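(* Let $X,Y$ be real Hilbert spaces and let $(L,A,B)$ satisfy (G1)-(G4) listed in the context; put $\mathbf X=X\times Y$, $\mathbf J=\begin{pmatrix}0&B\\-B'&0\end{pmatrix}$, $\mathbf L=\begin{pmatrix}L&0\\0&A\end{pmatrix}$, and let $E^c$ be the center subspace of $\mathbf{JL}$. The following hold under additional assumptions. i) If $A$ is injective on $\overline{R(B'LBA)}$, then $|e^{t\mathbf{JL}}|_{E^c}|\le M(1+t^2)$, $t\in\mathbb R$, for some $M>0$. ii) If $\overline{R(BA)}=X$, then $|e^{t\mathbf{JL}}|_{E^c}|\le M(1+|t|)$, $t\in\mathbb R$, for some $M>0$. iii) Suppose $\langle L\cdot,\cdot\rangle$ and $\langle A\cdot,\cdot\rangle$ are non-degenerate on $\overline{R(B)}$ and $\overline{R(B')}$, respectively. Then $|e^{t\mathbf{JL}}|_{E^c}|\le M$, $t\in\mathbb R$, for some $M>0$. Namely, there is Lyapunov stability on the center space $E^c$.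
   Context: Notation: $A'$ denotes the dual operator of a densely defined operator; $\langle\cdot,\cdot\rangle$ is the duality pairing; for a closed subspace $X_1\subset X$, $i_{X_1}:X_1\to X$ is the embedding and $\ker(i_{X_1})'=\{f\in X^*\mid\langle f,x\rangle=0\ \forall x\in X_1\}$. $R(\cdot)$ denotes the range. Assumptions. (G1) $B:Y^*\supset D(B)\to X$ and its dual $B':X^*\supset D(B')\to Y$ are densely defined and closed (thus $B''=B$). (G2) $A:Y\to Y^*$ is bounded and self-dual ($A'=A$), and there exist $\delta>0$ and a closed subspace $Y_+\subset Y$ with $Y=\ker A\oplus Y_+$, $\langle Au,u\rangle\ge\delta\|u\|_Y^2$ for all $u\in Y_+$. (G3) $L:X\to X^*$ is bounded and self-dual, and there is a direct sum decomposition into closed subspaces $X=X_-\oplus\ker L\oplus X_+$ with $n^-(L):=\dim X_-<\infty$, $\langle Lu,u\rangle<0$ for all $u\in X_-\setminus\{0\}$, and, for some $\delta>0$, $\langle Lu,u\rangle\ge\delta\|u\|^2$ for all $u\in X_+$. (G4) The subspaces $X_-,X_+$ in the decomposition $X=X_-\oplus\ker L\oplus X_+$ and the subspace $Y_+$ in the decomposition $Y=\ker A\oplus Y_+$ satisfy $\ker(i_{X_+\oplus X_-})'\subset D(B')$ and $\ker(i_{Y_+})'\subset D(B)$. Under (G1)-(G4), $\mathbf{JL}$ generates a $C^0$ group $e^{t\mathbf{JL}}$ on $\mathbf X$, and $\mathbf X=E^u\oplus E^c\oplus E^s$ with invariant closed subspaces, where $E^u$ (resp. $E^s$) is the finite dimensional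 span of the eigenvectors of $\mathbf{JL}$ with positive (resp. negative) eigenvalues, and $E^c=\{\mathbf u\in\mathbf X\mid\langle\mathbf{Lu},\mathbf v\rangle=0\ \forall\mathbf v\in E^s\oplus E^u\}$. A bounded symmetric form $b$ on a Banach space $W$ is non-degenerate if $v\mapsto b(\cdot,v)$ is an isomorphism from $W$ to $W^*$. *)

theory Defs
  imports "HOL-Analysis.Analysis"
begin

text \<open>The dual of a real normed space \<open>'a\<close> is \<open>'a \<Rightarrow>\<^sub>L real\<close>, with
  \<open>blinfun_apply f x\<close> as the duality pairing. An unbounded operator is given by a domain
  \<open>D\<close> and a total function whose values outside \<open>D\<close> are never used.\<close>

definition linear_operator_on :: "'a::real_vector set \<Rightarrow> ('a \<Rightarrow> 'b::real_vector) \<Rightarrow> bool" where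
  "linear_operator_on D T \<longleftrightarrow> subspace D \<and>
     (\<forall>x\<in>D. \<forall>y\<in>D. T (x + y) = T x + T y) \<and> (\<forall>c. \<forall>x\<in>D. T (c *\<^sub>R x) = c *\<^sub>R T x)"

definition densely_defined :: "'a::topological_space set \<Rightarrow> bool" where
  "densely_defined D \<longleftrightarrow> closure D = UNIV"

definition closed_operator ::
  "'a::topological_space set \<Rightarrow> ('a \<Rightarrow> 'b::topological_space) \<Rightarrow> bool" where
  "closed_operator D T \<longleftrightarrow> closed {(x, T x) | x. x \<in> D}"

text \<open>The dual of \<open>B : Y\<^sup>* \<supseteq> D \<rightarrow> X\<close>, with \<open>Y\<^sup>*\<^sup>*\<close> identified with
  the Hilbert space \<open>Y\<close> through the canonical embedding: \<open>f\<close> is in the domain iff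
  \<open>\<phi> \<mapsto> \<langle>f, B \<phi>\<rangle>\<close> agrees on \<open>D\<close> with evaluation at some \<open>y\<close>, and then
  \<open>B' f = y\<close>. This \<open>y\<close> is unique when \<open>D\<close> is dense.\<close>

definition dual_dom ::
  "('y::real_normed_vector \<Rightarrow>\<^sub>L real) set \<Rightarrow> (('y \<Rightarrow>\<^sub>L real) \<Rightarrow> 'x::real_normed_vector)
    \<Rightarrow> ('x \<Rightarrow>\<^sub>L real) set" where
  "dual_dom D B =
     {f. \<exists>y. \<forall>\<phi>\<in>D. blinfun_apply f (B \<phi>) = blinfun_apply \<phi> y}"

definition dual_op ::
  "('y::real_normed_vector \<Rightarrow>\<^sub>L real) set \<Rightarrow> (('y \<Rightarrow>\<^sub>L real) \<Rightarrow> 'x::real_normed_vector)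
    \<Rightarrow> ('x \<Rightarrow>\<^sub>L real) \<Rightarrow> 'y" where
  "dual_op D B f = (THE y. \<forall>\<phi>\<in>D. blinfun_apply f (B \<phi>) = blinfun_apply \<phi> y)"

text \<open>\<open>L' = L\<close> for bounded \<open>L : X \<rightarrow> X\<^sup>*\<close>, where \<open>L' : X\<^sup>*\<^sup>* = X \<rightarrow> X\<^sup>*\<close>.\<close>

definition self_dual :: "('a::real_normed_vector \<Rightarrow>\<^sub>L ('a \<Rightarrow>\<^sub>L real)) \<Rightarrow> bool" where
  "self_dual L \<longleftrightarrow> (\<forall>u v. blinfun_apply (blinfun_apply L u) v = blinfun_apply (blinfun_apply L v) u)"

definition ker :: "('a::real_normed_vector \<Rightarrow>\<^sub>L 'b::real_normed_vector) \<Rightarrow> 'a set" where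
  "ker L = {x. blinfun_apply L x = 0}"

definition closed_subspace :: "'a::real_normed_vector set \<Rightarrow> bool" where
  "closed_subspace S \<longleftrightarrow> subspace S \<and> closed S"

definition subspace_sum :: "'a::real_vector set \<Rightarrow> 'a set \<Rightarrow> 'a set" where
  "subspace_sum U V = {u + v | u v. u \<in> U \<and> v \<in> V}"

text \<open>The kernel of the dual \<open>(i\<^sub>S)'\<close> of the embedding of a subspace \<open>S\<close>.\<close>

definition annihilator :: "'a::real_normed_vector set \<Rightarrow> ('a \<Rightarrow>\<^sub>L real) set" where
  "annihilator S = {f. \<forall>x\<in>S. blinfun_apply f x = 0}"


definition G1 ::
  "('y::{real_inner,complete_space} \<Rightarrow>\<^sub>L real) set
    \<Rightarrow> (('y \<Rightarrow>\<^sub>L real) \<Rightarrow> 'x::{real_inner,complete_space}) \<Rightarrow> bool" where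
  "G1 D B \<longleftrightarrow> linear_operator_on D B \<and>
     densely_defined D \<and> closed_operator D B \<and>
     densely_defined (dual_dom D B) \<and> closed_operator (dual_dom D B) (dual_op D B)"

definition G2 ::
  "('y::{real_inner,complete_space} \<Rightarrow>\<^sub>L ('y \<Rightarrow>\<^sub>L real)) \<Rightarrow> 'y set \<Rightarrow> bool" where
  "G2 A Yp \<longleftrightarrow> self_dual A \<and> closed_subspace Yp \<and>
     bij_betw (\<lambda>(u, v). u + v) (ker A \<times> Yp) UNIV \<and>
     (\<exists>\<delta>>0. \<forall>u\<in>Yp. blinfun_apply (blinfun_apply A u) u \<ge> \<delta> * (norm u)\<^sup>2)"

definition G3 ::
  "('x::{real_inner,complete_space} \<Rightarrow>\<^sub>L ('x \<Rightarrow>\<^sub>L real)) \<Rightarrow> 'x set \<Rightarrow> 'x set \<Rightarrow> bool" where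
  "G3 L Xm Xp \<longleftrightarrow> self_dual L \<and> closed_subspace Xm \<and> closed_subspace Xp \<and>
     bij_betw (\<lambda>(u, v, w). u + v + w) (Xm \<times> ker L \<times> Xp) UNIV \<and>
     (\<exists>b. finite b \<and> span b = Xm) \<and>
     (\<forall>u\<in>Xm - {0}. blinfun_apply (blinfun_apply L u) u < 0) \<and>
     (\<exists>\<delta>>0. \<forall>u\<in>Xp. blinfun_apply (blinfun_apply L u) u \<ge> \<delta> * (norm u)\<^sup>2)"

definition G4 ::
  "('y::{real_inner,complete_space} \<Rightarrow>\<^sub>L real) set
    \<Rightarrow> (('y \<Rightarrow>\<^sub>L real) \<Rightarrow> 'x::{real_inner,complete_space})
    \<Rightarrow> 'x set \<Rightarrow> 'x set \<Rightarrow> 'y set \<Rightarrow> bool" where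
  "G4 D B Xm Xp Yp \<longleftrightarrow>
     annihilator (subspace_sum Xp Xm) \<subseteq> dual_dom D B \<and> annihilator Yp \<subseteq> D"


text \<open>The operators on \<open>X \<times> Y\<close>; its dual is written \<open>X\<^sup>* \<times> Y\<^sup>*\<close>, with pairing
  \<open>\<langle>(f, g), (x, y)\<rangle> = \<langle>f, x\<rangle> + \<langle>g, y\<rangle>\<close>.\<close>

definition J_dom ::
  "('y::real_normed_vector \<Rightarrow>\<^sub>L real) set \<Rightarrow> (('y \<Rightarrow>\<^sub>L real) \<Rightarrow> 'x::real_normed_vector)
    \<Rightarrow> (('x \<Rightarrow>\<^sub>L real) \<times> ('y \<Rightarrow>\<^sub>L real)) set" where
  "J_dom D B = dual_dom D B \<times> D"

definition J_op ::
  "('y::real_normed_vector \<Rightarrow>\<^sub>L real) set \<Rightarrow> (('y \<Rightarrow>\<^sub>L real) \<Rightarrow> 'x::real_normed_vector)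
    \<Rightarrow> ('x \<Rightarrow>\<^sub>L real) \<times> ('y \<Rightarrow>\<^sub>L real) \<Rightarrow> 'x \<times> 'y" where
  "J_op D B = (\<lambda>(f, g). (B g, - dual_op D B f))"

definition L_op ::
  "('x::real_normed_vector \<Rightarrow>\<^sub>L ('x \<Rightarrow>\<^sub>L real)) \<Rightarrow> ('y::real_normed_vector \<Rightarrow>\<^sub>L ('y \<Rightarrow>\<^sub>L real))
    \<Rightarrow> 'x \<times> 'y \<Rightarrow> ('x \<Rightarrow>\<^sub>L real) \<times> ('y \<Rightarrow>\<^sub>L real)" where
  "L_op L A = (\<lambda>(x, y). (blinfun_apply L x, blinfun_apply A y))"

definition pairing ::
  "('x::real_normed_vector \<Rightarrow>\<^sub>L real) \<times> ('y::real_normed_vector \<Rightarrow>\<^sub>L real) \<Rightarrow> 'x \<times> 'y \<Rightarrow> real" where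
  "pairing = (\<lambda>(f, g) (x, y). blinfun_apply f x + blinfun_apply g y)"

definition JL_dom ::
  "('x::real_normed_vector \<Rightarrow>\<^sub>L ('x \<Rightarrow>\<^sub>L real)) \<Rightarrow> ('y::real_normed_vector \<Rightarrow>\<^sub>L ('y \<Rightarrow>\<^sub>L real))
    \<Rightarrow> ('y \<Rightarrow>\<^sub>L real) set \<Rightarrow> (('y \<Rightarrow>\<^sub>L real) \<Rightarrow> 'x) \<Rightarrow> ('x \<times> 'y) set" where
  "JL_dom L A D B = {u. L_op L A u \<in> J_dom D B}"

definition JL_op ::
  "('x::real_normed_vector \<Rightarrow>\<^sub>L ('x \<Rightarrow>\<^sub>L real)) \<Rightarrow> ('y::real_normed_vector \<Rightarrow>\<^sub>L ('y \<Rightarrow>\<^sub>L real))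
    \<Rightarrow> ('y \<Rightarrow>\<^sub>L real) set \<Rightarrow> (('y \<Rightarrow>\<^sub>L real) \<Rightarrow> 'x) \<Rightarrow> 'x \<times> 'y \<Rightarrow> 'x \<times> 'y" where
  "JL_op L A D B u = J_op D B (L_op L A u)"


definition C0_group :: "(real \<Rightarrow> 'a::real_normed_vector \<Rightarrow>\<^sub>L 'a) \<Rightarrow> bool" where
  "C0_group T \<longleftrightarrow> T 0 = id_blinfun \<and> (\<forall>s t. T (s + t) = T s o\<^sub>L T t) \<and>
     (\<forall>z. continuous_on UNIV (\<lambda>t. blinfun_apply (T t) z))"

text \<open>\<open>T\<close> is the group \<open>e\<^sup>t\<^sup>G\<close>: its infinitesimal generator is exactly \<open>G\<close> with domain
  \<open>D\<close>. A \<open>C\<^sup>0\<close> group is determined by its generator.\<close>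

definition generates_C0_group ::
  "'a::real_normed_vector set \<Rightarrow> ('a \<Rightarrow> 'a) \<Rightarrow> (real \<Rightarrow> 'a \<Rightarrow>\<^sub>L 'a) \<Rightarrow> bool" where
  "generates_C0_group D G T \<longleftrightarrow> C0_group T \<and>
     (\<forall>z w. ((\<lambda>h. (1 / h) *\<^sub>R (blinfun_apply (T h) z - z)) \<longlongrightarrow> w) (at 0) \<longleftrightarrow> z \<in> D \<and> w = G z)"

definition eigenvector_for :: "'a::real_vector set \<Rightarrow> ('a \<Rightarrow> 'a) \<Rightarrow> real \<Rightarrow> 'a \<Rightarrow> bool" where
  "eigenvector_for D G \<mu> z \<longleftrightarrow> z \<in> D \<and> z \<noteq> 0 \<and> G z = \<mu> *\<^sub>R z"

definition E_u :: "'a::real_vector set \<Rightarrow> ('a \<Rightarrow> 'a) \<Rightarrow> 'a set" where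
  "E_u D G = span {z. \<exists>\<mu>>0. eigenvector_for D G \<mu> z}"

definition E_s :: "'a::real_vector set \<Rightarrow> ('a \<Rightarrow> 'a) \<Rightarrow> 'a set" where
  "E_s D G = span {z. \<exists>\<mu><0. eigenvector_for D G \<mu> z}"

definition E_c ::
  "('x::real_normed_vector \<Rightarrow>\<^sub>L ('x \<Rightarrow>\<^sub>L real)) \<Rightarrow> ('y::real_normed_vector \<Rightarrow>\<^sub>L ('y \<Rightarrow>\<^sub>L real))
    \<Rightarrow> ('y \<Rightarrow>\<^sub>L real) set \<Rightarrow> (('y \<Rightarrow>\<^sub>L real) \<Rightarrow> 'x) \<Rightarrow> ('x \<times> 'y) set" where
  "E_c L A D B =
     {u. \<forall>v \<in> subspace_sum (E_s (JL_dom L A D B) (JL_op L A D B))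
                            (E_u (JL_dom L A D B) (JL_op L A D B)).
           pairing (L_op L A u) v = 0}"


text \<open>Ranges of the unbounded compositions \<open>BA\<close> and \<open>B'LBA\<close> on their natural domains.\<close>

definition range_BA ::
  "('y::real_normed_vector \<Rightarrow>\<^sub>L ('y \<Rightarrow>\<^sub>L real))
    \<Rightarrow> ('y \<Rightarrow>\<^sub>L real) set \<Rightarrow> (('y \<Rightarrow>\<^sub>L real) \<Rightarrow> 'x) \<Rightarrow> 'x set" where
  "range_BA A D B = {B (blinfun_apply A y) | y. blinfun_apply A y \<in> D}"

definition range_BLBA ::
  "('x::real_normed_vector \<Rightarrow>\<^sub>L ('x \<Rightarrow>\<^sub>L real)) \<Rightarrow> ('y::real_normed_vector \<Rightarrow>\<^sub>L ('y \<Rightarrow>\<^sub>L real))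
    \<Rightarrow> ('y \<Rightarrow>\<^sub>L real) set \<Rightarrow> (('y \<Rightarrow>\<^sub>L real) \<Rightarrow> 'x) \<Rightarrow> 'y set" where
  "range_BLBA L A D B =
     {dual_op D B (blinfun_apply L (B (blinfun_apply A y))) | y.
        blinfun_apply A y \<in> D \<and> blinfun_apply L (B (blinfun_apply A y)) \<in> dual_dom D B}"


text \<open>The dual of a subspace \<open>W\<close> that is a set rather than a type: bounded linear functionals
  on \<open>W\<close>, represented by functions with the fixed value \<open>undefined\<close> off \<open>W\<close>.\<close>

definition dual_of :: "'a::real_normed_vector set \<Rightarrow> ('a \<Rightarrow> real) set" where
  "dual_of W = {f \<in> extensional W. linear_operator_on W f \<and> (\<exists>K. \<forall>x\<in>W. \<bar>f x\<bar> \<le> K * norm x)}"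

definition dual_norm :: "'a::real_normed_vector set \<Rightarrow> ('a \<Rightarrow> real) \<Rightarrow> real" where
  "dual_norm W f = (SUP x\<in>{x\<in>W. norm x \<le> 1}. \<bar>f x\<bar>)"

text \<open>Non-degeneracy on \<open>W\<close> of a bounded symmetric bilinear form \<open>b\<close>: the (automatically linear)
  map \<open>v \<mapsto> b(\<cdot>, v)\<close> is an isomorphism of \<open>W\<close> onto its dual, i.e. a bijection bounded in
  both directions.\<close>

definition nondegenerate_on :: "'a::real_normed_vector set \<Rightarrow> ('a \<Rightarrow> 'a \<Rightarrow> real) \<Rightarrow> bool" where
  "nondegenerate_on W b \<longleftrightarrow>
     bij_betw (\<lambda>v. restrict (\<lambda>u. b u v) W) W (dual_of W) \<and>
     (\<exists>c>0. \<exists>C. \<forall>v\<in>W. c * norm v \<le> dual_norm W (restrict (\<lambda>u. b u v) W) \<and>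
                      dual_norm W (restrict (\<lambda>u. b u v) W) \<le> C * norm v)"

end

theory Submission
  imports Defs
begin

text \<open>Write \<open>X\<^sup>c \<times> Y\<^sup>c\<close> for the center space; it splits because \<open>(x, y) \<mapsto> (x, -y)\<close> reverses time.
  The key point is that \<open>\<langle>L \<cdot>, \<cdot>\<rangle>\<close> is nonnegative on \<open>BA(Y\<^sup>c)\<close>. Otherwise the cosine family
  \<open>C(t) = (e\<^sup>t\<^sup>J\<^sup>L + e\<^sup>-\<^sup>t\<^sup>J\<^sup>L) / 2\<close>, acting on \<open>Y\<^sup>c / ker A\<close> with the inner product \<open>\<langle>A \<cdot>, \<cdot>\<rangle>\<close>, would for
  some \<open>t\<close> be a bounded self-adjoint operator not below 1; its part above 1 is compact since \<open>L\<close> has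
  finite Morse index, so there is an eigenvalue \<open>cosh(rt)\<close>. Halving \<open>t\<close> and the d'Alembert
  equation give \<open>C(s) = cosh(rs)\<close> on the eigenvector for all \<open>s\<close>, hence eigenvalues \<open>\<plusminus>r\<close> of \<open>JL\<close> with
  eigenvectors in the center space, which is absurd.

  The displacement \<open>x(t) - x(0) = BA \<integral> y\<close> lies in \<open>BA(Y\<^sup>c)\<close>, so conservation of energy controls
  \<open>\<langle>Ay, y\<rangle>\<close>, with linear growth from the finitely many negative directions of \<open>L\<close>. The components
  in \<open>ker L\<close> and \<open>ker A\<close> are driven by bounded functionals of \<open>Ay\<close> and \<open>Lx\<close> and cost one more
  integration; under (i) the driving of \<open>ker A\<close> vanishes on the isotropic directions. Under (ii) and (iii)
  the energy is nonnegative on the center space modulo the kernel, respectively coercive on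
  the closed range.\<close>

section \<open>Forms and functionals on Hilbert spaces\<close>

text \<open>The operator of the second order equation for \<open>y\<close> is unbounded, whereas
  \<open>Cos (2 * t)\<close> is bounded and everywhere defined; \<open>lf_Sin\<close> turns a
  negative value of L on a displacement into a Rayleigh quotient of \<open>Cos (2 * t)\<close> above
  1, so the spectral step is a minimisation for bounded forms. The negative directions of L are
  measured by functionals \<open>g e\<close> in \<open>Dd\<close> rather than by the projection to
  \<open>Xm\<close>. (G4) and the density of \<open>Dd\<close> permit this choice, and then
  \<open>g e\<close> of B A y is the value of A y at the fixed vector B' (g e). This device serves
  three times: for compactness in the minimisation, in place of a dimension count for
  \<open>Eu\<close>, and to bound displacements by the integrated velocity. On displacements L is
  only semidefinite. \<open>drop_finitely_many_functionals\<close> turns a statement about null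
  sequences into an estimate by the seminorm alone. Displacements need not lie in the domain of B'
  L, which is why its part in ker A is first extended to all of X by means of
  \<open>kap\<close>.\<close>

lemma quadratic_nonneg_imp_zero:
  fixes a b :: real
  assumes "0 \<le> b" and "\<And>s. 0 \<le> 2 * s * a + s\<^sup>2 * b"
  shows "a = 0"
proof (rule ccontr)
  assume "a \<noteq> 0"
  \<comment> \<open>Tested at -a / (1 + b) rather than at the vertex -a / b, so that b = 0 needs no
    separate case.\<close>
  have "2 * (- a / (1 + b)) * a + (- a / (1 + b))\<^sup>2 * b = - (a\<^sup>2 * (2 + b) / (1 + b)\<^sup>2)"
    using \<open>0 \<le> b\<close> by (simp add: divide_simps power2_eq_square) (simp add: algebra_simps)
  moreover have "0 < a\<^sup>2 * (2 + b) / (1 + b)\<^sup>2"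
    using \<open>a \<noteq> 0\<close> \<open>0 \<le> b\<close> by (intro divide_pos_pos mult_pos_pos) auto
  ultimately show False using assms(2)[of "- a / (1 + b)"] by linarith
qed

lemma form_add_scaled:
  assumes "bounded_bilinear \<beta>" and "\<And>u v. \<beta> u v = \<beta> v u"
  shows "\<beta> (u + s *\<^sub>R w) (u + s *\<^sub>R w) = \<beta> u u + 2 * s * \<beta> u w + s\<^sup>2 * (\<beta> w w :: real)"
proof -
  interpret b: bounded_bilinear \<beta> by fact
  show ?thesis
    by (simp add: b.add_left b.add_right b.scaleR_left b.scaleR_right assms(2)[of w u]
        power2_eq_square algebra_simps)
qed

text \<open>Discriminant argument on a subspace, because L is semidefinite only on suitable
  subspaces and may have null vectors there. For a null \<open>v\<close> the quadratic in
  \<open>s\<close> becomes affine, and an affine function that is bounded below is constant.\<close>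

lemma form_Cauchy_Schwarz:
  fixes \<beta> :: "'a::real_normed_vector \<Rightarrow> 'a \<Rightarrow> real"
  assumes bb: "bounded_bilinear \<beta>" and sym: "\<And>u v. \<beta> u v = \<beta> v u"
    and V: "subspace V" and psd: "\<And>u. u \<in> V \<Longrightarrow> 0 \<le> \<beta> u u"
    and u: "u \<in> V" and v: "v \<in> V"
  shows "(\<beta> u v)\<^sup>2 \<le> \<beta> u u * \<beta> v v"
proof -
  have q: "0 \<le> \<beta> u u + 2 * s * \<beta> u v + s\<^sup>2 * \<beta> v v" for s
    using psd[of "u + s *\<^sub>R v"] form_add_scaled[OF bb sym, of u s v] V u v
    by (simp add: subspace_add subspace_scale)
  show ?thesis
  proof (cases "\<beta> v v = 0")
    case True
    have "\<beta> u v = 0"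
    proof (rule ccontr)
      assume n: "\<beta> u v \<noteq> 0"
      have "0 \<le> \<beta> u u + 2 * (- (\<beta> u u + 1) / \<beta> u v) * \<beta> u v"
        using q[of "- (\<beta> u u + 1) / \<beta> u v"] True by simp
      then show False using n psd[OF u] by simp
    qed
    then show ?thesis using True by simp
  next
    case False
    then have p: "0 < \<beta> v v" using psd[OF v] by simp
    have "\<beta> u u + 2 * (- \<beta> u v / \<beta> v v) * \<beta> u v + (- \<beta> u v / \<beta> v v)\<^sup>2 * \<beta> v v
        = \<beta> u u - (\<beta> u v)\<^sup>2 / \<beta> v v"
      using p by (simp add: divide_simps power2_eq_square)
    then have "(\<beta> u v)\<^sup>2 / \<beta> v v \<le> \<beta> u u" using q[of "- \<beta> u v / \<beta> v v"] by simp
    then show ?thesis using p by (simp add: divide_le_eq)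
  qed
qed

lemma form_Cauchy_Schwarz_sqrt:
  fixes \<beta> :: "'a::real_normed_vector \<Rightarrow> 'a \<Rightarrow> real"
  assumes "bounded_bilinear \<beta>" "\<And>u v. \<beta> u v = \<beta> v u"
    and "subspace V" "\<And>u. u \<in> V \<Longrightarrow> 0 \<le> \<beta> u u" "u \<in> V" "v \<in> V"
  shows "\<bar>\<beta> u v\<bar> \<le> sqrt (\<beta> u u) * sqrt (\<beta> v v)"
  using form_Cauchy_Schwarz[OF assms] real_sqrt_le_mono[of "(\<beta> u v)\<^sup>2" "\<beta> u u * \<beta> v v"]
  by (simp add: real_sqrt_mult)

lemma form_seminorm_triangle:
  fixes \<beta> :: "'a::real_normed_vector \<Rightarrow> 'a \<Rightarrow> real"
  assumes bb: "bounded_bilinear \<beta>" and sym: "\<And>u v. \<beta> u v = \<beta> v u"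
    and V: "subspace V" and psd: "\<And>u. u \<in> V \<Longrightarrow> 0 \<le> \<beta> u u" and u: "u \<in> V" and v: "v \<in> V"
  shows "sqrt (\<beta> (u + v) (u + v)) \<le> sqrt (\<beta> u u) + sqrt (\<beta> v v)"
proof (rule real_le_lsqrt)
  have "\<beta> (u + v) (u + v) = \<beta> u u + 2 * \<beta> u v + \<beta> v v"
    using form_add_scaled[OF bb sym, of u 1 v] by simp
  also have "\<dots> \<le> \<beta> u u + 2 * (sqrt (\<beta> u u) * sqrt (\<beta> v v)) + \<beta> v v"
    using form_Cauchy_Schwarz_sqrt[OF assms] by simp
  also have "\<dots> = (sqrt (\<beta> u u) + sqrt (\<beta> v v))\<^sup>2"
    using psd[OF u] psd[OF v] by (simp add: power2_sum)
  finally show "\<beta> (u + v) (u + v) \<le> (sqrt (\<beta> u u) + sqrt (\<beta> v v))\<^sup>2" .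
qed (use psd u v in simp)

text \<open>Ritz's minimisation of \<open>\<beta> v v - 2 f v\<close>: the parallelogram identity makes minimising
  sequences Cauchy.\<close>

lemma coercive_form_represents:
  fixes \<beta> :: "'a::{real_normed_vector,complete_space} \<Rightarrow> 'a \<Rightarrow> real"
  assumes bb: "bounded_bilinear \<beta>" and sym: "\<And>u v. \<beta> u v = \<beta> v u"
    and S: "closed_subspace S" and \<delta>: "0 < \<delta>"
    and co: "\<And>u. u \<in> S \<Longrightarrow> \<delta> * (norm u)\<^sup>2 \<le> \<beta> u u"
    and f: "bounded_linear f"
  obtains u where "u \<in> S" "\<And>w. w \<in> S \<Longrightarrow> \<beta> u w = f w"
proof -
  interpret b: bounded_bilinear \<beta> by fact
  interpret f: bounded_linear f by fact
  have sub: "subspace S" and cl: "closed S" using S by (auto simp: closed_subspace_def)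
  define J where "J v = \<beta> v v - 2 * f v" for v
  obtain K where K: "\<And>v. \<bar>f v\<bar> \<le> norm v * K" using f.bounded by auto
  \<comment> \<open>Completing the square in delta |v|^2 - 2 K |v|.\<close>
  have Jlow: "- (K\<^sup>2 / \<delta>) \<le> J v" if "v \<in> S" for v
  proof -
    have "0 \<le> \<delta> * (norm v - K / \<delta>)\<^sup>2" using \<delta> by simp
    also have "\<dots> = \<delta> * (norm v)\<^sup>2 - 2 * (norm v * K) + K\<^sup>2 / \<delta>"
      using \<delta> by (simp add: power2_eq_square field_simps)
    finally show ?thesis using co[OF that] K[of v] unfolding J_def by linarith
  qed
  define m where "m = Inf (J ` S)"
  have "0 \<in> S" using sub by (rule subspace_0)
  have bdd: "bdd_below (J ` S)" using Jlow by (auto intro!: bdd_belowI2)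
  have mle: "m \<le> J v" if "v \<in> S" for v
    unfolding m_def using bdd that by (rule cINF_lower)
  have "\<exists>v\<in>S. J v < m + 1 / real (Suc n)" for n
  proof (rule ccontr)
    assume "\<not> ?thesis"
    then have "m + 1 / real (Suc n) \<le> m" unfolding m_def
      using \<open>0 \<in> S\<close> by (intro cINF_greatest) (auto simp: m_def not_less)
    then show False by simp
  qed
  then obtain v where v: "\<And>n. v n \<in> S" "\<And>n. J (v n) < m + 1 / real (Suc n)" by metis
  have par: "\<delta> * (norm (x - y))\<^sup>2 \<le> 2 * (J x - m) + 2 * (J y - m)" if "x \<in> S" "y \<in> S" for x y
  proof -
    have "(1/2) *\<^sub>R (x + y) \<in> S" "x - y \<in> S"
      using that sub by (auto intro: subspace_add subspace_scale subspace_diff)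
    moreover have "J ((1/2) *\<^sub>R (x + y)) = J x / 2 + J y / 2 - \<beta> (x - y) (x - y) / 4"
      unfolding J_def by (simp add: b.add_left b.add_right b.diff_left b.diff_right b.scaleR_left
        b.scaleR_right f.add f.scaleR sym[of y x] field_simps)
    ultimately show ?thesis using mle co[of "x - y"] by fastforce
  qed
  have "Cauchy v"
  proof (rule metric_CauchyI)
    fix e :: real assume "0 < e"
    obtain N where N: "4 / (\<delta> * e\<^sup>2) < real (Suc N)" 
      using reals_Archimedean2[of "4 / (\<delta> * e\<^sup>2)"] by (metis less_trans of_nat_less_iff lessI)
    have "dist (v i) (v j) < e" if "i \<ge> N" "j \<ge> N" for i j
    proof -
      have s: "1 / real (Suc k) \<le> 1 / real (Suc N)" if "k \<ge> N" for k
        using that by (simp add: field_simps)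
      have "\<delta> * (norm (v i - v j))\<^sup>2 \<le> 2 * (J (v i) - m) + 2 * (J (v j) - m)"
        using par v by blast
      also have "\<dots> < 2 * (1 / real (Suc N)) + 2 * (1 / real (Suc N))"
      proof -
        have "J (v k) - m < 1 / real (Suc N)" if "k \<ge> N" for k
          using less_le_trans[OF v(2)[of k] add_left_mono[OF s[OF that]]] by (simp only: less_diff_eq add.commute)
        then show ?thesis using that by (intro add_strict_mono mult_strict_left_mono) auto
      qed
      also have "\<dots> = 4 / real (Suc N)" by simp
      also have "\<dots> < \<delta> * e\<^sup>2"
        using N \<delta> \<open>0 < e\<close> by (simp only: pos_divide_less_eq mult_pos_pos zero_less_power of_nat_0_less_iff zero_less_Suc mult.commute)
      finally have "(norm (v i - v j))\<^sup>2 < e\<^sup>2" using \<delta> by simp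
      then show ?thesis using \<open>0 < e\<close> by (simp add: dist_norm power2_less_imp_less)
    qed
    then show "\<exists>M. \<forall>m\<ge>M. \<forall>n\<ge>M. dist (v m) (v n) < e" by blast
  qed
  then obtain u where u: "v \<longlonglongrightarrow> u" using Cauchy_convergent convergent_def by blast
  have uS: "u \<in> S" using closed_sequentially[OF cl _ u] v by blast
  have "(\<lambda>n. J (v n)) \<longlonglongrightarrow> J u" unfolding J_def
    by (intro tendsto_intros b.tendsto f.tendsto u)
  moreover have "(\<lambda>n. m + 1 / real (Suc n)) \<longlonglongrightarrow> m + 0"
    by (intro tendsto_intros LIMSEQ_Suc[OF lim_const_over_n])
  ultimately have "J u \<le> m + 0"
    by (rule LIMSEQ_le) (use v(2) less_imp_le in blast)
  then have Ju: "J u = m" using mle[OF uS] by simp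
  have "\<beta> u w = f w" if w: "w \<in> S" for w
  proof -
    have "0 \<le> 2 * s * (\<beta> u w - f w) + s\<^sup>2 * \<beta> w w" for s
    proof -
      have "u + s *\<^sub>R w \<in> S" using uS w sub by (simp add: subspace_add subspace_scale)
      then have "J u \<le> J (u + s *\<^sub>R w)" using mle Ju by simp
      then show ?thesis unfolding J_def form_add_scaled[OF bb sym]
        by (simp add: f.add f.scaleR algebra_simps)
    qed
    moreover have "0 \<le> \<beta> w w" using co[OF w] \<delta> by (smt (verit) mult_nonneg_nonneg zero_le_power2)
    ultimately show ?thesis using quadratic_nonneg_imp_zero by fastforce
  qed
  then show ?thesis using that uS by blast
qed

lemma Riesz_representation:
  fixes f :: "'a::{real_inner,complete_space} \<Rightarrow> real"
  assumes "bounded_linear f"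
  obtains u where "\<And>w. f w = inner u w"
proof -
  obtain u :: 'a where "u \<in> UNIV" "\<And>w. w \<in> UNIV \<Longrightarrow> inner u w = f w"
    by (rule coercive_form_represents[OF bounded_bilinear_inner inner_commute _ zero_less_one _ assms, of UNIV])
       (auto simp: closed_subspace_def power2_norm_eq_inner)
  then have "f w = inner u w" for w by simp
  then show ?thesis by (rule that)
qed

lemma orthogonal_projection_exists:
  fixes S :: "'a::{real_inner,complete_space} set"
  assumes "closed_subspace S"
  obtains p where "p \<in> S" "\<And>w. w \<in> S \<Longrightarrow> inner (x - p) w = 0"
proof -
  obtain u where "u \<in> S" "\<And>w. w \<in> S \<Longrightarrow> inner u w = inner x w"
    by (rule coercive_form_represents[OF bounded_bilinear_inner inner_commute assms zero_less_one _
          bounded_linear_inner_right, of x])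
       (auto simp: power2_norm_eq_inner)
  then show ?thesis using that[of u] by (simp add: inner_diff_left)
qed

section \<open>Uniform boundedness\<close>

text \<open>Gliding hump.\<close>

lemma uniform_boundedness:
  fixes F :: "('a::{real_normed_vector,complete_space} \<Rightarrow>\<^sub>L 'b::real_normed_vector) set"
  assumes pb: "\<And>x. \<exists>K. \<forall>T\<in>F. norm (blinfun_apply T x) \<le> K"
  obtains K where "\<And>T. T \<in> F \<Longrightarrow> norm T \<le> K"
proof (rule ccontr)
  assume "\<not> thesis"
  then have big: "\<exists>T\<in>F. K < norm T" for K using that not_less by metis
  \<comment> \<open>Since 2 T h = T (x + h) - T (x - h), one of x + h and x - h has an image at
    least as large as that of h. The factor 2/3 replaces 1 because the operator norm need not be
    attained.\<close>
  have step: "\<exists>y. norm (y - x) \<le> r \<and> 2/3 * r * norm T \<le> norm (blinfun_apply T y)"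
    if "0 < r" for T :: "'a \<Rightarrow>\<^sub>L 'b" and x r
  proof (cases "norm T = 0")
    case True then show ?thesis using that by (intro exI[of _ x]) simp
  next
    case False
    obtain \<xi> where \<xi>: "2/3 * norm T * norm \<xi> < norm (blinfun_apply T \<xi>)"
    proof (rule ccontr)
      assume "\<not> thesis"
      then have "norm (blinfun_apply T \<xi>) \<le> 2/3 * norm T * norm \<xi>" for \<xi> using that not_less by blast
      then have "norm T \<le> 2/3 * norm T" by (intro norm_blinfun_bound) auto
      then show False using False by simp
    qed
    then have "norm \<xi> > 0" by (cases "\<xi> = 0") auto
    define h where "h = (r / norm \<xi>) *\<^sub>R \<xi>"
    have nh: "norm h = r" using \<open>norm \<xi> > 0\<close> \<open>0 < r\<close> by (simp add: h_def)
    have "2/3 * r * norm T = (r / norm \<xi>) * (2/3 * norm T * norm \<xi>)"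
      using \<open>norm \<xi> > 0\<close> by simp
    also have "\<dots> \<le> (r / norm \<xi>) * norm (blinfun_apply T \<xi>)"
      using \<xi> \<open>norm \<xi> > 0\<close> \<open>0 < r\<close> by (intro mult_left_mono) auto
    also have "\<dots> = norm (blinfun_apply T h)"
      using \<open>0 < r\<close> by (simp add: h_def blinfun.scaleR_right)
    finally have Th: "2/3 * r * norm T \<le> norm (blinfun_apply T h)" .
    have "2 * norm (blinfun_apply T h) = norm (blinfun_apply T (x + h) - blinfun_apply T (x - h))"
      by (simp add: blinfun.add_right blinfun.diff_right scaleR_2[symmetric])
    also have "\<dots> \<le> norm (blinfun_apply T (x + h)) + norm (blinfun_apply T (x - h))"
      by (rule norm_triangle_ineq4)
    finally have "norm (blinfun_apply T h) \<le> norm (blinfun_apply T (x + h)) \<or>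
      norm (blinfun_apply T h) \<le> norm (blinfun_apply T (x - h))" by linarith
    then show ?thesis
    proof
      assume "norm (blinfun_apply T h) \<le> norm (blinfun_apply T (x + h))"
      then show ?thesis using Th nh by (intro exI[of _ "x + h"]) auto
    next
      assume "norm (blinfun_apply T h) \<le> norm (blinfun_apply T (x - h))"
      then show ?thesis using Th nh by (intro exI[of _ "x - h"]) auto
    qed
  qed
  \<comment> \<open>Radii shrinking by the factor 3 keep all moves after step n within r n / 2, so
    that of the gained 2/3 * r n * |T n| one sixth survives at the limit point; hence the 6 in the
    choice of \<open>T\<close>.\<close>
  define r :: "nat \<Rightarrow> real" where "r n = (1/3) ^ Suc n" for n
  have rpos: "0 < r n" for n by (simp add: r_def)
  have "\<forall>n. \<exists>T\<in>F. 6 * real (Suc n) / r n < norm T" using big by blast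
  then obtain T where T: "\<And>n. T n \<in> F" "\<And>n. 6 * real (Suc n) / r n < norm (T n)" by metis
  have "\<forall>n x. \<exists>y. norm (y - x) \<le> r n \<and> 2/3 * r n * norm (T n) \<le> norm (blinfun_apply (T n) y)"
    using step rpos by blast
  then obtain s where s: "\<And>n x. norm (s n x - x) \<le> r n"
    "\<And>n x. 2/3 * r n * norm (T n) \<le> norm (blinfun_apply (T n) (s n x))" by metis
  define x where "x = rec_nat 0 (\<lambda>n y. s n y)"
  have xS: "x (Suc n) = s n (x n)" for n by (simp add: x_def)
  have d: "norm (x (n + k) - x n) \<le> (3 * r n - 3 * r (n + k)) / 2" for n k
  proof (induction k)
    case (Suc k)
    have "norm (x (n + Suc k) - x n) \<le> norm (x (Suc (n + k)) - x (n + k)) + norm (x (n + k) - x n)"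
      using norm_triangle_ineq[of "x (Suc (n + k)) - x (n + k)" "x (n + k) - x n"] by simp
    also have "\<dots> \<le> r (n + k) + (3 * r n - 3 * r (n + k)) / 2" using Suc s(1) xS by (simp add: add_mono)
    also have "\<dots> = (3 * r n - 3 * r (n + Suc k)) / 2" by (simp add: r_def field_simps)
    finally show ?case .
  qed simp
  have d2: "norm (x m - x n) \<le> 3 * r n / 2" if "n \<le> m" for m n
    using d[of n "m - n"] that rpos[of m] by simp
  have r0: "r \<longlonglongrightarrow> 0" unfolding r_def by (intro LIMSEQ_Suc LIMSEQ_realpow_zero) auto
  have "Cauchy x"
  proof (rule metric_CauchyI)
    fix e :: real assume "0 < e"
    obtain N where N: "r N < e / 3" using order_tendstoD(2)[OF r0, of "e / 3"] \<open>0 < e\<close>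
      by (auto simp: eventually_sequentially)
    have "dist (x i) (x j) < e" if "i \<ge> N" "j \<ge> N" for i j
    proof -
      have "dist (x i) (x j) \<le> norm (x i - x N) + norm (x j - x N)"
        using dist_triangle2[of "x i" "x j" "x N"] by (simp add: dist_norm)
      also have "\<dots> < e" using d2[OF that(1)] d2[OF that(2)] N by linarith
      finally show ?thesis .
    qed
    then show "\<exists>M. \<forall>m\<ge>M. \<forall>n\<ge>M. dist (x m) (x n) < e" by blast
  qed
  then obtain l where l: "x \<longlonglongrightarrow> l" using Cauchy_convergent convergent_def by blast
  obtain K where K: "\<And>T. T \<in> F \<Longrightarrow> norm (blinfun_apply T l) \<le> K" using pb by blast
  have "real (Suc n) \<le> K" for n
  proof -
    have "(\<lambda>m. norm (x m - x (Suc n))) \<longlonglongrightarrow> norm (l - x (Suc n))"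
      by (intro tendsto_intros l)
    then have "norm (l - x (Suc n)) \<le> 3 * r (Suc n) / 2"
      by (rule LIMSEQ_le_const2) (use d2 in blast)
    then have "norm (l - x (Suc n)) \<le> r n / 2" by (simp add: r_def)
    then have "norm (blinfun_apply (T n) (l - x (Suc n))) \<le> norm (T n) * (r n / 2)"
      by (meson mult_left_mono norm_blinfun norm_ge_zero order_trans)
    moreover have "2/3 * r n * norm (T n) \<le> norm (blinfun_apply (T n) (x (Suc n)))"
      using s(2) xS by simp
    moreover have "norm (blinfun_apply (T n) (x (Suc n))) \<le>
        norm (blinfun_apply (T n) l) + norm (blinfun_apply (T n) (l - x (Suc n)))"
      by (metis blinfun.diff_right norm_triangle_sub norm_minus_commute)
    ultimately have "norm (T n) * r n / 6 \<le> norm (blinfun_apply (T n) l)" by (simp add: algebra_simps)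
    also have "\<dots> \<le> K" using K T by blast
    finally show ?thesis using T(2)[of n] rpos[of n] by (simp add: field_simps)
  qed
  then have "real n \<le> K" for n by (smt (verit) of_nat_Suc)
  then show False using reals_Archimedean2[of K] by (metis not_less)
qed

text \<open>Uniform boundedness for the functionals given by the elements of \<open>S\<close>; each
  \<open>s\<close> is its own test vector for the norm.\<close>

lemma weakly_bounded_imp_bounded:
  fixes S :: "'a::{real_inner,complete_space} set"
  assumes "\<And>x. \<exists>K. \<forall>s\<in>S. \<bar>inner x s\<bar> \<le> K"
  obtains K where "\<And>s. s \<in> S \<Longrightarrow> norm s \<le> K"
proof -
  have "\<And>x. \<exists>K. \<forall>T\<in>blinfun_inner_left ` S. norm (blinfun_apply T x) \<le> K"
    using assms by (simp add: inner_commute)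
  then obtain K where K: "\<And>T. T \<in> blinfun_inner_left ` S \<Longrightarrow> norm T \<le> K"
    using uniform_boundedness[of "blinfun_inner_left ` S"] by metis
  have "norm s \<le> norm (blinfun_inner_left s)" for s :: 'a
    using norm_blinfun[of "blinfun_inner_left s" s]
    by (cases "s = 0") (auto simp: power2_norm_eq_inner[symmetric] power2_eq_square)
  then have "norm s \<le> K" if "s \<in> S" for s using K[OF imageI[OF that]] order_trans by blast
  then show ?thesis by (rule that)
qed

section \<open>Antiderivatives of continuous curves\<close>

text \<open>The dual of \<open>'a\<close> is of class \<open>banach\<close>, while \<open>'a\<close> itself is not known to be; so the
  antiderivative is taken there and transported back by Riesz representation.\<close>

lemma antiderivative_exists_banach:
  fixes f :: "real \<Rightarrow> 'a::banach"
  assumes "continuous_on UNIV f"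
  obtains F where "\<And>t. (F has_vector_derivative f t) (at t)"
proof -
  \<comment> \<open>The integral over an empty interval is 0, so at most one of the two terms is
    nonzero and \<open>t\<close> may have either sign.\<close>
  define F where "F t = integral {0..t} f - integral {t..0} f" for t
  have int: "f integrable_on {a..b}" for a b
    using assms by (intro integrable_continuous_real) (auto intro: continuous_on_subset)
  have "(F has_vector_derivative f t) (at t)" for t
  proof -
    define N where "N = \<bar>t\<bar> + 1"
    have F: "F s = integral {-N..s} f - integral {-N..0} f" if "s \<in> {-N<..<N}" for s
    proof (cases "0 \<le> s")
      case True
      then have "integral {s..0} f = 0"
        by (cases "s = 0") auto
      moreover have "integral {-N..0} f + integral {0..s} f = integral {-N..s} f"
        by (rule Henstock_Kurzweil_Integration.integral_combine) (use True int in \<open>auto simp: N_def\<close>)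
      ultimately show ?thesis by (simp add: F_def algebra_simps)
    next
      case False
      then have "integral {0..s} f = 0" by simp
      moreover have "integral {-N..s} f + integral {s..0} f = integral {-N..0} f"
        by (rule Henstock_Kurzweil_Integration.integral_combine) (use False that int in auto)
      ultimately show ?thesis by (simp add: F_def algebra_simps)
    qed
    have "((\<lambda>s. integral {-N..s} f) has_vector_derivative f t) (at t within {-N..N})"
      by (rule integral_has_vector_derivative) (use assms in \<open>auto simp: N_def intro: continuous_on_subset\<close>)
    then have "((\<lambda>s. integral {-N..s} f) has_vector_derivative f t) (at t)"
      by (subst (asm) at_within_interior) (auto simp: N_def)
    then have "((\<lambda>s. integral {-N..s} f - integral {-N..0} f) has_vector_derivative f t - 0) (at t)"
      by (rule has_vector_derivative_diff) simp
    then have "((\<lambda>s. integral {-N..s} f - integral {-N..0} f) has_vector_derivative f t) (at t)" by simp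
    then show ?thesis
      by (rule has_vector_derivative_transform_within_open[where S = "{-N<..<N}"]) (auto simp: F N_def)
  qed
  then show ?thesis using that by blast
qed

lemma antiderivative_exists:
  fixes f :: "real \<Rightarrow> 'a::{real_inner,complete_space}"
  assumes "continuous_on UNIV f"
  obtains F where "F 0 = 0" "\<And>t. (F has_vector_derivative f t) (at t)"
proof -
  have "\<forall>\<phi>::'a \<Rightarrow>\<^sub>L real. \<exists>u. \<forall>w. blinfun_apply \<phi> w = inner u w"
    using Riesz_representation blinfun.bounded_linear_right by metis
  then obtain r :: "('a \<Rightarrow>\<^sub>L real) \<Rightarrow> 'a" where r: "\<And>\<phi> w. blinfun_apply \<phi> w = inner (r \<phi>) w"
    by (auto dest!: choice)
  have r_eq: "r \<phi> = u" if "\<And>w. blinfun_apply \<phi> w = inner u w" for \<phi> u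
  proof -
    have "inner (r \<phi>) w = inner u w" for w using r[of \<phi> w] that[of w] by (rule trans[OF sym])
    then have "inner (r \<phi> - u) (r \<phi> - u) = 0" by (simp add: inner_diff_left)
    then show ?thesis by simp
  qed
  have jr: "blinfun_inner_right u = \<phi> \<Longrightarrow> r \<phi> = u" for u \<phi> by (rule r_eq) auto
  have "bounded_linear r"
  proof (rule bounded_linear_intro[where K = 1])
    fix \<phi> \<psi> :: "'a \<Rightarrow>\<^sub>L real" and c
    show "r (\<phi> + \<psi>) = r \<phi> + r \<psi>"
      by (rule r_eq) (simp add: inner_add_left r[symmetric] blinfun.add_left)
    show "r (c *\<^sub>R \<phi>) = c *\<^sub>R r \<phi>"
      by (rule r_eq) (simp add: r[symmetric] blinfun.scaleR_left)
    have "(norm (r \<phi>))\<^sup>2 = blinfun_apply \<phi> (r \<phi>)" by (simp only: r power2_norm_eq_inner)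
    also have "\<dots> \<le> norm \<phi> * norm (r \<phi>)" using norm_blinfun[of \<phi> "r \<phi>"] by simp
    finally show "norm (r \<phi>) \<le> norm \<phi> * 1" by (cases "r \<phi> = 0") (auto simp: power2_eq_square)
  qed
  have "continuous_on UNIV (\<lambda>t. blinfun_inner_right (f t))"
    by (intro bounded_linear.continuous_on[OF bounded_linear_blinfun_inner_right] assms)
  then obtain F where F: "\<And>t. (F has_vector_derivative blinfun_inner_right (f t)) (at t)"
    using antiderivative_exists_banach by blast
  have "((\<lambda>t. r (F t)) has_vector_derivative f t) (at t)" for t
    using bounded_linear.has_vector_derivative[OF \<open>bounded_linear r\<close> F[of t]] jr by simp
  then have "((\<lambda>t. r (F t) - r (F 0)) has_vector_derivative f t - 0) (at t)" for t
    by (rule has_vector_derivative_diff) simp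
  then show ?thesis by (intro that[of "\<lambda>t. r (F t) - r (F 0)"]) auto
qed

section \<open>Estimates modulo finitely many functionals\<close>

text \<open>Either \<open>g k\<close> is already controlled by \<open>q\<close> and the other functionals, or there is a null
  sequence \<open>v j\<close> for these with \<open>g k (v j) = 1\<close>; subtracting multiples of \<open>v j\<close> then
  reduces the estimate to the kernel of \<open>g k\<close>.\<close>

lemma drop_finitely_many_functionals:
  fixes q :: "'v::real_vector \<Rightarrow> real" and g :: "'i \<Rightarrow> 'v \<Rightarrow> real" and \<Phi> :: "'v \<Rightarrow> 'w::real_normed_vector"
  assumes "finite I" and "subspace V" and lin: "\<And>i. i \<in> I \<Longrightarrow> linear (g i)" "linear \<Phi>"
    and q_add: "\<And>x y. x \<in> V \<Longrightarrow> y \<in> V \<Longrightarrow> q (x + y) \<le> q x + q y"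
    and q_scale: "\<And>c x. x \<in> V \<Longrightarrow> q (c *\<^sub>R x) = \<bar>c\<bar> * q x"
    and bound: "\<And>v. v \<in> V \<Longrightarrow> norm (\<Phi> v) \<le> C * (q v + (\<Sum>i\<in>I. \<bar>g i v\<bar>))"
    and null: "\<And>v. (\<And>j. v j \<in> V) \<Longrightarrow> (\<lambda>j. q (v j)) \<longlonglongrightarrow> 0 \<Longrightarrow>
       (\<And>i. i \<in> I \<Longrightarrow> convergent (\<lambda>j. g i (v j))) \<Longrightarrow> (\<lambda>j. \<Phi> (v j)) \<longlonglongrightarrow> 0"
  shows "\<exists>C. \<forall>v\<in>V. norm (\<Phi> v) \<le> C * q v"
  using assms
proof (induction I arbitrary: V C rule: finite_induct)
  case empty
  then have "\<forall>v\<in>V. norm (\<Phi> v) \<le> C * q v" by simp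
  then show ?case ..
next
  case (insert k I)
  note sub = \<open>subspace V\<close>
  have g: "linear (g i)" if "i \<in> insert k I" for i using insert.prems that by blast
  have lin\<Phi>: "linear \<Phi>" by fact
  note q_add = insert.prems(4) and q_scale = insert.prems(5)
  note bound = insert.prems(6) and null = insert.prems(7)
  have q_nonneg: "0 \<le> q v" if "v \<in> V" for v
    using q_add[of v "- v"] q_scale[of v "-1"] q_scale[of v 0] that sub
    by (simp add: subspace_neg)
  define p where "p v = q v + (\<Sum>i\<in>I. \<bar>g i v\<bar>)" for v
  have p_nonneg: "0 \<le> p v" if "v \<in> V" for v
    unfolding p_def by (intro add_nonneg_nonneg sum_nonneg q_nonneg that) auto
  have bound': "norm (\<Phi> v) \<le> \<bar>C\<bar> * (\<bar>g k v\<bar> + p v)" if "v \<in> V" for v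
  proof -
    have "norm (\<Phi> v) \<le> C * (\<bar>g k v\<bar> + p v)"
      using bound[OF that] insert.hyps by (simp add: p_def algebra_simps)
    also have "\<dots> \<le> \<bar>C\<bar> * (\<bar>g k v\<bar> + p v)" using p_nonneg[OF that] by (intro mult_right_mono) auto
    finally show ?thesis .
  qed
  show ?case
  proof (cases "\<exists>D. \<forall>v\<in>V. \<bar>g k v\<bar> \<le> D * p v")
    case True
    then obtain D where D: "\<And>v. v \<in> V \<Longrightarrow> \<bar>g k v\<bar> \<le> D * p v" by blast
    show ?thesis
    proof (rule insert.IH[of V "\<bar>C\<bar> * (D + 1)"])
      show "norm (\<Phi> v) \<le> \<bar>C\<bar> * (D + 1) * (q v + (\<Sum>i\<in>I. \<bar>g i v\<bar>))" if "v \<in> V" for v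
      proof -
        have "\<bar>C\<bar> * (\<bar>g k v\<bar> + p v) \<le> \<bar>C\<bar> * (D * p v + p v)"
          using D[OF that] by (intro mult_left_mono) auto
        then show ?thesis using bound'[OF that] by (simp add: p_def algebra_simps)
      qed
      show "(\<lambda>j. \<Phi> (v j)) \<longlonglongrightarrow> 0" if v: "\<And>j. v j \<in> V" and q0: "(\<lambda>j. q (v j)) \<longlonglongrightarrow> 0"
        and c: "\<And>i. i \<in> I \<Longrightarrow> convergent (\<lambda>j. g i (v j))" for v
      proof (rule null[OF v q0])
        fix i assume i: "i \<in> insert k I"
        \<comment> \<open>Where \<open>p\<close> bounds \<open>g k\<close>, convergence of the other
          functionals together with q -> 0 already makes \<open>g k\<close> Cauchy along the
          sequence. Hence \<open>null\<close> for \<open>insert k I\<close> supplies what the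
          induction hypothesis asks for \<open>I\<close>.\<close>
        have "Cauchy (\<lambda>j. g k (v j))"
        proof (rule metric_CauchyI)
          fix e :: real assume "0 < e"
          define D' where "D' = \<bar>D\<bar> + 1"
          have D': "\<bar>g k x\<bar> \<le> D' * p x" if "x \<in> V" for x
          proof -
            have "D * p x \<le> D' * p x" using p_nonneg[OF that] by (intro mult_right_mono) (auto simp: D'_def)
            then show ?thesis using D[OF that] by simp
          qed
          have "D' > 0" by (simp add: D'_def)
          define n where "n = real (card I + 1)"
          have n: "n > 0" by (simp add: n_def)
          define e' where "e' = e / (D' * (n + 1))"
          have e': "e' > 0" using \<open>0 < e\<close> \<open>D' > 0\<close> n by (simp add: e'_def)
          have "\<exists>M. \<forall>a\<ge>M. \<forall>b\<ge>M. \<bar>g i (v a) - g i (v b)\<bar> < e'" if "i \<in> I" for i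
            using c[OF that] e' by (simp add: Cauchy_convergent_iff[symmetric] Cauchy_def dist_real_def)
          then obtain M where M: "\<And>i a b. i \<in> I \<Longrightarrow> a \<ge> M i \<Longrightarrow> b \<ge> M i \<Longrightarrow> \<bar>g i (v a) - g i (v b)\<bar> < e'"
            by metis
          obtain M0 where M0: "\<And>a. a \<ge> M0 \<Longrightarrow> q (v a) < e' / 2"
            using order_tendstoD(2)[OF q0, of "e' / 2"] e' by (auto simp: eventually_sequentially)
          have fin: "finite (insert M0 (M ` I))" using insert.hyps by simp
          define N where "N = Max (insert M0 (M ` I))"
          have NM0: "M0 \<le> N" unfolding N_def by (rule Max_ge[OF fin]) simp
          have NM: "M i \<le> N" if "i \<in> I" for i unfolding N_def by (rule Max_ge[OF fin]) (use that in simp)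
          have "dist (g k (v a)) (g k (v b)) < e" if ab: "a \<ge> N" "b \<ge> N" for a b
          proof -
            have V: "v a - v b \<in> V" using v sub by (simp add: subspace_diff)
            have "q (v a - v b) \<le> q (v a) + q (v b)"
              using q_add[of "v a" "- v b"] q_scale[of "v b" "-1"] v sub by (simp add: subspace_neg)
            also have "\<dots> < e'" using M0[of a] M0[of b] ab NM0 by simp
            finally have 1: "q (v a - v b) \<le> e'" by simp
            have 2: "(\<Sum>i\<in>I. \<bar>g i (v a - v b)\<bar>) \<le> (\<Sum>i\<in>I. e')"
            proof (rule sum_mono)
              fix i assume i: "i \<in> I"
              have "g i (v a - v b) = g i (v a) - g i (v b)" using g i by (simp add: linear_diff)
              then show "\<bar>g i (v a - v b)\<bar> \<le> e'" using M[OF i, of a b] NM[OF i] ab by simp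
            qed
            have "p (v a - v b) \<le> e' + real (card I) * e'" using 1 2 by (simp add: p_def)
            also have "\<dots> = n * e'" by (simp add: n_def algebra_simps)
            also have "\<dots> < (n + 1) * e'" using e' by simp
            finally have p: "p (v a - v b) < (n + 1) * e'" .
            have "\<bar>g k (v a) - g k (v b)\<bar> \<le> D' * p (v a - v b)"
              using D'[OF V] g[of k] by (simp add: linear_diff)
            also have "\<dots> < D' * ((n + 1) * e')" using p \<open>D' > 0\<close> by simp
            also have "\<dots> = e" using \<open>D' > 0\<close> n by (simp add: e'_def)
            finally show ?thesis by (simp add: dist_real_def)
          qed
          then show "\<exists>M. \<forall>m\<ge>M. \<forall>n\<ge>M. dist (g k (v m)) (g k (v n)) < e" by blast
        qed
        then show "convergent (\<lambda>j. g i (v j))" using c i Cauchy_convergent by blast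
      qed
    qed (use insert.prems g in auto)
  next
    case False
    have "\<exists>v\<in>V. g k v = 1 \<and> p v \<le> 1 / real (Suc j)" for j
    proof -
      obtain w where w: "w \<in> V" "real (Suc j) * p w < \<bar>g k w\<bar>" using False not_less by blast
      then have gw: "g k w \<noteq> 0" using p_nonneg[OF w(1)]
        by (metis abs_zero mult_nonneg_nonneg not_less of_nat_0_le_iff)
      have p_scale: "p (c *\<^sub>R w) = \<bar>c\<bar> * p w" for c
      proof -
        have "(\<Sum>i\<in>I. \<bar>g i (c *\<^sub>R w)\<bar>) = (\<Sum>i\<in>I. \<bar>c\<bar> * \<bar>g i w\<bar>)"
          using g by (intro sum.cong refl) (simp add: linear_scale abs_mult)
        then show ?thesis using q_scale[OF w(1)] by (simp add: p_def distrib_left sum_distrib_left)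
      qed
      have "p ((1 / g k w) *\<^sub>R w) \<le> 1 / real (Suc j)"
        using w(2) gw unfolding p_scale by (simp add: divide_simps mult.commute)
      moreover have "g k ((1 / g k w) *\<^sub>R w) = 1" using g[of k] gw by (simp add: linear_scale)
      moreover have "(1 / g k w) *\<^sub>R w \<in> V" using w(1) sub by (rule subspace_scale[rotated])
      ultimately show ?thesis by blast
    qed
    then obtain v where v: "\<And>j. v j \<in> V" "\<And>j. g k (v j) = 1" "\<And>j. p (v j) \<le> 1 / real (Suc j)" by metis
    have inv: "(\<lambda>j. 1 / real (Suc j)) \<longlonglongrightarrow> 0" by (rule LIMSEQ_Suc[OF lim_const_over_n])
    have p0: "(\<lambda>j. p (v j)) \<longlonglongrightarrow> 0"
      by (rule tendsto_sandwich[OF _ _ tendsto_const inv]) (use p_nonneg v in auto)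
    have qp: "q x \<le> p x" "i \<in> I \<Longrightarrow> \<bar>g i x\<bar> \<le> p x" if "x \<in> V" for x i
    proof -
      show "q x \<le> p x" by (simp add: p_def sum_nonneg)
      assume "i \<in> I"
      then have "\<bar>g i x\<bar> \<le> (\<Sum>i\<in>I. \<bar>g i x\<bar>)" using insert.hyps by (intro member_le_sum) auto
      then show "\<bar>g i x\<bar> \<le> p x" using q_nonneg[OF that] by (simp add: p_def)
    qed
    have q0: "(\<lambda>j. q (v j)) \<longlonglongrightarrow> 0"
      by (rule tendsto_sandwich[OF _ _ tendsto_const p0]) (use q_nonneg qp v in auto)
    have gi0: "(\<lambda>j. g i (v j)) \<longlonglongrightarrow> 0" if "i \<in> I" for i
      by (rule Lim_null_comparison[OF _ p0]) (use qp(2)[OF v(1) that] in simp)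
    have "convergent (\<lambda>j. g i (v j))" if "i \<in> insert k I" for i
    proof (cases "i = k")
      case True then show ?thesis by (simp add: v(2) convergent_const)
    next
      case False then show ?thesis using gi0 that by (auto simp: convergent_def)
    qed
    then have \<Phi>0: "(\<lambda>j. \<Phi> (v j)) \<longlonglongrightarrow> 0" using null v q0 by blast
    define V' where "V' = {v \<in> V. g k v = 0}"
    have "\<exists>C. \<forall>v\<in>V'. norm (\<Phi> v) \<le> C * q v"
    proof (rule insert.IH[of V' "\<bar>C\<bar>"])
      show "subspace V'" using sub g[of k] unfolding V'_def
        by (auto simp: subspace_def linear_0 linear_add linear_scale)
      show "norm (\<Phi> v) \<le> \<bar>C\<bar> * (q v + (\<Sum>i\<in>I. \<bar>g i v\<bar>))" if "v \<in> V'" for v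
        using bound'[of v] that by (simp add: V'_def p_def)
      show "(\<lambda>j. \<Phi> (v j)) \<longlonglongrightarrow> 0" if "\<And>j. v j \<in> V'" and q0: "(\<lambda>j. q (v j)) \<longlonglongrightarrow> 0"
        and c: "\<And>i. i \<in> I \<Longrightarrow> convergent (\<lambda>j. g i (v j))" for v
      proof (rule null[OF _ q0])
        fix i assume i: "i \<in> insert k I"
        have "g k (v j) = 0" for j using that(1) by (simp add: V'_def)
        then show "convergent (\<lambda>j. g i (v j))" using c i by (cases "i = k") (auto simp: convergent_const)
      qed (use that(1) V'_def in blast)
    qed (use q_add q_scale g lin\<Phi> V'_def in auto)
    then obtain C' where C': "\<And>v. v \<in> V' \<Longrightarrow> norm (\<Phi> v) \<le> C' * q v" by blast
    have "norm (\<Phi> x) \<le> \<bar>C'\<bar> * q x" if x: "x \<in> V" for x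
    proof -
      \<comment> \<open>\<open>y j\<close> moves \<open>x\<close> into the kernel of
        \<open>g k\<close>. The price vanishes in the limit, because both q (v j) and \<Phi> (v j)
        tend to 0.\<close>
      define y where "y j = x + (- g k x) *\<^sub>R v j" for j
      have y: "y j \<in> V'" for j
        using x v sub g[of k] by (simp add: y_def V'_def subspace_add subspace_scale subspace_neg subspace_diff linear_add linear_scale linear_diff)
      have "norm (\<Phi> (y j)) \<le> \<bar>C'\<bar> * (q x + \<bar>g k x\<bar> * q (v j))" for j
      proof -
        have vv: "(- g k x) *\<^sub>R v j \<in> V" using v sub by (intro subspace_scale)
        have "0 \<le> q (y j)" using y[of j] q_nonneg by (simp add: V'_def)
        then have "C' * q (y j) \<le> \<bar>C'\<bar> * q (y j)" by (intro mult_right_mono) auto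
        also have "\<dots> \<le> \<bar>C'\<bar> * (q x + \<bar>g k x\<bar> * q (v j))"
          using q_add[OF x vv] q_scale[OF v(1)[of j], of "- g k x"] by (intro mult_left_mono) (auto simp: y_def)
        finally show ?thesis using C'[OF y[of j]] by simp
      qed
      moreover have "\<Phi> (y j) = \<Phi> x + (- g k x) *\<^sub>R \<Phi> (v j)" for j
        by (simp only: y_def linear_add[OF lin\<Phi>] linear_scale[OF lin\<Phi>])
      ultimately have le: "norm (\<Phi> x + (- g k x) *\<^sub>R \<Phi> (v j)) \<le> \<bar>C'\<bar> * (q x + \<bar>g k x\<bar> * q (v j))" for j
        by metis
      have "(\<lambda>j. norm (\<Phi> x + (- g k x) *\<^sub>R \<Phi> (v j))) \<longlonglongrightarrow> norm (\<Phi> x + (- g k x) *\<^sub>R 0)"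
        by (intro tendsto_intros \<Phi>0)
      moreover have "(\<lambda>j. \<bar>C'\<bar> * (q x + \<bar>g k x\<bar> * q (v j))) \<longlonglongrightarrow> \<bar>C'\<bar> * (q x + \<bar>g k x\<bar> * 0)"
        by (intro tendsto_intros q0)
      ultimately have "norm (\<Phi> x + (- g k x) *\<^sub>R 0) \<le> \<bar>C'\<bar> * (q x + \<bar>g k x\<bar> * 0)"
        by (rule LIMSEQ_le) (use le in blast)
      then show ?thesis by simp
    qed
    then show ?thesis by blast
  qed
qed

text \<open>Gram-Schmidt driven by functionals: a vector of \<open>S\<close> off the kernel of
  \<open>g k\<close>, made orthogonal to that kernel, supplies the one missing direction. Joint
  injectivity of the functionals on \<open>S\<close> stands in for finite dimension, which suits the
  span of eigenvectors of unknown number.\<close>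

lemma definite_projection_exists:
  fixes \<beta> :: "'a::real_normed_vector \<Rightarrow> 'a \<Rightarrow> real" and g :: "'i \<Rightarrow> 'a \<Rightarrow> real"
  assumes bb: "bounded_bilinear \<beta>" and "finite I" and "\<And>i. i \<in> I \<Longrightarrow> linear (g i)"
    and "subspace S" and "\<And>u. u \<in> S \<Longrightarrow> u \<noteq> 0 \<Longrightarrow> 0 < \<beta> u u"
    and "\<And>u. u \<in> S \<Longrightarrow> (\<And>i. i \<in> I \<Longrightarrow> g i u = 0) \<Longrightarrow> u = 0"
  shows "\<exists>C. \<forall>x. \<exists>f\<in>S. (\<forall>s\<in>S. \<beta> (x - f) s = 0) \<and> norm f \<le> C * norm x"
  using assms(2-)
proof (induction I arbitrary: S rule: finite_induct)
  case empty
  then have "S = {0}" using subspace_0 by auto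
  interpret b: bounded_bilinear \<beta> by fact
  show ?case by (rule exI[of _ 0]) (simp add: \<open>S = {0}\<close> b.zero_right)
next
  case (insert k I)
  interpret b: bounded_bilinear \<beta> by fact
  have gk: "linear (g k)" using insert.prems by blast
  note sub = \<open>subspace S\<close>
  define S' where "S' = {u \<in> S. g k u = 0}"
  have sub': "subspace S'" using sub gk unfolding S'_def
    by (auto simp: subspace_def linear_0 linear_add linear_scale)
  have "\<exists>C. \<forall>x. \<exists>f\<in>S'. (\<forall>s\<in>S'. \<beta> (x - f) s = 0) \<and> norm f \<le> C * norm x"
  proof (rule insert.IH)
    show "u = 0" if "u \<in> S'" "\<And>i. i \<in> I \<Longrightarrow> g i u = 0" for u
      by (rule insert.prems(4)) (use that S'_def in auto)
  qed (use insert.prems sub' S'_def in auto)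
  then obtain C where C: "\<And>x. \<exists>f\<in>S'. (\<forall>s\<in>S'. \<beta> (x - f) s = 0) \<and> norm f \<le> C * norm x" by blast
  show ?case
  proof (cases "S' = S")
    case True then show ?thesis using C by auto
  next
    case False
    then obtain v where v: "v \<in> S" "g k v \<noteq> 0" by (auto simp: S'_def)
    obtain f where f: "f \<in> S'" "\<And>s. s \<in> S' \<Longrightarrow> \<beta> (v - f) s = 0" using C by blast
    define e where "e = v - f"
    have e: "e \<in> S" "g k e \<noteq> 0" using v f(1) sub gk by (auto simp: e_def S'_def subspace_diff linear_diff)
    have "e \<noteq> 0" using e(2) linear_0[OF gk] by auto
    then have ee: "0 < \<beta> e e" using insert.prems(3) e by blast
    have eS': "\<beta> e s = 0" if "s \<in> S'" for s using f that by (simp add: e_def)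
    obtain K where K: "0 \<le> K" "\<And>a b. norm (\<beta> a b) \<le> norm a * norm b * K" using b.nonneg_bounded by blast
    \<comment> \<open>Bounds the coefficient of \<open>e\<close>: |x - h| <= (1 + |C|) |x|, and the
      form at (x - h, e) is at most K |x - h| |e|.\<close>
    define C2 where "C2 = (1 + \<bar>C\<bar>) * norm e * K / \<beta> e e"
    have "\<exists>f\<in>S. (\<forall>s\<in>S. \<beta> (x - f) s = 0) \<and> norm f \<le> (\<bar>C\<bar> + C2 * norm e) * norm x" for x
    proof -
      obtain h where h: "h \<in> S'" "\<And>s. s \<in> S' \<Longrightarrow> \<beta> (x - h) s = 0" "norm h \<le> C * norm x" using C by blast
      define c where "c = \<beta> (x - h) e / \<beta> e e"
      have F: "h + c *\<^sub>R e \<in> S" using h(1) e(1) sub by (auto simp: S'_def subspace_add subspace_scale)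
      have "\<beta> (x - (h + c *\<^sub>R e)) s = 0" if s: "s \<in> S" for s
      proof -
        define s' where "s' = s - (g k s / g k e) *\<^sub>R e"
        have s': "s' \<in> S'" using s e sub gk
          by (simp add: s'_def S'_def subspace_diff subspace_scale linear_diff linear_scale)
        have "\<beta> (x - (h + c *\<^sub>R e)) s' = 0"
          using h(2)[OF s'] eS'[OF s'] by (simp add: b.diff_left b.add_left b.scaleR_left)
        moreover have "\<beta> (x - (h + c *\<^sub>R e)) e = 0"
          using ee by (simp add: c_def b.diff_left b.add_left b.scaleR_left)
        moreover have "s = s' + (g k s / g k e) *\<^sub>R e" by (simp add: s'_def)
        ultimately show ?thesis by (metis add_0 b.add_right b.scaleR_right scaleR_zero_right)
      qed
      moreover have "norm (h + c *\<^sub>R e) \<le> (\<bar>C\<bar> + C2 * norm e) * norm x"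
      proof -
        have hx: "norm h \<le> \<bar>C\<bar> * norm x" using h(3) by (meson abs_ge_self mult_right_mono norm_ge_zero order_trans)
        have "norm (x - h) \<le> (1 + \<bar>C\<bar>) * norm x" using hx norm_triangle_ineq4[of x h] by (simp add: algebra_simps)
        then have "norm (x - h) * (norm e * K) \<le> (1 + \<bar>C\<bar>) * norm x * (norm e * K)"
          by (rule mult_right_mono) (simp add: K)
        then have "\<bar>\<beta> (x - h) e\<bar> \<le> (1 + \<bar>C\<bar>) * norm x * norm e * K"
          using K(2)[of "x - h" e] by (simp add: mult.assoc)
        then have "\<bar>c\<bar> \<le> C2 * norm x" using ee by (simp add: c_def C2_def divide_simps mult_ac)
        then have "norm (c *\<^sub>R e) \<le> C2 * norm x * norm e" by (simp add: mult_right_mono)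
        then show ?thesis using hx norm_triangle_ineq[of h "c *\<^sub>R e"] by (simp add: algebra_simps)
      qed
      ultimately show ?thesis using F by blast
    qed
    then show ?thesis by blast
  qed
qed

lemma common_convergent_subsequence:
  fixes s :: "'i \<Rightarrow> nat \<Rightarrow> real"
  assumes "finite I" and "\<And>i. i \<in> I \<Longrightarrow> bounded (range (s i))"
  shows "\<exists>r. strict_mono r \<and> (\<forall>i\<in>I. convergent (s i \<circ> r))"
  using assms
proof (induction I rule: finite_induct)
  case empty
  show ?case by (rule exI[of _ id]) (simp add: strict_mono_def)
next
  case (insert k I)
  then obtain r where r: "strict_mono r" "\<And>i. i \<in> I \<Longrightarrow> convergent (s i \<circ> r)" by blast
  have "bounded (range (s k \<circ> r))"
    by (rule bounded_subset[of "range (s k)"]) (use insert.prems in auto)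
  then obtain l r' where r': "strict_mono r'" "((s k \<circ> r) \<circ> r') \<longlonglongrightarrow> l"
    using bounded_imp_convergent_subsequence by metis
  have "convergent (s i \<circ> (r \<circ> r'))" if "i \<in> insert k I" for i
  proof (cases "i = k")
    case True then show ?thesis using r'(2) by (auto simp: convergent_def comp_assoc)
  next
    case False
    then have "convergent (s i \<circ> r)" using r that by auto
    then show ?thesis using r'(1) convergent_subseq_convergent by (metis comp_assoc)
  qed
  moreover have "strict_mono (r \<circ> r')" using r r' by (simp add: strict_mono_o)
  ultimately show ?case by blast
qed

lemma span_le_sum_inner:
  fixes b :: "'a::real_inner set"
  assumes "finite b" and "pairwise orthogonal b" and "m \<in> span b"
  shows "m = (\<Sum>e\<in>b. (inner e m / inner e e) *\<^sub>R e)"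
    and "norm m \<le> (\<Sum>e\<in>b. (1 / norm e) * \<bar>inner e m\<bar>)"
proof -
  from assms obtain c where c: "m = (\<Sum>e\<in>b. c e *\<^sub>R e)" using span_finite by (auto simp: span_finite[OF assms(1)])
  have "inner e m = c e * inner e e" if "e \<in> b" for e
  proof -
    have "inner e m = (\<Sum>f\<in>b. c f * inner e f)" by (simp add: c inner_sum_right)
    also have "\<dots> = (\<Sum>f\<in>b. if f = e then c e * inner e e else 0)"
      using assms(2) that by (intro sum.cong) (auto simp: pairwise_def orthogonal_def)
    finally show ?thesis using that assms(1) by simp
  qed
  \<comment> \<open>\<open>b\<close> may contain 0. Its term vanishes whatever the coefficient, and
    x / 0 = 0 keeps the formulas valid.\<close>
  then have "c e *\<^sub>R e = (inner e m / inner e e) *\<^sub>R e" if "e \<in> b" for e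
    using that by (cases "e = 0") auto
  then have "(\<Sum>e\<in>b. c e *\<^sub>R e) = (\<Sum>e\<in>b. (inner e m / inner e e) *\<^sub>R e)" by (rule sum.cong[OF refl])
  then show eq: "m = (\<Sum>e\<in>b. (inner e m / inner e e) *\<^sub>R e)" using c by (rule trans[rotated])
  have "norm m \<le> (\<Sum>e\<in>b. norm ((inner e m / inner e e) *\<^sub>R e))" by (subst eq) (rule norm_sum)
  also have "\<dots> = (\<Sum>e\<in>b. (1 / norm e) * \<bar>inner e m\<bar>)"
    by (intro sum.cong refl) (auto simp: power2_norm_eq_inner[symmetric] power2_eq_square)
  finally show "norm m \<le> (\<Sum>e\<in>b. (1 / norm e) * \<bar>inner e m\<bar>)" .
qed

text \<open>\<open>J\<close> is the identity minus the orthogonal projection onto \<open>S\<close>.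
  The distance to \<open>S\<close> is thus the norm of a linear map, which makes it usable as the
  seminorm of \<open>drop_finitely_many_functionals\<close>.\<close>

lemma distance_to_closed_subspace:
  fixes S :: "'a::{real_inner,complete_space} set"
  assumes S: "closed_subspace S"
  obtains J :: "'a \<Rightarrow> 'a" where "bounded_linear J" "\<And>x. J x = 0 \<Longrightarrow> x \<in> S" "\<And>x s. s \<in> S \<Longrightarrow> norm (J x) \<le> norm (x - s)"
proof -
  have sub: "subspace S" using S by (simp add: closed_subspace_def)
  have "\<forall>x. \<exists>p. p \<in> S \<and> (\<forall>w\<in>S. inner (x - p) w = 0)"
    using orthogonal_projection_exists[OF S] by metis
  then obtain p where p: "\<And>x. p x \<in> S" "\<And>x w. w \<in> S \<Longrightarrow> inner (x - p x) w = 0" by metis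
  have uniq: "p x = a" if "a \<in> S" "\<And>w. w \<in> S \<Longrightarrow> inner (x - a) w = 0" for x a
  proof -
    have d: "p x - a \<in> S" using p that sub by (simp add: subspace_diff)
    have "inner (p x - a) (p x - a) = inner (x - a) (p x - a) - inner (x - p x) (p x - a)"
      by (simp add: inner_diff_left)
    also have "\<dots> = 0" using that(2)[OF d] p(2)[OF d] by simp
    finally show ?thesis by simp
  qed
  define J where "J x = x - p x" for x
  have Jle: "norm (J x) \<le> norm (x - s)" if "s \<in> S" for x s
  proof -
    have d: "p x - s \<in> S" using p that sub by (simp add: subspace_diff)
    have "(norm (x - s))\<^sup>2 = (norm (J x + (p x - s)))\<^sup>2" by (simp add: J_def)
    also have "\<dots> = (norm (J x))\<^sup>2 + (norm (p x - s))\<^sup>2"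
      using p(2)[OF d, of x] unfolding J_def[symmetric]
      by (simp add: power2_norm_eq_inner inner_add_left inner_add_right inner_commute)
    finally have "(norm (J x))\<^sup>2 \<le> (norm (x - s))\<^sup>2" by simp
    then show ?thesis by (rule power2_le_imp_le) simp
  qed
  have blJ: "bounded_linear J"
  proof (rule bounded_linear_intro[where K = 1])
    fix x y :: 'a and c
    have "p (x + y) = p x + p y"
    proof (rule uniq)
      show "inner (x + y - (p x + p y)) w = 0" if "w \<in> S" for w
        using p(2)[OF that, of x] p(2)[OF that, of y] by (simp add: algebra_simps inner_diff_left inner_add_left)
    qed (use p sub in \<open>simp add: subspace_add\<close>)
    then show "J (x + y) = J x + J y" by (simp add: J_def)
    have "p (c *\<^sub>R x) = c *\<^sub>R p x"
    proof (rule uniq)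
      show "inner (c *\<^sub>R x - c *\<^sub>R p x) w = 0" if "w \<in> S" for w
        using p(2)[OF that, of x] by (simp add: inner_diff_left)
    qed (use p sub in \<open>simp add: subspace_scale\<close>)
    then show "J (c *\<^sub>R x) = c *\<^sub>R J x" by (simp add: J_def scaleR_diff_right)
    show "norm (J x) \<le> norm x * 1" using Jle[OF subspace_0[OF sub], of x] by simp
  qed
  have "x \<in> S" if "J x = 0" for x using that p(1)[of x] by (simp add: J_def)
  from that[OF blJ this Jle] show ?thesis .
qed

text \<open>The distance to \<open>S\<close> plays the seminorm and the coordinates along
  \<open>b\<close> play the functionals. If the coordinates converge and the distance tends to 0,
  the limit lies in \<open>S\<close> and in \<open>span b\<close>, so it is 0; this is the only
  place where the two subspaces have to meet trivially.\<close>

lemma finite_dimensional_complement_bound: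
  fixes S :: "'a::{real_inner,complete_space} set"
  assumes S: "closed_subspace S" and b: "finite b" "pairwise orthogonal b"
    and disj: "S \<inter> span b = {0}"
  obtains C where "\<And>s m. s \<in> S \<Longrightarrow> m \<in> span b \<Longrightarrow> norm m \<le> C * norm (s + m)"
proof -
  obtain J :: "'a \<Rightarrow> 'a" where J: "bounded_linear J" "\<And>x. J x = 0 \<Longrightarrow> x \<in> S"
    "\<And>x s. s \<in> S \<Longrightarrow> norm (J x) \<le> norm (x - s)"
    by (rule distance_to_closed_subspace[OF S]) (rule that)
  interpret J: bounded_linear J by fact
  have sub: "subspace S" using S by (simp add: closed_subspace_def)
  define g where "g e m = (1 / norm e) * inner e m" for e m :: 'a
  have "\<exists>C. \<forall>m\<in>span b. norm (id m) \<le> C * norm (J m)"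
  proof (rule drop_finitely_many_functionals[where I = b and C = 1 and g = g])
    show "norm (id m) \<le> 1 * (norm (J m) + (\<Sum>e\<in>b. \<bar>g e m\<bar>))" if "m \<in> span b" for m
      using add_mono[OF norm_ge_zero span_le_sum_inner(2)[OF b that]] by (simp add: g_def abs_mult)
    show "(\<lambda>j. id (m j)) \<longlonglongrightarrow> 0" if m: "\<And>j. m j \<in> span b" and J0: "(\<lambda>j. norm (J (m j))) \<longlonglongrightarrow> 0"
      and c: "\<And>e. e \<in> b \<Longrightarrow> convergent (\<lambda>j. g e (m j))" for m
    proof -
      obtain l where l: "\<And>e. e \<in> b \<Longrightarrow> (\<lambda>j. g e (m j)) \<longlonglongrightarrow> l e" using c unfolding convergent_def by metis
      have "(\<lambda>j. \<Sum>e\<in>b. (g e (m j) / norm e) *\<^sub>R e) = m"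
      proof
        fix j show "(\<Sum>e\<in>b. (g e (m j) / norm e) *\<^sub>R e) = m j"
          by (subst (2) span_le_sum_inner(1)[OF b m])
            (simp add: g_def power2_norm_eq_inner[symmetric] power2_eq_square)
      qed
      moreover have "(\<lambda>j. \<Sum>e\<in>b. (g e (m j) / norm e) *\<^sub>R e) \<longlonglongrightarrow> (\<Sum>e\<in>b. (l e / norm e) *\<^sub>R e)"
        by (intro tendsto_sum tendsto_scaleR tendsto_const bounded_linear.tendsto[OF bounded_linear_divide] l)
      ultimately have lim: "m \<longlonglongrightarrow> (\<Sum>e\<in>b. (l e / norm e) *\<^sub>R e)" (is "_ \<longlonglongrightarrow> ?l") by simp
      have "(\<lambda>j. J (m j)) \<longlonglongrightarrow> J ?l" by (rule J.tendsto[OF lim])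
      moreover have "(\<lambda>j. J (m j)) \<longlonglongrightarrow> 0" using J0 by (simp add: tendsto_norm_zero_iff)
      ultimately have "?l \<in> S" using J(2) LIMSEQ_unique by blast
      moreover have "?l \<in> span b" by (intro span_sum span_scale span_base)
      ultimately have "?l = 0" using disj by blast
      then show ?thesis using lim by simp
    qed
  qed (auto simp: b g_def J.add J.scaleR inner_add_right norm_triangle_ineq algebra_simps linear_id
       intro!: linearI)
  then obtain C where C: "\<And>m. m \<in> span b \<Longrightarrow> norm m \<le> C * norm (J m)" by auto
  have "norm m \<le> \<bar>C\<bar> * norm (s + m)" if "s \<in> S" "m \<in> span b" for s m
  proof -
    have "norm m \<le> \<bar>C\<bar> * norm (J m)" using C[OF that(2)] by (meson abs_ge_self mult_right_mono norm_ge_zero order_trans)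
    also have "\<dots> \<le> \<bar>C\<bar> * norm (m - (- s))"
      using that(1) sub by (intro mult_left_mono J(3)) (auto intro: subspace_neg)
    finally show ?thesis by (simp add: add.commute)
  qed
  then show ?thesis using that by blast
qed

section \<open>The operators \<open>L\<close>, \<open>A\<close> and \<open>B\<close>\<close>

locale separable_operators =
  fixes L :: "'x::{real_inner,complete_space} \<Rightarrow>\<^sub>L ('x \<Rightarrow>\<^sub>L real)"
    and A :: "'y::{real_inner,complete_space} \<Rightarrow>\<^sub>L ('y \<Rightarrow>\<^sub>L real)"
    and D :: "('y \<Rightarrow>\<^sub>L real) set"
    and B :: "('y \<Rightarrow>\<^sub>L real) \<Rightarrow> 'x"
    and Xm Xp :: "'x set"
    and Yp :: "'y set"
  assumes G1: "G1 D B" and G2: "G2 A Yp" and G3: "G3 L Xm Xp" and G4: "G4 D B Xm Xp Yp"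
begin

abbreviation "Bd \<equiv> dual_op D B"
abbreviation "Dd \<equiv> dual_dom D B"
abbreviation "lf x y \<equiv> blinfun_apply (blinfun_apply L x) y"
abbreviation "af x y \<equiv> blinfun_apply (blinfun_apply A x) y"

lemma bounded_bilinear_lf: "bounded_bilinear lf"
  by (rule bounded_bilinear.comp1[OF bounded_bilinear_blinfun_apply blinfun.bounded_linear_right])

lemma bounded_bilinear_af: "bounded_bilinear af"
  by (rule bounded_bilinear.comp1[OF bounded_bilinear_blinfun_apply blinfun.bounded_linear_right])

lemma lf_commute: "lf u v = lf v u"
  by (rule G3[unfolded G3_def self_dual_def, THEN conjunct1, rule_format])

lemma af_commute: "af u v = af v u"
  by (rule G2[unfolded G2_def self_dual_def, THEN conjunct1, rule_format])

lemma subspace_D: "subspace D"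
  using G1 by (simp add: G1_def linear_operator_on_def)

lemma B_add: "g \<in> D \<Longrightarrow> h \<in> D \<Longrightarrow> B (g + h) = B g + B h"
  using G1 by (simp add: G1_def linear_operator_on_def)

lemma B_scale: "g \<in> D \<Longrightarrow> B (c *\<^sub>R g) = c *\<^sub>R B g"
  using G1 by (simp add: G1_def linear_operator_on_def)

lemma B_diff: "g \<in> D \<Longrightarrow> h \<in> D \<Longrightarrow> B (g - h) = B g - B h"
  using B_add[of "g" "(-1) *\<^sub>R h"] B_scale[of h "-1"] subspace_scale[OF subspace_D, of h "-1"] by simp

lemma B_0: "B 0 = 0"
  using B_scale[OF subspace_0[OF subspace_D], of 0] by simp

text \<open>Density of \<open>D\<close> is what makes the vector picked by \<open>THE\<close> in
  \<open>dual_op\<close> unique: the functional given by y - z is a limit of elements of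
  \<open>D\<close>.\<close>

lemma D_separates:
  assumes "\<And>\<phi>. \<phi> \<in> D \<Longrightarrow> blinfun_apply \<phi> y = blinfun_apply \<phi> z"
  shows "y = z"
proof -
  have "blinfun_inner_left (y - z) \<in> closure D"
    using G1 by (simp add: G1_def densely_defined_def)
  then obtain \<phi> where \<phi>: "\<And>n. \<phi> n \<in> D" "\<phi> \<longlonglongrightarrow> blinfun_inner_left (y - z)"
    unfolding closure_sequential by blast
  have "(\<lambda>n. blinfun_apply (\<phi> n) (y - z)) \<longlonglongrightarrow> blinfun_apply (blinfun_inner_left (y - z)) (y - z)"
    by (intro tendsto_intros \<phi>)
  moreover have "blinfun_apply (\<phi> n) (y - z) = 0" for n
    using assms[OF \<phi>(1)] by (simp add: blinfun.diff_right)
  ultimately have "inner (y - z) (y - z) = 0" by (simp add: LIMSEQ_const_iff)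
  then show ?thesis by simp
qed

lemma dual_op_eqI:
  assumes "\<And>\<phi>. \<phi> \<in> D \<Longrightarrow> blinfun_apply f (B \<phi>) = blinfun_apply \<phi> y"
  shows "f \<in> Dd" "Bd f = y"
proof -
  show "f \<in> Dd" using assms by (auto simp: dual_dom_def)
  show "Bd f = y" unfolding dual_op_def
    by (rule the_equality) (use assms D_separates in auto)
qed

lemma dual_op_eq: "f \<in> Dd \<Longrightarrow> \<phi> \<in> D \<Longrightarrow> blinfun_apply f (B \<phi>) = blinfun_apply \<phi> (Bd f)"
  using dual_op_eqI(2) by (auto simp: dual_dom_def)

lemma Bd_add: "f + h \<in> Dd" "Bd (f + h) = Bd f + Bd h" if "f \<in> Dd" "h \<in> Dd"
  using dual_op_eqI[of "f + h" "Bd f + Bd h"] that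
  by (simp_all add: dual_op_eq blinfun.add_left blinfun.add_right)

lemma Bd_scale: "c *\<^sub>R f \<in> Dd" "Bd (c *\<^sub>R f) = c *\<^sub>R Bd f" if "f \<in> Dd"
  using dual_op_eqI[of "c *\<^sub>R f" "c *\<^sub>R Bd f"] that
  by (simp_all add: dual_op_eq blinfun.scaleR_left blinfun.scaleR_right)

lemma Bd_0: "0 \<in> Dd" "Bd 0 = 0"
  using dual_op_eqI[of 0 0] by simp_all

lemma Bd_diff: "f - h \<in> Dd" "Bd (f - h) = Bd f - Bd h" if "f \<in> Dd" "h \<in> Dd"
  using Bd_add[of f "(-1) *\<^sub>R h"] Bd_scale[of h "-1"] that by simp_all

lemma subspace_Dd: "subspace Dd"
  using Bd_add Bd_scale Bd_0 by (auto simp: subspace_def)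

section \<open>The projection of Y onto \<open>Yp\<close> along \<open>ker A\<close>\<close>

definition Py :: "'y \<Rightarrow> 'y" where "Py y = (SOME w. w \<in> Yp \<and> blinfun_apply A (y - w) = 0)"

lemma subspace_Yp: "subspace Yp" and closed_Yp: "closed Yp"
  using G2 by (auto simp: G2_def closed_subspace_def)

lemma af_Yp: obtains \<delta> where "0 < \<delta>" "\<And>w. w \<in> Yp \<Longrightarrow> \<delta> * (norm w)\<^sup>2 \<le> af w w"
  using G2 by (auto simp: G2_def)

lemma Py: "Py y \<in> Yp" "blinfun_apply A (Py y) = blinfun_apply A y"
proof -
  have "y \<in> (\<lambda>(u, v). u + v) ` (ker A \<times> Yp)" using G2 by (auto simp: G2_def bij_betw_def)
  then have "\<exists>w. w \<in> Yp \<and> blinfun_apply A (y - w) = 0" by (force simp: ker_def)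
  then have "Py y \<in> Yp \<and> blinfun_apply A (y - Py y) = 0" unfolding Py_def by (rule someI_ex)
  then show "Py y \<in> Yp" "blinfun_apply A (Py y) = blinfun_apply A y"
    by (auto simp: blinfun.diff_right)
qed

lemma Yp_ker: "w \<in> Yp \<Longrightarrow> blinfun_apply A w = 0 \<Longrightarrow> w = 0"
proof -
  assume w: "w \<in> Yp" "blinfun_apply A w = 0"
  obtain \<delta> where \<delta>: "0 < \<delta>" "\<And>w. w \<in> Yp \<Longrightarrow> \<delta> * (norm w)\<^sup>2 \<le> af w w" by (rule af_Yp) blast
  have "\<delta> * (norm w)\<^sup>2 \<le> 0" using \<delta>(2)[OF w(1)] w(2) by simp
  then show "w = 0" using \<delta>(1) by (simp add: mult_le_0_iff)
qed

lemma Py_eqI: "w \<in> Yp \<Longrightarrow> blinfun_apply A w = blinfun_apply A y \<Longrightarrow> Py y = w"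
  using Yp_ker[of "Py y - w"] Py[of y] subspace_diff[OF subspace_Yp]
  by (simp add: blinfun.diff_right)

text \<open>Coercivity tested on Py y gives delta |Py y|^2 <= af y (Py y). The bound by |A y|
  instead of |y| is what later converts control of A y(t) into control of the \<open>Yp\<close>
  component.\<close>

lemma Py_bound: obtains C where "0 \<le> C" "\<And>y. norm (Py y) \<le> C * norm (blinfun_apply A y)"
proof -
  obtain \<delta> where \<delta>: "0 < \<delta>" "\<And>w. w \<in> Yp \<Longrightarrow> \<delta> * (norm w)\<^sup>2 \<le> af w w" by (rule af_Yp) blast
  have "norm (Py y) \<le> (1 / \<delta>) * norm (blinfun_apply A y)" for y
  proof -
    have "\<delta> * (norm (Py y))\<^sup>2 \<le> af y (Py y)" using \<delta>(2)[OF Py(1), of y] by (simp add: Py(2))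
    also have "\<dots> \<le> norm (blinfun_apply A y) * norm (Py y)" using norm_blinfun[of "blinfun_apply A y" "Py y"] by simp
    finally have "\<delta> * norm (Py y) \<le> norm (blinfun_apply A y)"
      by (cases "Py y = 0") (auto simp: power2_eq_square)
    then show ?thesis using \<delta>(1) by (simp add: field_simps)
  qed
  then show ?thesis using that[of "1 / \<delta>"] \<delta>(1) by simp
qed

lemma bounded_linear_Py: "bounded_linear Py"
proof -
  obtain C where C: "0 \<le> C" "\<And>y. norm (Py y) \<le> C * norm (blinfun_apply A y)" by (rule Py_bound) blast
  show ?thesis
  proof (rule bounded_linear_intro)
    show "Py (x + y) = Py x + Py y" for x y
      by (rule Py_eqI) (auto simp: Py blinfun.add_right intro: subspace_add[OF subspace_Yp])
    show "Py (c *\<^sub>R x) = c *\<^sub>R Py x" for c x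
      by (rule Py_eqI) (auto simp: Py blinfun.scaleR_right intro: subspace_scale[OF subspace_Yp])
    show "norm (Py x) \<le> norm x * (C * norm A)" for x
    proof -
      have "C * norm (blinfun_apply A x) \<le> C * (norm A * norm x)" using C(1) norm_blinfun by (intro mult_left_mono)
      then show ?thesis using C(2)[of x] by (simp add: mult_ac)
    qed
  qed
qed

lemma af_nonneg: "0 \<le> af y y"
proof -
  obtain \<delta> where \<delta>: "0 < \<delta>" "\<And>w. w \<in> Yp \<Longrightarrow> \<delta> * (norm w)\<^sup>2 \<le> af w w" by (rule af_Yp) blast
  have "0 \<le> \<delta> * (norm (Py y))\<^sup>2" using \<delta>(1) by simp
  also have "\<dots> \<le> af (Py y) (Py y)" by (rule \<delta>(2)[OF Py(1)])
  also have "\<dots> = af y y" using af_commute[of y "Py y"] by (simp add: Py(2))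
  finally show ?thesis .
qed

lemma A_bound: obtains C where "0 < C" "\<And>y. norm (blinfun_apply A y) \<le> C * sqrt (af y y)"
proof -
  \<comment> \<open>Cauchy-Schwarz for the semidefinite form yields sqrt (norm A); adding 1 keeps
    the constant positive when A = 0.\<close>
  define C where "C = sqrt (norm A) + 1"
  have "norm (blinfun_apply A y) \<le> C * sqrt (af y y)" for y
  proof (rule norm_blinfun_bound)
    show "0 \<le> C * sqrt (af y y)" using af_nonneg by (simp add: C_def)
    fix w
    have "\<bar>af y w\<bar> \<le> sqrt (af y y) * sqrt (af w w)"
      by (rule form_Cauchy_Schwarz_sqrt[OF bounded_bilinear_af af_commute subspace_UNIV]) (auto simp: af_nonneg)
    also have "sqrt (af w w) \<le> C * norm w"
    proof -
      have "af w w \<le> norm (blinfun_apply A w) * norm w" using norm_blinfun[of "blinfun_apply A w" w] by simp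
      also have "\<dots> \<le> norm A * norm w * norm w" by (intro mult_right_mono norm_blinfun) auto
      finally have "sqrt (af w w) \<le> sqrt (norm A * (norm w)\<^sup>2)" by (simp add: power2_eq_square mult_ac)
      also have "\<dots> = sqrt (norm A) * norm w" by (simp add: real_sqrt_mult)
      also have "\<dots> \<le> C * norm w" by (simp add: C_def algebra_simps)
      finally show ?thesis .
    qed
    finally have "\<bar>af y w\<bar> \<le> sqrt (af y y) * (C * norm w)" using af_nonneg by (simp add: mult_left_mono)
    then show "norm (af y w) \<le> C * sqrt (af y y) * norm w" by (simp add: mult_ac)
  qed
  moreover have "0 < C" by (simp add: C_def add_nonneg_pos)
  ultimately show ?thesis using that by blast
qed

lemma af_zero_iff: "af y y = 0 \<longleftrightarrow> blinfun_apply A y = 0"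
proof
  obtain C where "0 < C" "\<And>y. norm (blinfun_apply A y) \<le> C * sqrt (af y y)" by (rule A_bound) blast
  then show "af y y = 0 \<Longrightarrow> blinfun_apply A y = 0" by (metis mult_zero_right norm_le_zero_iff real_sqrt_zero)
qed simp

section \<open>The projections belonging to \<open>Xm\<close>, \<open>ker L\<close> and
  \<open>Xp\<close>\<close>

lemma subspace_Xm: "subspace Xm" and subspace_Xp: "subspace Xp" and closed_Xp: "closed Xp"
  using G3 by (auto simp: G3_def closed_subspace_def)

lemma subspace_ker_L: "subspace (ker L)"
  by (auto simp: subspace_def ker_def blinfun.add_right blinfun.scaleR_right)

lemma lf_Xp: obtains \<delta> where "0 < \<delta>" "\<And>w. w \<in> Xp \<Longrightarrow> \<delta> * (norm w)\<^sup>2 \<le> lf w w"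
  using G3 by (auto simp: G3_def)

text \<open>Only the components in \<open>Xm\<close> and \<open>Xp\<close> are chosen; the one in
  \<open>ker L\<close> is the remainder.\<close>

definition Xmk :: "'x \<Rightarrow> 'x \<times> 'x" where
  "Xmk x = (SOME (m, p). m \<in> Xm \<and> p \<in> Xp \<and> blinfun_apply L (x - m - p) = 0)"
definition Pm :: "'x \<Rightarrow> 'x" where "Pm x = fst (Xmk x)"
definition Pp :: "'x \<Rightarrow> 'x" where "Pp x = snd (Xmk x)"
definition Px :: "'x \<Rightarrow> 'x" where "Px x = Pm x + Pp x"

lemma Pmp: "Pm x \<in> Xm" "Pp x \<in> Xp" "blinfun_apply L (x - Pm x - Pp x) = 0"
proof -
  have "x \<in> (\<lambda>(u, v, w). u + v + w) ` (Xm \<times> ker L \<times> Xp)" using G3 by (auto simp: G3_def bij_betw_def)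
  then obtain m k p where "m \<in> Xm" "k \<in> ker L" "p \<in> Xp" "x = m + k + p" by auto
  then have "\<exists>z. (case z of (m, p) \<Rightarrow> m \<in> Xm \<and> p \<in> Xp \<and> blinfun_apply L (x - m - p) = 0)"
    by (intro exI[of _ "(m, p)"]) (simp add: ker_def)
  then have "(case Xmk x of (m, p) \<Rightarrow> m \<in> Xm \<and> p \<in> Xp \<and> blinfun_apply L (x - m - p) = 0)"
    unfolding Xmk_def by (rule someI_ex)
  then show "Pm x \<in> Xm" "Pp x \<in> Xp" "blinfun_apply L (x - Pm x - Pp x) = 0"
    by (auto simp: Pm_def Pp_def split: prod.splits)
qed

lemma Pmp_eqI:
  assumes "m \<in> Xm" "p \<in> Xp" "blinfun_apply L (x - m - p) = 0"
  shows "Pm x = m" "Pp x = p"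
proof -
  have inj: "inj_on (\<lambda>(u, v, w). u + v + w) (Xm \<times> ker L \<times> Xp)" using G3 by (simp add: G3_def bij_betw_def)
  have "(Pm x, x - Pm x - Pp x, Pp x) = (m, x - m - p, p)"
    by (rule inj_onD[OF inj]) (use assms Pmp in \<open>auto simp: ker_def\<close>)
  then show "Pm x = m" "Pp x = p" by auto
qed

lemma L_Px: "blinfun_apply L (Px x) = blinfun_apply L x"
  using Pmp(3)[of x] by (simp add: Px_def blinfun.diff_right blinfun.add_right algebra_simps)

lemma Pmp_ker: "Pm x = 0" "Pp x = 0" if "blinfun_apply L x = 0"
  using Pmp_eqI[of 0 0 x] that subspace_0[OF subspace_Xm] subspace_0[OF subspace_Xp] by simp_all

lemma linear_Pm: "linear Pm" and linear_Pp: "linear Pp"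
proof -
  have a: "Pm (x + y) = Pm x + Pm y \<and> Pp (x + y) = Pp x + Pp y" for x y
    using Pmp_eqI[of "Pm x + Pm y" "Pp x + Pp y" "x + y"] Pmp[of x] Pmp[of y]
      subspace_add[OF subspace_Xm] subspace_add[OF subspace_Xp]
    by (simp add: blinfun.diff_right blinfun.add_right algebra_simps)
  have s: "Pm (c *\<^sub>R x) = c *\<^sub>R Pm x \<and> Pp (c *\<^sub>R x) = c *\<^sub>R Pp x" for c x
    using Pmp_eqI[of "c *\<^sub>R Pm x" "c *\<^sub>R Pp x" "c *\<^sub>R x"] Pmp[of x]
      subspace_scale[OF subspace_Xm] subspace_scale[OF subspace_Xp]
    by (simp add: blinfun.diff_right blinfun.scaleR_right scaleR_diff_right[symmetric])
  show "linear Pm" "linear Pp" using a s by (auto intro!: linearI)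
qed

lemma Xm_basis: obtains b where "finite b" "pairwise orthogonal b" "span b = Xm"
proof -
  obtain b where "finite b" "span b = Xm" using G3 by (auto simp: G3_def)
  then show ?thesis using basis_orthogonal[of b] that by metis
qed

text \<open>As L k = 0, coercivity on \<open>Xp\<close> reads delta |p|^2 <= lf (k + p) p, so the
  projection to \<open>Xp\<close> inside \<open>ker L\<close> + \<open>Xp\<close> is
  bounded.\<close>

lemma kernel_component_bound:
  obtains C where "\<And>k p. blinfun_apply L k = 0 \<Longrightarrow> p \<in> Xp \<Longrightarrow> norm p \<le> C * norm (k + p)"
proof -
  obtain \<delta> where \<delta>: "0 < \<delta>" "\<And>w. w \<in> Xp \<Longrightarrow> \<delta> * (norm w)\<^sup>2 \<le> lf w w" by (rule lf_Xp) blast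
  have "norm p \<le> (norm L / \<delta>) * norm (k + p)" if k: "blinfun_apply L k = 0" and p: "p \<in> Xp" for k p
  proof -
    have "\<delta> * (norm p)\<^sup>2 \<le> lf (k + p) p" using \<delta>(2)[OF p] k by (simp add: blinfun.add_right)
    also have "\<dots> \<le> norm (blinfun_apply L (k + p)) * norm p" using norm_blinfun[of "blinfun_apply L (k + p)" p] by simp
    also have "\<dots> \<le> norm L * norm (k + p) * norm p" by (intro mult_right_mono norm_blinfun) auto
    finally have "\<delta> * norm p \<le> norm L * norm (k + p)" by (cases "p = 0") (auto simp: power2_eq_square)
    then show ?thesis using \<delta>(1) by (simp add: field_simps)
  qed
  then show ?thesis using that by blast
qed

text \<open>By \<open>kernel_component_bound\<close> a convergent sequence in the sum has Cauchy
  components in \<open>Xp\<close>; the remainder then converges inside the kernel.\<close>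

lemma closed_subspace_ker_Xp: "closed_subspace {k + p |k p. blinfun_apply L k = 0 \<and> p \<in> Xp}" (is "closed_subspace ?S")
  unfolding closed_subspace_def
proof
  have "?S = {x + y |x y. x \<in> ker L \<and> y \<in> Xp}" by (auto simp: ker_def)
  then show sub: "subspace ?S" using subspace_sums[OF subspace_ker_L subspace_Xp] by simp
  obtain C where C: "\<And>k p. blinfun_apply L k = 0 \<Longrightarrow> p \<in> Xp \<Longrightarrow> norm p \<le> C * norm (k + p)" by (rule kernel_component_bound) blast
  show "closed ?S" unfolding closed_sequential_limits
  proof (intro allI impI, elim conjE)
    fix s l assume s: "\<forall>n. s n \<in> ?S" and l: "s \<longlonglongrightarrow> l"
    have "\<forall>n. \<exists>k p. blinfun_apply L k = 0 \<and> p \<in> Xp \<and> s n = k + p" using s by blast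
    then obtain k p where kp: "\<And>n. blinfun_apply L (k n) = 0" "\<And>n. p n \<in> Xp" "\<And>n. s n = k n + p n" by metis
    define C' where "C' = \<bar>C\<bar> + 1"
    have C': "norm (p i - p j) \<le> C' * norm (s i - s j)" for i j
    proof -
      have "norm (p i - p j) \<le> C * norm ((k i - k j) + (p i - p j))"
        by (rule C) (use kp subspace_diff[OF subspace_Xp] in \<open>auto simp: blinfun.diff_right\<close>)
      also have "\<dots> \<le> C' * norm ((k i - k j) + (p i - p j))" by (rule mult_right_mono) (auto simp: C'_def)
      finally show ?thesis by (simp add: kp(3) algebra_simps)
    qed
    have "0 < C'" by (simp add: C'_def)
    have "Cauchy p"
    proof (rule metric_CauchyI)
      fix e :: real assume "0 < e"
      then obtain M where M: "\<And>m n. m \<ge> M \<Longrightarrow> n \<ge> M \<Longrightarrow> dist (s m) (s n) < e / C'"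
        using LIMSEQ_imp_Cauchy[OF l] \<open>0 < C'\<close> unfolding Cauchy_def by (meson divide_pos_pos)
      have "dist (p m) (p n) < e" if "m \<ge> M" "n \<ge> M" for m n
        using M[OF that] C'[of m n] \<open>0 < C'\<close> unfolding dist_norm by (simp add: pos_less_divide_eq mult.commute)
      then show "\<exists>M. \<forall>m\<ge>M. \<forall>n\<ge>M. dist (p m) (p n) < e" by blast
    qed
    then obtain q where q: "p \<longlonglongrightarrow> q" using Cauchy_convergent convergent_def by blast
    have "q \<in> Xp" using closed_sequentially[OF closed_Xp _ q] kp by blast
    have "(\<lambda>n. blinfun_apply L (s n - p n)) \<longlonglongrightarrow> blinfun_apply L (l - q)"
      by (intro tendsto_intros l q)
    moreover have "blinfun_apply L (s n - p n) = 0" for n using kp by simp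
    ultimately have "blinfun_apply L (l - q) = 0" by (simp add: LIMSEQ_const_iff)
    then show "l \<in> ?S" using \<open>q \<in> Xp\<close> by (metis (mono_tags, lifting) diff_add_cancel mem_Collect_eq)
  qed
qed

text \<open>\<open>Xm\<close> is finite-dimensional and meets the closed subspace
  \<open>ker L\<close> + \<open>Xp\<close> only in 0, which bounds \<open>Pm\<close>. Inside that
  sum, coercivity on \<open>Xp\<close> bounds \<open>Pp\<close>.\<close>

lemma bounded_linear_Pm: "bounded_linear Pm" and bounded_linear_Pp: "bounded_linear Pp"
proof -
  define S where "S = {k + p |k p. blinfun_apply L k = 0 \<and> p \<in> Xp}"
  obtain b where b: "finite b" "pairwise orthogonal b" "span b = Xm" by (rule Xm_basis)
  have "S \<inter> span b = {0}"
  proof -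
    have "m = 0" if m: "m \<in> Xm" "m \<in> S" for m
    proof -
      obtain k p where kp: "blinfun_apply L k = 0" "p \<in> Xp" "m = k + p" using m(2) S_def by blast
      have "Pm m = m" "Pm m = 0"
        using Pmp_eqI(1)[of m 0 m] Pmp_eqI(1)[of 0 p m] m(1) kp subspace_0[OF subspace_Xm] subspace_0[OF subspace_Xp]
        by simp_all
      then show ?thesis by simp
    qed
    moreover have "0 \<in> S" using closed_subspace_ker_Xp subspace_0 unfolding S_def closed_subspace_def by blast
    ultimately show ?thesis using b(3) subspace_0[OF subspace_Xm] by auto
  qed
  then obtain C where C: "\<And>s m. s \<in> S \<Longrightarrow> m \<in> span b \<Longrightarrow> norm m \<le> C * norm (s + m)"
    using finite_dimensional_complement_bound[OF closed_subspace_ker_Xp b(1,2)] unfolding S_def by blast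
  have Pm: "norm (Pm x) \<le> norm x * C" for x
  proof -
    have "x - Pm x = (x - Pm x - Pp x) + Pp x" by simp
    then have "x - Pm x \<in> S" unfolding S_def using Pmp by blast
    then show ?thesis using C[of "x - Pm x" "Pm x"] Pmp b(3) by (simp add: mult.commute)
  qed
  then show "bounded_linear Pm" using linear_Pm
    by (auto simp: bounded_linear_def bounded_linear_axioms_def)
  obtain C2 where C2: "\<And>k p. blinfun_apply L k = 0 \<Longrightarrow> p \<in> Xp \<Longrightarrow> norm p \<le> C2 * norm (k + p)" by (rule kernel_component_bound) blast
  have "norm (Pp x) \<le> norm x * (\<bar>C2\<bar> * (1 + C))" for x
  proof -
    have "norm (Pp x) \<le> C2 * norm (x - Pm x)" using C2[OF Pmp(3)[of x] Pmp(2)[of x]] by simp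
    also have "\<dots> \<le> \<bar>C2\<bar> * norm (x - Pm x)" by (rule mult_right_mono) auto
    also have "\<dots> \<le> \<bar>C2\<bar> * (norm x + norm x * C)"
      using norm_triangle_ineq4[of x "Pm x"] Pm[of x] by (intro mult_left_mono) auto
    finally show ?thesis by (simp add: algebra_simps)
  qed
  then show "bounded_linear Pp" using linear_Pp
    by (auto simp: bounded_linear_def bounded_linear_axioms_def)
qed

lemma bounded_linear_Px: "bounded_linear Px"
  using bounded_linear_add[OF bounded_linear_Pm bounded_linear_Pp] by (simp add: Px_def[abs_def])

lemma Px_fix: "x \<in> subspace_sum Xp Xm \<Longrightarrow> Px x = x"
proof -
  assume "x \<in> subspace_sum Xp Xm"
  then obtain p m where pm: "p \<in> Xp" "m \<in> Xm" "x = p + m" by (auto simp: subspace_sum_def)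
  have "Pm x = m" "Pp x = p" using Pmp_eqI[of m p x] pm by simp_all
  then show ?thesis using pm by (simp add: Px_def)
qed

end

text \<open>\<open>T\<close> comes from an unbounded operator and lives only on \<open>F\<close>.
  Weak bounds on the image of the unit ball suffice by uniform boundedness; the codomain is complete
  even though \<open>F\<close> need not be.\<close>

lemma bounded_on_if_weakly_bounded:
  fixes T :: "'b::real_normed_vector \<Rightarrow> 'a::{real_inner,complete_space}"
  assumes F: "subspace F" and scale: "\<And>c g. g \<in> F \<Longrightarrow> T (c *\<^sub>R g) = c *\<^sub>R T g"
    and weak: "\<And>x. \<exists>K. \<forall>g\<in>F. \<bar>inner x (T g)\<bar> \<le> K * norm g"
  obtains C where "0 \<le> C" "\<And>g. g \<in> F \<Longrightarrow> norm (T g) \<le> C * norm g"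
proof -
  define S where "S = T ` {g \<in> F. norm g \<le> 1}"
  have "\<exists>K. \<forall>s\<in>S. \<bar>inner x s\<bar> \<le> K" for x
  proof -
    obtain K where K: "\<And>g. g \<in> F \<Longrightarrow> \<bar>inner x (T g)\<bar> \<le> K * norm g" using weak by blast
    have "\<bar>inner x s\<bar> \<le> \<bar>K\<bar>" if s: "s \<in> S" for s
    proof -
      obtain g where g: "g \<in> F" "norm g \<le> 1" "s = T g" using s unfolding S_def by blast
      have "K * norm g \<le> \<bar>K\<bar> * 1" using g(2) by (intro mult_mono) auto
      then show ?thesis using K[OF g(1)] g(3) by simp
    qed
    then show ?thesis by blast
  qed
  then obtain K where K: "\<And>s. s \<in> S \<Longrightarrow> norm s \<le> K" by (rule weakly_bounded_imp_bounded[of S]) auto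
  have "norm (T g) \<le> \<bar>K\<bar> * norm g" if g: "g \<in> F" for g
  proof (cases "g = 0")
    case True
    then show ?thesis using scale[OF g, of 0] by simp
  next
    case False
    have "T ((1 / norm g) *\<^sub>R g) \<in> S" using False g F by (auto simp: S_def intro!: imageI subspace_scale)
    then have "norm ((1 / norm g) *\<^sub>R T g) \<le> K" using K scale[OF g] by metis
    then show ?thesis using False by (simp add: field_simps) (smt (verit) mult_right_mono norm_ge_zero)
  qed
  then show ?thesis using that[of "\<bar>K\<bar>"] by simp
qed

lemma square_sum_le: "finite I \<Longrightarrow> (\<Sum>e\<in>I. \<bar>h e\<bar>)\<^sup>2 \<le> real (card I) * (\<Sum>e\<in>I. (h e)\<^sup>2)" for h :: "'i \<Rightarrow> real"
  using Cauchy_Schwarz_ineq_sum[of "\<lambda>_. 1" "\<lambda>e. \<bar>h e\<bar>" I] by simp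

section \<open>Consequences of (G4): adapted functionals and bounded kernel components\<close>

context separable_operators
begin

lemma Pm_Px: "Pm (Px x) = Pm x"
  using Pmp_eqI(1)[of "Pm x" "Pp x" "Px x"] Pmp[of x] by (simp add: Px_def blinfun.zero_right)

text \<open>The difference of \<open>f\<close> and its composition with \<open>Px\<close> vanishes
  on \<open>Xp\<close> + \<open>Xm\<close>, so (G4) puts it into \<open>Dd\<close>.\<close>

lemma comp_Px_mem_Dd: "f \<in> Dd \<Longrightarrow> Blinfun (\<lambda>x. blinfun_apply f (Px x)) \<in> Dd"
proof -
  assume f: "f \<in> Dd"
  have ap: "blinfun_apply (Blinfun (\<lambda>x. blinfun_apply f (Px x))) x = blinfun_apply f (Px x)" for x
    by (subst bounded_linear_Blinfun_apply) (auto intro: bounded_linear_compose[OF blinfun.bounded_linear_right bounded_linear_Px])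
  have "f - Blinfun (\<lambda>x. blinfun_apply f (Px x)) \<in> annihilator (subspace_sum Xp Xm)"
    by (auto simp: annihilator_def blinfun.diff_left ap Px_fix)
  then have "f - Blinfun (\<lambda>x. blinfun_apply f (Px x)) \<in> Dd" using G4 by (auto simp: G4_def)
  from Bd_diff(1)[OF f this] show ?thesis by simp
qed

text \<open>The coordinates of \<open>Xm\<close>, perturbed into the dense domain of \<open>B'\<close>.\<close>

lemma coercive_functionals:
  obtains I :: "'x set" and g :: "'x \<Rightarrow> 'x \<Rightarrow>\<^sub>L real" and c :: real
  where "finite I" "0 < c" "\<And>e. e \<in> I \<Longrightarrow> g e \<in> Dd"
    "\<And>x. c * (norm (Px x))\<^sup>2 \<le> lf x x + (\<Sum>e\<in>I. (blinfun_apply (g e) x)\<^sup>2)"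
proof -
  obtain b where b: "finite b" "pairwise orthogonal b" "span b = Xm" by (rule Xm_basis)
  obtain \<delta> where \<delta>: "0 < \<delta>" "\<And>w. w \<in> Xp \<Longrightarrow> \<delta> * (norm w)\<^sup>2 \<le> lf w w" by (rule lf_Xp) blast
  define l where "l = norm L"
  \<comment> \<open>l bounds the form on \<open>Xm\<close>; 2 l^2 / \<delta> is the price of Young's
    inequality, which spends half of the coercivity on the mixed term.\<close>
  define C1 where "C1 = l + 2 * l\<^sup>2 / \<delta>"
  have C1: "0 \<le> C1" using \<delta>(1) by (simp add: C1_def l_def)
  \<comment> \<open>The 1/2 lets the \<open>Xm\<close> part be absorbed on the left. The square root
    gives 8 * C1 * \<eta>^2 <= \<delta> / 4, half of the coercivity that the mixed term
    leaves.\<close>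
  define \<eta> where "\<eta> = min (1/2) (sqrt (\<delta> / (32 * (C1 + 1))))"
  have \<eta>0: "0 < \<eta>" using \<delta>(1) C1 by (simp add: \<eta>_def)
  have \<eta>1: "\<eta> \<le> 1/2" by (simp add: \<eta>_def)
  have "\<eta>\<^sup>2 \<le> (sqrt (\<delta> / (32 * (C1 + 1))))\<^sup>2" using \<eta>0 by (intro power_mono) (auto simp: \<eta>_def)
  then have "\<eta>\<^sup>2 \<le> \<delta> / (32 * (C1 + 1))" using \<delta>(1) C1 by simp
  then have "\<eta>\<^sup>2 * (32 * (C1 + 1)) \<le> \<delta>" using C1 by (simp add: field_simps)
  moreover have "\<eta>\<^sup>2 * (32 * (C1 + 1)) = 32 * (C1 * \<eta>\<^sup>2) + 32 * \<eta>\<^sup>2" by (simp add: algebra_simps)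
  moreover have "0 \<le> \<eta>\<^sup>2" by simp
  ultimately have "C1 * \<eta>\<^sup>2 \<le> \<delta> / 32" by linarith
  then have \<eta>2: "8 * C1 * \<eta>\<^sup>2 \<le> \<delta> / 4" by (simp add: mult.assoc)
  define \<gamma> where "\<gamma> e = Blinfun (\<lambda>x. (1 / norm e) * inner e (Pm x))" for e :: 'x
  have \<gamma>: "blinfun_apply (\<gamma> e) x = (1 / norm e) * inner e (Pm x)" for e x
    unfolding \<gamma>_def by (subst bounded_linear_Blinfun_apply)
      (rule bounded_linear_compose[OF bounded_linear_mult_right
          bounded_linear_compose[OF bounded_linear_inner_right bounded_linear_Pm]], simp)
  \<comment> \<open>All card b perturbations together cost at most \<eta>; the 1 covers an empty
    \<open>b\<close>.\<close>
  define \<epsilon> where "\<epsilon> = \<eta> / (real (card b) + 1)"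
  have \<epsilon>: "0 < \<epsilon>" using \<eta>0 by (simp add: \<epsilon>_def add_nonneg_pos)
  have "\<exists>f\<in>Dd. dist f (\<gamma> e) < \<epsilon>" for e
  proof -
    have "\<gamma> e \<in> closure Dd" using G1 by (simp add: G1_def densely_defined_def)
    then show ?thesis using \<epsilon> unfolding closure_approachable by blast
  qed
  then obtain f where f: "\<And>e. f e \<in> Dd" "\<And>e. dist (f e) (\<gamma> e) < \<epsilon>" by metis
  \<comment> \<open>Composition with \<open>Px\<close> stays in \<open>Dd\<close> and makes the
    value depend on \<open>Px x\<close> alone, so that it can be compared with
    \<open>\<gamma> e\<close> with an error measured by \<open>Px x\<close>.\<close>
  define h where "h e = Blinfun (\<lambda>x. blinfun_apply (f e) (Px x))" for e
  have h: "blinfun_apply (h e) x = blinfun_apply (f e) (Px x)" for e x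
    unfolding h_def by (subst bounded_linear_Blinfun_apply)
      (auto intro: bounded_linear_compose[OF blinfun.bounded_linear_right bounded_linear_Px])
  have hD: "h e \<in> Dd" for e unfolding h_def by (rule comp_Px_mem_Dd[OF f(1)])
  \<comment> \<open>6 * c = \<delta> / 4 is the coefficient of p^2 still available;
    \<open>\<kappa>\<close> gathers the multiples of G^2 and the factor card b from
    \<open>square_sum_le\<close>.\<close>
  define c where "c = \<delta> / 24"
  define \<kappa> where "\<kappa> = (8 * C1 + 16 * c) * real (card b)"
  have \<kappa>: "0 \<le> \<kappa>" using C1 \<delta>(1) by (simp add: \<kappa>_def c_def)
  define g where "g e = sqrt \<kappa> *\<^sub>R h e" for e
  have "c * (norm (Px x))\<^sup>2 \<le> lf x x + (\<Sum>e\<in>b. (blinfun_apply (g e) x)\<^sup>2)" for x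
  proof -
    define G where "G = (\<Sum>e\<in>b. \<bar>blinfun_apply (h e) x\<bar>)"
    define m where "m = norm (Pm x)"
    define p where "p = norm (Pp x)"
    have pos: "0 \<le> m" "0 \<le> p" "0 \<le> G" by (auto simp: m_def p_def G_def sum_nonneg)
    have Pxle: "norm (Px x) \<le> m + p" unfolding m_def p_def Px_def by (rule norm_triangle_ineq)
    have "m \<le> (\<Sum>e\<in>b. \<bar>blinfun_apply (\<gamma> e) (Px x)\<bar>)"
      using span_le_sum_inner(2)[OF b(1,2), of "Pm x"] Pmp(1) b(3) by (simp add: m_def \<gamma> Pm_Px abs_mult)
    also have "\<dots> \<le> (\<Sum>e\<in>b. \<bar>blinfun_apply (h e) x\<bar> + \<epsilon> * (m + p))"
    proof (rule sum_mono)
      fix e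
      have "\<bar>blinfun_apply (f e - \<gamma> e) (Px x)\<bar> \<le> norm (f e - \<gamma> e) * norm (Px x)"
        using norm_blinfun[of "f e - \<gamma> e" "Px x"] by simp
      also have "\<dots> \<le> \<epsilon> * (m + p)"
        using f(2)[of e] Pxle \<epsilon> by (intro mult_mono) (auto simp: dist_norm)
      finally show "\<bar>blinfun_apply (\<gamma> e) (Px x)\<bar> \<le> \<bar>blinfun_apply (h e) x\<bar> + \<epsilon> * (m + p)"
        by (simp add: h blinfun.diff_left)
    qed
    also have "\<dots> = G + real (card b) * \<epsilon> * (m + p)" by (simp add: sum.distrib G_def)
    also have "\<dots> \<le> G + \<eta> * (m + p)"
    proof -
      have "real (card b) * \<epsilon> \<le> \<eta>" using \<eta>0 by (simp add: \<epsilon>_def field_simps)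
      then show ?thesis using pos by (intro add_left_mono mult_right_mono) auto
    qed
    finally have "m \<le> G + \<eta> * m + \<eta> * p" by (simp add: algebra_simps)
    moreover have "\<eta> * m \<le> 1/2 * m" using \<eta>1 pos by (intro mult_right_mono) auto
    ultimately have "m \<le> 2 * G + 2 * (\<eta> * p)" by linarith
    then have "m\<^sup>2 \<le> (2 * G + 2 * (\<eta> * p))\<^sup>2" using pos by (intro power_mono) auto
    also have "\<dots> \<le> 8 * G\<^sup>2 + 8 * (\<eta> * p)\<^sup>2"
      using zero_le_power2[of "2 * G - 2 * (\<eta> * p)"] by (simp add: power2_eq_square algebra_simps)
    finally have m2: "m\<^sup>2 \<le> 8 * G\<^sup>2 + 8 * \<eta>\<^sup>2 * p\<^sup>2" by (simp add: power_mult_distrib)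
    have "\<eta>\<^sup>2 \<le> (1/2)\<^sup>2" using \<eta>0 \<eta>1 by (intro power_mono) auto
    then have "\<eta>\<^sup>2 * p\<^sup>2 \<le> 1/4 * p\<^sup>2" by (intro mult_right_mono) (auto simp: power2_eq_square)
    moreover have "(norm (Px x))\<^sup>2 \<le> 2 * m\<^sup>2 + 2 * p\<^sup>2"
    proof -
      have "(norm (Px x))\<^sup>2 \<le> (m + p)\<^sup>2" using Pxle by (intro power_mono) auto
      also have "\<dots> \<le> 2 * m\<^sup>2 + 2 * p\<^sup>2"
        using zero_le_power2[of "m - p"] by (simp add: power2_eq_square algebra_simps)
      finally show ?thesis .
    qed
    ultimately have P2: "(norm (Px x))\<^sup>2 \<le> 16 * G\<^sup>2 + 6 * p\<^sup>2" using m2 by linarith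
    have bd: "\<bar>lf u v\<bar> \<le> l * norm u * norm v" for u v
    proof -
      have "\<bar>lf u v\<bar> \<le> norm (blinfun_apply L u) * norm v" using norm_blinfun[of "blinfun_apply L u" v] by simp
      also have "\<dots> \<le> l * norm u * norm v" unfolding l_def by (intro mult_right_mono norm_blinfun) auto
      finally show ?thesis .
    qed
    have "lf x x = lf (Px x) (Px x)" using lf_commute[of x "Px x"] by (simp add: L_Px)
    also have "\<dots> = lf (Pm x) (Pm x) + 2 * lf (Pm x) (Pp x) + lf (Pp x) (Pp x)"
      using form_add_scaled[OF bounded_bilinear_lf lf_commute, of "Pm x" 1 "Pp x"] by (simp add: Px_def)
    finally have "lf x x \<ge> \<delta> * p\<^sup>2 - 2 * (l * m * p) - l * m\<^sup>2"
      using bd[of "Pm x" "Pm x"] bd[of "Pm x" "Pp x"] \<delta>(2)[OF Pmp(2), of x]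
      unfolding m_def p_def by (simp add: power2_eq_square abs_le_iff mult.assoc)
    moreover have "2 * (l * m * p) \<le> \<delta> / 2 * p\<^sup>2 + 2 * l\<^sup>2 / \<delta> * m\<^sup>2"
    proof -
      have "0 \<le> 1 / (2 * \<delta>) * (\<delta> * p - 2 * l * m)\<^sup>2" using \<delta>(1) by simp
      also have "\<dots> = \<delta> / 2 * p\<^sup>2 + 2 * l\<^sup>2 / \<delta> * m\<^sup>2 - 2 * (l * m * p)"
        using \<delta>(1) by (simp add: power2_eq_square field_simps)
      finally show ?thesis by simp
    qed
    ultimately have lfx: "lf x x \<ge> \<delta> / 2 * p\<^sup>2 - C1 * m\<^sup>2" by (simp add: C1_def algebra_simps)
    have "C1 * m\<^sup>2 \<le> C1 * (8 * G\<^sup>2 + 8 * \<eta>\<^sup>2 * p\<^sup>2)" by (rule mult_left_mono[OF m2 C1])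
    also have "\<dots> = 8 * C1 * G\<^sup>2 + (8 * C1 * \<eta>\<^sup>2) * p\<^sup>2" by (simp add: algebra_simps)
    also have "\<dots> \<le> 8 * C1 * G\<^sup>2 + \<delta> / 4 * p\<^sup>2" using \<eta>2 by (intro add_left_mono mult_right_mono) auto
    finally have "\<delta> / 4 * p\<^sup>2 \<le> lf x x + 8 * C1 * G\<^sup>2" using lfx by linarith
    moreover have "c * (norm (Px x))\<^sup>2 \<le> c * (16 * G\<^sup>2 + 6 * p\<^sup>2)" using \<delta>(1) by (intro mult_left_mono P2) (simp add: c_def)
    moreover have "c * (16 * G\<^sup>2 + 6 * p\<^sup>2) = 16 * c * G\<^sup>2 + \<delta> / 4 * p\<^sup>2" by (simp add: c_def algebra_simps)
    moreover have "(8 * C1 + 16 * c) * G\<^sup>2 = 8 * C1 * G\<^sup>2 + 16 * c * G\<^sup>2" by (rule distrib_right)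
    ultimately have "c * (norm (Px x))\<^sup>2 \<le> lf x x + (8 * C1 + 16 * c) * G\<^sup>2" by linarith
    also have "\<dots> \<le> lf x x + (8 * C1 + 16 * c) * (real (card b) * (\<Sum>e\<in>b. (blinfun_apply (h e) x)\<^sup>2))"
      using square_sum_le[OF b(1), of "\<lambda>e. blinfun_apply (h e) x"] C1 \<delta>(1) unfolding G_def
      by (intro add_left_mono mult_left_mono) (auto simp: c_def)
    also have "\<dots> = lf x x + (\<Sum>e\<in>b. (blinfun_apply (g e) x)\<^sup>2)"
      using \<kappa> by (simp add: g_def blinfun.scaleR_left power_mult_distrib sum_distrib_left[symmetric] \<kappa>_def mult.assoc)
    finally show ?thesis .
  qed
  moreover have "g e \<in> Dd" for e unfolding g_def by (rule Bd_scale(1)[OF hD])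
  moreover have "0 < c" using \<delta>(1) by (simp add: c_def)
  ultimately show ?thesis using that[OF b(1)] by blast
qed

text \<open>Square root of the coercivity estimate, in the shape that
  \<open>drop_finitely_many_functionals\<close> and the growth estimates take. Since
  \<open>g e\<close> is in \<open>Dd\<close>, its value at B h is the value of h at Bd (g
  e).\<close>

lemma Px_le_seminorm:
  obtains I :: "'x set" and g :: "'x \<Rightarrow> 'x \<Rightarrow>\<^sub>L real" and C :: real
  where "finite I" "0 \<le> C" "\<And>e. e \<in> I \<Longrightarrow> g e \<in> Dd"
    "\<And>x. 0 \<le> lf x x \<Longrightarrow> norm (Px x) \<le> C * (sqrt (lf x x) + (\<Sum>e\<in>I. \<bar>blinfun_apply (g e) x\<bar>))"
proof -
  obtain I :: "'x set" and g and c :: real where g: "finite I" "0 < c" "\<And>e. e \<in> I \<Longrightarrow> g e \<in> Dd"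
    "\<And>x. c * (norm (Px x))\<^sup>2 \<le> lf x x + (\<Sum>e\<in>I. (blinfun_apply (g e) x)\<^sup>2)"
    by (rule coercive_functionals) blast
  have "norm (Px x) \<le> (1 / sqrt c) * (sqrt (lf x x) + (\<Sum>e\<in>I. \<bar>blinfun_apply (g e) x\<bar>))" if x: "0 \<le> lf x x" for x
  proof -
    have "sqrt c * norm (Px x) = sqrt (c * (norm (Px x))\<^sup>2)" by (simp add: real_sqrt_mult)
    also have "\<dots> \<le> sqrt (lf x x + (\<Sum>e\<in>I. (blinfun_apply (g e) x)\<^sup>2))" by (rule real_sqrt_le_mono[OF g(4)])
    also have "\<dots> \<le> sqrt (lf x x) + sqrt (\<Sum>e\<in>I. (blinfun_apply (g e) x)\<^sup>2)"
      by (rule sqrt_add_le_add_sqrt[OF x]) (simp add: sum_nonneg)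
    also have "sqrt (\<Sum>e\<in>I. (blinfun_apply (g e) x)\<^sup>2) \<le> (\<Sum>e\<in>I. \<bar>blinfun_apply (g e) x\<bar>)"
      using L2_set_le_sum_abs[of "\<lambda>e. blinfun_apply (g e) x" I] by (simp add: L2_set_def)
    finally show ?thesis using g(2) by (simp add: field_simps)
  qed
  then show ?thesis using that[of I "1 / sqrt c" g] g by simp
qed

text \<open>B is unbounded, but its component in \<open>ker L\<close> is not: a functional that sees
  only this component annihilates \<open>Xp\<close> + \<open>Xm\<close>, so it lies in
  \<open>Dd\<close> by (G4) and can be moved onto h.\<close>

lemma ker_component_B_bound:
  obtains C where "0 \<le> C" "\<And>h. h \<in> D \<Longrightarrow> norm (B h - Px (B h)) \<le> C * norm h"
proof (rule bounded_on_if_weakly_bounded[OF subspace_D, of "\<lambda>h. B h - Px (B h)"])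
  interpret P: bounded_linear Px by (rule bounded_linear_Px)
  show "B (c *\<^sub>R h) - Px (B (c *\<^sub>R h)) = c *\<^sub>R (B h - Px (B h))" if "h \<in> D" for c h
    using that by (simp add: B_scale P.scaleR scaleR_diff_right)
  show "\<exists>K. \<forall>h\<in>D. \<bar>inner x (B h - Px (B h))\<bar> \<le> K * norm h" for x
  proof -
    define f where "f = Blinfun (\<lambda>z. inner x (z - Px z))"
    have f: "blinfun_apply f z = inner x (z - Px z)" for z
      unfolding f_def by (subst bounded_linear_Blinfun_apply)
        (auto intro!: bounded_linear_compose[OF bounded_linear_inner_right] bounded_linear_sub bounded_linear_ident bounded_linear_Px)
    have "f \<in> annihilator (subspace_sum Xp Xm)" by (simp add: annihilator_def f Px_fix)
    then have fD: "f \<in> Dd" using G4 by (auto simp: G4_def)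
    have "\<bar>inner x (B h - Px (B h))\<bar> \<le> norm (Bd f) * norm h" if "h \<in> D" for h
      using dual_op_eq[OF fD that] norm_blinfun[of h "Bd f"] by (simp add: f mult.commute)
    then show ?thesis by blast
  qed
qed (use that in blast)

text \<open>By \<open>kap_dual\<close> the dual of \<open>kap\<close> extends the part of \<open>B'\<close> in \<open>ker A\<close> to all of \<open>X\<^sup>*\<close>; (G4) puts
  \<open>hY \<eta>\<close> into the domain of \<open>B\<close>.\<close>

definition hY :: "'y \<Rightarrow> 'y \<Rightarrow>\<^sub>L real" where "hY \<eta> = Blinfun (\<lambda>z. inner \<eta> (z - Py z))"
definition kap :: "'y \<Rightarrow> 'x" where "kap \<eta> = B (hY \<eta>)"

lemma hY_apply: "blinfun_apply (hY \<eta>) z = inner \<eta> (z - Py z)"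
  unfolding hY_def by (subst bounded_linear_Blinfun_apply)
    (auto intro!: bounded_linear_compose[OF bounded_linear_inner_right] bounded_linear_sub bounded_linear_ident bounded_linear_Py)

lemma hY_mem: "hY \<eta> \<in> D"
proof -
  have "hY \<eta> \<in> annihilator Yp" using Py_eqI[OF _ refl] by (simp add: annihilator_def hY_apply)
  then show ?thesis using G4 by (auto simp: G4_def)
qed

lemma kap_dual: "f \<in> Dd \<Longrightarrow> blinfun_apply f (kap \<eta>) = inner \<eta> (Bd f - Py (Bd f))"
  unfolding kap_def by (subst dual_op_eq) (auto simp: hY_mem hY_apply)

text \<open>Counterpart for B': by \<open>kap_dual\<close> each \<open>\<eta>\<close> tests the
  component in \<open>ker A\<close> through the fixed vector kap \<eta>.\<close>

lemma ker_component_Bd_bound: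
  obtains C where "0 \<le> C" "\<And>f. f \<in> Dd \<Longrightarrow> norm (Bd f - Py (Bd f)) \<le> C * norm f"
proof (rule bounded_on_if_weakly_bounded[OF subspace_Dd, of "\<lambda>f. Bd f - Py (Bd f)"])
  interpret P: bounded_linear Py by (rule bounded_linear_Py)
  show "Bd (c *\<^sub>R h) - Py (Bd (c *\<^sub>R h)) = c *\<^sub>R (Bd h - Py (Bd h))" if "h \<in> Dd" for c h
    using that by (simp add: Bd_scale P.scaleR scaleR_diff_right)
  show "\<exists>K. \<forall>f\<in>Dd. \<bar>inner \<eta> (Bd f - Py (Bd f))\<bar> \<le> K * norm f" for \<eta>
  proof -
    have "\<bar>inner \<eta> (Bd f - Py (Bd f))\<bar> \<le> norm (kap \<eta>) * norm f" if "f \<in> Dd" for f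
      using norm_blinfun[of f "kap \<eta>"] kap_dual[OF that] by (simp add: mult.commute)
    then show ?thesis by blast
  qed
qed (use that in blast)

text \<open>Transposes \<open>ker_component_Bd_bound\<close>. The norm of kap \<eta> is read off
  with the functional given by kap \<eta> itself, which need not be in \<open>Dd\<close>; density of
  \<open>Dd\<close> carries the bound over to it.\<close>

lemma bounded_linear_kap: "bounded_linear kap"
proof -
  interpret P: bounded_linear Py by (rule bounded_linear_Py)
  obtain C where C: "0 \<le> C" "\<And>f. f \<in> Dd \<Longrightarrow> norm (Bd f - Py (Bd f)) \<le> C * norm f"
    by (rule ker_component_Bd_bound) blast
  have bd: "\<bar>blinfun_apply f (kap \<eta>)\<bar> \<le> norm \<eta> * (C * norm f)" for f \<eta>
  proof -
    have "f \<in> closure Dd" using G1 by (simp add: G1_def densely_defined_def)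
    then obtain \<phi> where \<phi>: "\<And>n. \<phi> n \<in> Dd" "\<phi> \<longlonglongrightarrow> f" unfolding closure_sequential by blast
    have "\<bar>blinfun_apply (\<phi> n) (kap \<eta>)\<bar> \<le> norm \<eta> * (C * norm (\<phi> n))" for n
    proof -
      have "\<bar>inner \<eta> (Bd (\<phi> n) - Py (Bd (\<phi> n)))\<bar> \<le> norm \<eta> * norm (Bd (\<phi> n) - Py (Bd (\<phi> n)))"
        by (rule Cauchy_Schwarz_ineq2)
      also have "\<dots> \<le> norm \<eta> * (C * norm (\<phi> n))" by (intro mult_left_mono C \<phi>) auto
      finally show ?thesis by (simp add: kap_dual \<phi>)
    qed
    moreover have "(\<lambda>n. \<bar>blinfun_apply (\<phi> n) (kap \<eta>)\<bar>) \<longlonglongrightarrow> \<bar>blinfun_apply f (kap \<eta>)\<bar>"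
      by (intro tendsto_intros \<phi>)
    moreover have "(\<lambda>n. norm \<eta> * (C * norm (\<phi> n))) \<longlonglongrightarrow> norm \<eta> * (C * norm f)"
      by (intro tendsto_intros \<phi>)
    ultimately show ?thesis by (intro LIMSEQ_le) auto
  qed
  show ?thesis
  proof (rule bounded_linear_intro)
    show "kap (x + y) = kap x + kap y" for x y
    proof -
      have "hY (x + y) = hY x + hY y" by (rule blinfun_eqI) (simp add: hY_apply blinfun.add_left inner_add_left)
      then show ?thesis by (simp add: kap_def B_add hY_mem)
    qed
    show "kap (c *\<^sub>R x) = c *\<^sub>R kap x" for c x
    proof -
      have "hY (c *\<^sub>R x) = c *\<^sub>R hY x" by (rule blinfun_eqI) (simp add: hY_apply blinfun.scaleR_left)
      then show ?thesis by (simp add: kap_def B_scale hY_mem)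
    qed
    show "norm (kap \<eta>) \<le> norm \<eta> * C" for \<eta>
    proof (cases "kap \<eta> = 0")
      case False
      have n: "norm (blinfun_inner_left (kap \<eta>)) \<le> norm (kap \<eta>)"
        by (rule norm_blinfun_bound) (auto simp: Cauchy_Schwarz_ineq2 inner_commute[of _ "kap \<eta>"])
      have "norm (kap \<eta>) * norm (kap \<eta>) \<le> norm \<eta> * (C * norm (blinfun_inner_left (kap \<eta>)))"
        using bd[of "blinfun_inner_left (kap \<eta>)" \<eta>] by (simp add: power2_norm_eq_inner[symmetric] power2_eq_square)
      also have "\<dots> \<le> norm \<eta> * (C * norm (kap \<eta>))" using C(1) n by (intro mult_left_mono) auto
      finally show ?thesis using False by simp
    qed (use C in simp)
  qed
qed

text \<open>The coercive form on \<open>Yp\<close> represents g there by some A c, and the rest is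
  \<open>hY\<close> of the Riesz vector of g. Thus the range of B is spanned by the range of B A and
  the range of the bounded map \<open>kap\<close>.\<close>

lemma A_decompose:
  assumes "g \<in> D"
  obtains c \<eta> where "g = blinfun_inner_right \<eta>" "g = blinfun_apply A c + hY \<eta>" "blinfun_apply A c \<in> D"
proof -
  obtain \<eta> where \<eta>: "\<And>w. blinfun_apply g w = inner \<eta> w"
    using Riesz_representation[OF blinfun.bounded_linear_right] by blast
  obtain \<delta> where \<delta>: "0 < \<delta>" "\<And>w. w \<in> Yp \<Longrightarrow> \<delta> * (norm w)\<^sup>2 \<le> af w w" by (rule af_Yp) blast
  have "closed_subspace Yp" using subspace_Yp closed_Yp by (simp add: closed_subspace_def)
  from coercive_form_represents[OF bounded_bilinear_af af_commute this \<delta>(1) \<delta>(2) blinfun.bounded_linear_right[of g]]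
  obtain c where c: "c \<in> Yp" "\<And>w. w \<in> Yp \<Longrightarrow> af c w = blinfun_apply g w" by blast
  have eq: "g = blinfun_apply A c + hY \<eta>"
  proof (rule blinfun_eqI)
    fix w
    have "af c w = af w c" by (rule af_commute)
    also have "\<dots> = af c (Py w)" using af_commute[of "Py w" c] by (simp add: Py(2))
    also have "\<dots> = blinfun_apply g (Py w)" by (rule c(2)[OF Py(1)])
    finally show "blinfun_apply g w = blinfun_apply (blinfun_apply A c + hY \<eta>) w"
      by (simp add: blinfun.add_left hY_apply \<eta> inner_diff_right)
  qed
  have "blinfun_apply A c = g - hY \<eta>" by (subst eq) simp
  then have "blinfun_apply A c \<in> D" using assms hY_mem subspace_diff[OF subspace_D] by simp
  moreover have "g = blinfun_inner_right \<eta>" by (rule blinfun_eqI) (simp add: \<eta>)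
  ultimately show ?thesis using that eq by blast
qed

text \<open>Such an f acts on the range of B only through \<open>kap\<close>, which is bounded, so
  Riesz produces B' f. Applied to f = L n for the limit n of a null sequence of
  displacements.\<close>

lemma annihilates_range_BA:
  assumes f: "\<And>c. blinfun_apply A c \<in> D \<Longrightarrow> blinfun_apply f (B (blinfun_apply A c)) = 0"
  shows "f \<in> Dd" "blinfun_apply A (Bd f) = 0" "blinfun_apply f (kap \<eta>) = inner \<eta> (Bd f)"
proof -
  have "bounded_linear (\<lambda>\<eta>. blinfun_apply f (kap \<eta>))"
    by (rule bounded_linear_compose[OF blinfun.bounded_linear_right bounded_linear_kap])
  then obtain y where y: "\<And>\<eta>. blinfun_apply f (kap \<eta>) = inner y \<eta>" using Riesz_representation by blast
  have "blinfun_apply f (B g) = blinfun_apply g y" if g: "g \<in> D" for g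
  proof -
    obtain c \<eta> where c: "g = blinfun_inner_right \<eta>" "g = blinfun_apply A c + hY \<eta>" "blinfun_apply A c \<in> D"
      using A_decompose[OF g] by metis
    have "blinfun_apply f (B g) = blinfun_apply f (B (blinfun_apply A c) + kap \<eta>)"
      by (subst c(2)) (simp add: B_add c(3) hY_mem kap_def)
    also have "\<dots> = inner y \<eta>" by (simp add: blinfun.add_right f[OF c(3)] y)
    also have "\<dots> = blinfun_apply g y" by (simp add: c(1) inner_commute)
    finally show ?thesis .
  qed
  note fy = dual_op_eqI[OF this]
  from fy(1) show "f \<in> Dd" .
  from fy(2) have By: "Bd f = y" .
  then show "blinfun_apply f (kap \<eta>) = inner \<eta> (Bd f)" by (simp add: y inner_commute)
  have "af y w = 0" for w
  proof -
    obtain \<eta> where \<eta>: "\<And>z. af w z = inner \<eta> z"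
      using Riesz_representation[OF blinfun.bounded_linear_right] by blast
    \<comment> \<open>The functional A w vanishes on \<open>ker A\<close>, so its \<open>hY\<close>
      part, and with it kap \<eta>, is zero.\<close>
    have "hY \<eta> = 0"
    proof (rule blinfun_eqI)
      fix z
      have "af w z = af w (Py z)" using af_commute[of w z] af_commute[of w "Py z"] by (simp add: Py(2))
      then show "blinfun_apply (hY \<eta>) z = blinfun_apply 0 z"
        by (simp add: hY_apply inner_diff_right \<eta>[symmetric])
    qed
    then have "kap \<eta> = 0" by (simp add: kap_def B_0)
    then have "inner y \<eta> = 0" using y[of \<eta>] by simp
    then show ?thesis using \<eta>[of y] by (simp add: af_commute[of y w] inner_commute)
  qed
  then show "blinfun_apply A (Bd f) = 0" by (intro blinfun_eqI) (simp add: By)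
qed

text \<open>The kernel half of B'' = B. Project (g, 0) onto the closed graph of B: orthogonality of
  the residual (a, b) to the graph says B' b = - a, and since g kills a the residual is 0, so (g, 0)
  lies on the graph.\<close>

lemma B_kernel:
  assumes g: "\<And>f. f \<in> Dd \<Longrightarrow> blinfun_apply g (Bd f) = 0"
  shows "g \<in> D" "B g = 0"
proof -
  \<comment> \<open>The graph is transported to Y x X by Riesz vectors, because the orthogonal
    projection needs an inner product.\<close>
  define \<Gamma> where "\<Gamma> = {(\<eta>, x). blinfun_inner_right \<eta> \<in> D \<and> x = B (blinfun_inner_right \<eta>)}"
  have j: "blinfun_inner_right (a + b) = blinfun_inner_right a + blinfun_inner_right b"
    "blinfun_inner_right (c *\<^sub>R a) = c *\<^sub>R blinfun_inner_right a" for a b :: 'y and c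
    by (auto intro!: blinfun_eqI simp: inner_add_left blinfun.add_left blinfun.scaleR_left)
  have j0: "blinfun_inner_right 0 = (0 :: 'y \<Rightarrow>\<^sub>L real)" using j(2)[of 0 0] by simp
  have sub: "subspace \<Gamma>"
    using subspace_0[OF subspace_D] subspace_add[OF subspace_D] subspace_scale[OF subspace_D]
    by (auto simp: subspace_def \<Gamma>_def zero_prod_def j j0 B_0 B_add B_scale)
  have "closed ((\<lambda>(\<eta>, x). (blinfun_inner_right \<eta>, x)) -` {(h, B h) |h. h \<in> D})"
    using G1 by (intro closed_vimage)
      (auto simp: G1_def closed_operator_def case_prod_beta intro!: continuous_intros
        bounded_linear.continuous_on[OF bounded_linear_blinfun_inner_right])
  also have "(\<lambda>(\<eta>, x). (blinfun_inner_right \<eta>, x)) -` {(h, B h) |h. h \<in> D} = \<Gamma>" by (auto simp: \<Gamma>_def)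
  finally have cl: "closed_subspace \<Gamma>" using sub by (simp add: closed_subspace_def)
  obtain \<eta>0 where \<eta>0: "\<And>w. blinfun_apply g w = inner \<eta>0 w"
    using Riesz_representation[OF blinfun.bounded_linear_right] by blast
  obtain p where p: "p \<in> \<Gamma>" "\<And>w. w \<in> \<Gamma> \<Longrightarrow> inner ((\<eta>0, 0) - p) w = 0"
    using orthogonal_projection_exists[OF cl] by metis
  obtain a b where ab: "(\<eta>0, 0) - p = (a, b)" by fastforce
  have o: "inner a \<eta> + inner b (B (blinfun_inner_right \<eta>)) = 0" if "blinfun_inner_right \<eta> \<in> D" for \<eta>
    using p(2)[of "(\<eta>, B (blinfun_inner_right \<eta>))"] that by (simp add: ab \<Gamma>_def)
  have "blinfun_apply (blinfun_inner_right b) (B h) = blinfun_apply h (- a)" if h: "h \<in> D" for h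
  proof -
    obtain \<eta> where \<eta>: "\<And>w. blinfun_apply h w = inner \<eta> w"
      using Riesz_representation[OF blinfun.bounded_linear_right] by blast
    have "h = blinfun_inner_right \<eta>" by (rule blinfun_eqI) (simp add: \<eta>)
    then show ?thesis using o[of \<eta>] h by (simp add: inner_commute)
  qed
  from dual_op_eqI[OF this] have "blinfun_inner_right b \<in> Dd" "Bd (blinfun_inner_right b) = - a" by blast+
  then have "inner \<eta>0 a = 0" using g[of "blinfun_inner_right b"] by (simp add: \<eta>0)
  moreover have "inner (a, b) (a, b) = inner (a, b) (\<eta>0, 0) - inner (a, b) p"
    by (simp only: inner_diff_right[symmetric] ab)
  ultimately have "inner (a, b) (a, b) = 0" using p(2)[OF p(1)] by (simp add: ab inner_commute)
  then have "(a, b) = 0" by (simp only: inner_eq_zero_iff)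
  then have "(\<eta>0, 0) \<in> \<Gamma>" using ab p(1) by simp
  moreover have "g = blinfun_inner_right \<eta>0" by (rule blinfun_eqI) (simp add: \<eta>0)
  ultimately show "g \<in> D" "B g = 0" by (auto simp: \<Gamma>_def)
qed

end

section \<open>The group and the center space\<close>

lemma has_vector_derivative_at_iff_quotient:
  "(f has_vector_derivative d) (at t) \<longleftrightarrow> ((\<lambda>h. (1 / h) *\<^sub>R (f (t + h) - f t)) \<longlongrightarrow> d) (at 0)"
  for f :: "real \<Rightarrow> 'a::real_normed_vector"
proof -
  have "(f has_vector_derivative d) (at t) \<longleftrightarrow>
      ((\<lambda>h. norm (f (t + h) - f t - h *\<^sub>R d) / norm h) \<longlongrightarrow> 0) (at 0)"
    by (simp add: has_vector_derivative_def has_derivative_at bounded_linear_scaleR_left)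
  also have "\<dots> \<longleftrightarrow> ((\<lambda>h. norm ((1 / h) *\<^sub>R (f (t + h) - f t) - d)) \<longlongrightarrow> 0) (at 0)"
  proof (rule filterlim_cong[OF refl refl])
    have "norm (f (t + h) - f t - h *\<^sub>R d) / norm h = norm ((1 / h) *\<^sub>R (f (t + h) - f t) - d)" if "h \<noteq> 0" for h
    proof -
      have "(1 / h) *\<^sub>R (f (t + h) - f t) - d = (1 / h) *\<^sub>R (f (t + h) - f t - h *\<^sub>R d)"
        using that by (simp add: scaleR_diff_right)
      then show ?thesis by (simp add: divide_inverse abs_inverse mult.commute)
    qed
    then show "\<forall>\<^sub>F h in at 0. norm (f (t + h) - f t - h *\<^sub>R d) / norm h = norm ((1 / h) *\<^sub>R (f (t + h) - f t) - d)"
      by (auto simp: eventually_at intro!: exI[of _ 1])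
  qed
  also have "\<dots> \<longleftrightarrow> ((\<lambda>h. (1 / h) *\<^sub>R (f (t + h) - f t)) \<longlongrightarrow> d) (at 0)"
    by (simp add: tendsto_norm_zero_iff LIM_zero_iff)
  finally show ?thesis .
qed

lemma constant_if_vector_derivative_zero:
  fixes f :: "real \<Rightarrow> 'a::real_normed_vector"
  assumes "\<And>t. (f has_vector_derivative 0) (at t)"
  shows "f s = f t"
proof -
  obtain c where "\<And>x. x \<in> UNIV \<Longrightarrow> f x = c"
    using has_vector_derivative_zero_constant[of UNIV f] assms by auto
  then show ?thesis by simp
qed

section \<open>Time reversal and the group of JL\<close>

definition reflect :: "'a \<times> 'b::real_vector \<Rightarrow> 'a \<times> 'b" where
  "reflect z = (fst z, - snd z)"

lemma reflect_simps [simp]: "fst (reflect z) = fst z" "snd (reflect z) = - snd z" "reflect (reflect z) = z"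
  by (simp_all add: reflect_def)

lemma norm_reflect [simp]: "norm (reflect z) = norm z" for z :: "'a::real_normed_vector \<times> 'b::real_normed_vector"
  by (simp add: reflect_def norm_prod_def)

lemma bounded_linear_reflect: "bounded_linear (reflect :: 'a::real_normed_vector \<times> 'b::real_normed_vector \<Rightarrow> _)"
  by (rule bounded_linear_intro[where K = 1]) (auto simp: reflect_def norm_prod_def)

locale separable_hamiltonian = separable_operators L A D B Xm Xp Yp
  for L :: "'x::{real_inner,complete_space} \<Rightarrow>\<^sub>L ('x \<Rightarrow>\<^sub>L real)"
    and A :: "'y::{real_inner,complete_space} \<Rightarrow>\<^sub>L ('y \<Rightarrow>\<^sub>L real)"
    and D :: "('y \<Rightarrow>\<^sub>L real) set"
    and B :: "('y \<Rightarrow>\<^sub>L real) \<Rightarrow> 'x"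
    and Xm Xp :: "'x set"
    and Yp :: "'y set" +
  fixes T :: "real \<Rightarrow> ('x \<times> 'y) \<Rightarrow>\<^sub>L ('x \<times> 'y)"
  assumes gen: "generates_C0_group (JL_dom L A D B) (JL_op L A D B) T"
begin

abbreviation "dG \<equiv> JL_dom L A D B"
abbreviation "G \<equiv> JL_op L A D B"
abbreviation "Ec \<equiv> E_c L A D B"
abbreviation "bl z w \<equiv> lf (fst z) (fst w) + af (snd z) (snd w)"

lemma dG_iff: "z \<in> dG \<longleftrightarrow> blinfun_apply L (fst z) \<in> Dd \<and> blinfun_apply A (snd z) \<in> D"
  by (cases z) (simp add: JL_dom_def J_dom_def L_op_def)

lemma G_eq: "G z = (B (blinfun_apply A (snd z)), - Bd (blinfun_apply L (fst z)))"
  by (cases z) (simp add: JL_op_def J_op_def L_op_def)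

lemma pairing_eq: "pairing (L_op L A z) w = bl z w"
  by (cases z; cases w) (simp add: pairing_def L_op_def)

lemma bounded_bilinear_bl: "bounded_bilinear bl"
proof -
  interpret l: bounded_bilinear lf by (rule bounded_bilinear_lf)
  interpret a: bounded_bilinear af by (rule bounded_bilinear_af)
  have 1: "norm (lf u v) \<le> norm u * norm v * norm L" for u v
    using norm_blinfun[of "blinfun_apply L u" v] mult_right_mono[OF norm_blinfun[of L u], of "norm v"]
    by (simp add: mult_ac)
  have 2: "norm (af u v) \<le> norm u * norm v * norm A" for u v
    using norm_blinfun[of "blinfun_apply A u" v] mult_right_mono[OF norm_blinfun[of A u], of "norm v"]
    by (simp add: mult_ac)
  show ?thesis
  proof
    show "\<exists>K. \<forall>a b. norm (bl a b) \<le> norm a * norm b * K"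
    proof (intro exI allI)
      fix z w :: "'x \<times> 'y"
      have "norm (bl z w) \<le> norm (fst z) * norm (fst w) * norm L + norm (snd z) * norm (snd w) * norm A"
        using 1[of "fst z" "fst w"] 2[of "snd z" "snd w"] by (intro norm_triangle_le) (rule add_mono)
      also have "\<dots> \<le> norm z * norm w * norm L + norm z * norm w * norm A"
        using norm_fst_le[of "fst z" "snd z"] norm_fst_le[of "fst w" "snd w"]
          norm_snd_le[of "snd z" "fst z"] norm_snd_le[of "snd w" "fst w"]
        by (intro add_mono mult_mono) auto
      finally show "norm (bl z w) \<le> norm z * norm w * (norm L + norm A)" by (simp add: algebra_simps)
    qed
  qed (auto simp: l.add_left l.add_right a.add_left a.add_right l.scaleR_left l.scaleR_right
        a.scaleR_left a.scaleR_right algebra_simps)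
qed

text \<open>J is anti-self-dual; this is the source of energy conservation.\<close>

lemma bl_skew: "z \<in> dG \<Longrightarrow> w \<in> dG \<Longrightarrow> bl (G z) w = - bl z (G w)"
proof -
  assume z: "z \<in> dG" and w: "w \<in> dG"
  have 1: "lf (B (blinfun_apply A (snd z))) (fst w) = af (snd z) (Bd (blinfun_apply L (fst w)))"
    using dual_op_eq z w by (subst lf_commute) (auto simp: dG_iff)
  have 2: "lf (fst z) (B (blinfun_apply A (snd w))) = af (snd w) (Bd (blinfun_apply L (fst z)))"
    using dual_op_eq z w by (auto simp: dG_iff)
  show ?thesis
    by (simp add: G_eq 1 2 blinfun.minus_right blinfun.minus_left af_commute[of "snd w"])
qed

lemma subspace_dG: "subspace dG"
  using subspace_D subspace_Dd
  by (auto simp: subspace_def dG_iff blinfun.add_right blinfun.scaleR_right blinfun.zero_right)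

lemma G_add: "z \<in> dG \<Longrightarrow> w \<in> dG \<Longrightarrow> G (z + w) = G z + G w"
  by (simp add: G_eq dG_iff blinfun.add_right B_add Bd_add)

lemma G_scale: "z \<in> dG \<Longrightarrow> G (c *\<^sub>R z) = c *\<^sub>R G z"
  by (simp add: G_eq dG_iff blinfun.scaleR_right B_scale Bd_scale)

lemma G_diff: "z \<in> dG \<Longrightarrow> w \<in> dG \<Longrightarrow> G (z - w) = G z - G w"
  by (simp add: G_eq dG_iff blinfun.diff_right B_diff Bd_diff)

lemma T_0 [simp]: "blinfun_apply (T 0) z = z"
  using gen by (simp add: generates_C0_group_def C0_group_def)

lemma T_add: "blinfun_apply (T (s + t)) z = blinfun_apply (T s) (blinfun_apply (T t) z)"
  using gen by (simp add: generates_C0_group_def C0_group_def)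

lemma T_inverse [simp]: "blinfun_apply (T (- t)) (blinfun_apply (T t) z) = z"
  using T_add[of "- t" t z] by simp

lemma T_continuous: "continuous_on UNIV (\<lambda>t. blinfun_apply (T t) z)"
  using gen unfolding generates_C0_group_def C0_group_def by blast

lemma generator_limit: "z \<in> dG \<Longrightarrow> ((\<lambda>h. (1 / h) *\<^sub>R (blinfun_apply (T h) z - z)) \<longlongrightarrow> G z) (at 0)"
  using gen unfolding generates_C0_group_def by blast

lemma generatorI:
  assumes "((\<lambda>h. (1 / h) *\<^sub>R (blinfun_apply (T h) z - z)) \<longlongrightarrow> w) (at 0)"
  shows "z \<in> dG" "G z = w"
proof -
  have "z \<in> dG \<and> w = G z" using gen assms unfolding generates_C0_group_def by blast
  then show "z \<in> dG" "G z = w" by auto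
qed

lemma T_commute_G: "blinfun_apply (T t) z \<in> dG" "G (blinfun_apply (T t) z) = blinfun_apply (T t) (G z)" if "z \<in> dG"
proof -
  have "((\<lambda>h. blinfun_apply (T t) ((1 / h) *\<^sub>R (blinfun_apply (T h) z - z))) \<longlongrightarrow> blinfun_apply (T t) (G z)) (at 0)"
    by (intro tendsto_intros generator_limit that)
  moreover have "blinfun_apply (T t) ((1 / h) *\<^sub>R (blinfun_apply (T h) z - z))
      = (1 / h) *\<^sub>R (blinfun_apply (T h) (blinfun_apply (T t) z) - blinfun_apply (T t) z)" for h
    by (simp add: blinfun.scaleR_right blinfun.diff_right T_add[symmetric] add.commute)
  ultimately have "((\<lambda>h. (1 / h) *\<^sub>R (blinfun_apply (T h) (blinfun_apply (T t) z) - blinfun_apply (T t) z)) \<longlongrightarrow> blinfun_apply (T t) (G z)) (at 0)"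
    by simp
  then show "blinfun_apply (T t) z \<in> dG" "G (blinfun_apply (T t) z) = blinfun_apply (T t) (G z)"
    by (rule generatorI)+
qed

lemma T_has_vector_derivative:
  assumes "z \<in> dG"
  shows "((\<lambda>t. blinfun_apply (T t) z) has_vector_derivative blinfun_apply (T t) (G z)) (at t)"
  unfolding has_vector_derivative_at_iff_quotient
  using generator_limit[OF T_commute_G(1)[OF assms, of t]] T_commute_G(2)[OF assms, of t]
  by (simp add: T_add[symmetric] add.commute)

text \<open>y t is the integral of T s z over [0, t]. The shift identity T h (y t) = y (t + h) - y h
  holds because both sides have the same derivative and agree at t = 0; it turns the difference
  quotient of the group at y t into difference quotients of y.\<close>

lemma primitive_exists:
  obtains y where "y 0 = 0" "\<And>t. (y has_vector_derivative blinfun_apply (T t) z) (at t)"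
    "\<And>t. y t \<in> dG" "\<And>t. G (y t) = blinfun_apply (T t) z - z"
proof -
  obtain y where y: "y 0 = 0" "\<And>t. (y has_vector_derivative blinfun_apply (T t) z) (at t)"
    using antiderivative_exists[OF T_continuous] by blast
  have q: "((\<lambda>h. (1 / h) *\<^sub>R (blinfun_apply (T h) (y t) - y t)) \<longlongrightarrow> blinfun_apply (T t) z - z) (at 0)" for t
  proof -
    have shift: "blinfun_apply (T h) (y t) = y (t + h) - y h" for h
    proof -
      have "((\<lambda>t. y (t + h)) has_vector_derivative blinfun_apply (T (t + h)) z) (at t)" for t
      proof -
        have "((\<lambda>t. t + h) has_vector_derivative 1) (at t)"
          by (auto intro!: derivative_eq_intros)
        from vector_diff_chain_at[OF this y(2)] show ?thesis by (simp add: o_def)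
      qed
      moreover have "((\<lambda>t. blinfun_apply (T h) (y t)) has_vector_derivative blinfun_apply (T h) (blinfun_apply (T t) z)) (at t)" for t
        by (rule bounded_linear.has_vector_derivative[OF blinfun.bounded_linear_right y(2)])
      ultimately have "((\<lambda>t. blinfun_apply (T h) (y t) - y (t + h)) has_vector_derivative
          blinfun_apply (T h) (blinfun_apply (T t) z) - blinfun_apply (T (t + h)) z) (at t)" for t
        by (intro has_vector_derivative_diff)
      then have "((\<lambda>t. blinfun_apply (T h) (y t) - y (t + h)) has_vector_derivative 0) (at t)" for t
        by (simp add: T_add[symmetric] add.commute)
      from constant_if_vector_derivative_zero[OF this, of t 0] show ?thesis
        by (simp add: y(1) blinfun.zero_right algebra_simps)
    qed
    have "((\<lambda>h. (1 / h) *\<^sub>R (y (t + h) - y t) - (1 / h) *\<^sub>R (y (0 + h) - y 0)) \<longlongrightarrow> blinfun_apply (T t) z - blinfun_apply (T 0) z) (at 0)"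
      by (intro tendsto_diff y(2)[unfolded has_vector_derivative_at_iff_quotient])
    then show ?thesis by (simp add: shift y(1) scaleR_diff_right algebra_simps)
  qed
  show ?thesis by (rule that[OF y]) (use generatorI[OF q] in auto)
qed

text \<open>The averages y h / h of the orbit lie in the domain and tend to z.\<close>

lemma dG_dense: obtains \<zeta> where "\<And>n::nat. \<zeta> n \<in> dG" "\<zeta> \<longlonglongrightarrow> z"
proof -
  obtain y where y: "y 0 = 0" "\<And>t. (y has_vector_derivative blinfun_apply (T t) z) (at t)"
    "\<And>t. y t \<in> dG" "\<And>t. G (y t) = blinfun_apply (T t) z - z" by (rule primitive_exists) blast
  have "((\<lambda>h. (1 / h) *\<^sub>R (y (0 + h) - y 0)) \<longlongrightarrow> blinfun_apply (T 0) z) (at 0)"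
    using y(2)[of 0] unfolding has_vector_derivative_at_iff_quotient .
  then have "((\<lambda>h. (1 / h) *\<^sub>R y h) \<longlongrightarrow> z) (at 0)" by (simp add: y(1))
  moreover have "filterlim (\<lambda>n. 1 / real (Suc n)) (at 0) sequentially"
    unfolding filterlim_at using LIMSEQ_Suc[OF lim_const_over_n[of "1::real"]] by simp
  ultimately have "((\<lambda>n. (1 / (1 / real (Suc n))) *\<^sub>R y (1 / real (Suc n))) \<longlongrightarrow> z) sequentially"
    by (rule filterlim_compose)
  moreover have "(1 / (1 / real (Suc n))) *\<^sub>R y (1 / real (Suc n)) \<in> dG" for n
    by (intro subspace_scale[OF subspace_dG] y)
  ultimately show ?thesis using that[of "\<lambda>n. (1 / (1 / real (Suc n))) *\<^sub>R y (1 / real (Suc n))"] by blast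
qed

lemma bl_preserved: "bl (blinfun_apply (T t) z) (blinfun_apply (T t) w) = bl z w"
proof -
  interpret bl: bounded_bilinear bl by (rule bounded_bilinear_bl)
  have dom: "bl (blinfun_apply (T t) z) (blinfun_apply (T t) w) = bl z w" if z: "z \<in> dG" and w: "w \<in> dG" for z w
  proof -
    have "((\<lambda>t. bl (blinfun_apply (T t) z) (blinfun_apply (T t) w)) has_vector_derivative
       bl (blinfun_apply (T t) z) (blinfun_apply (T t) (G w)) + bl (blinfun_apply (T t) (G z)) (blinfun_apply (T t) w)) (at t)" for t
      by (rule bl.has_vector_derivative[OF T_has_vector_derivative[OF z] T_has_vector_derivative[OF w]])
    moreover have "bl (blinfun_apply (T t) z) (blinfun_apply (T t) (G w)) + bl (blinfun_apply (T t) (G z)) (blinfun_apply (T t) w) = 0" for t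
      using bl_skew[OF T_commute_G(1)[OF z, of t] T_commute_G(1)[OF w, of t]] T_commute_G(2)[OF z, of t] T_commute_G(2)[OF w, of t]
      by simp
    ultimately have "((\<lambda>t. bl (blinfun_apply (T t) z) (blinfun_apply (T t) w)) has_vector_derivative 0) (at t)" for t
      by (simp only:)
    from constant_if_vector_derivative_zero[OF this, of t 0] show ?thesis by simp
  qed
  obtain \<zeta> \<omega> where \<zeta>: "\<And>n::nat. \<zeta> n \<in> dG" "\<zeta> \<longlonglongrightarrow> z" and \<omega>: "\<And>n::nat. \<omega> n \<in> dG" "\<omega> \<longlonglongrightarrow> w"
    using dG_dense[of z] dG_dense[of w] by metis
  have "(\<lambda>n. bl (blinfun_apply (T t) (\<zeta> n)) (blinfun_apply (T t) (\<omega> n))) \<longlonglongrightarrow> bl (blinfun_apply (T t) z) (blinfun_apply (T t) w)"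
    by (intro tendsto_intros \<zeta> \<omega>)
  moreover have "(\<lambda>n. bl (\<zeta> n) (\<omega> n)) \<longlonglongrightarrow> bl z w" by (intro tendsto_intros \<zeta> \<omega>)
  ultimately show ?thesis using dom[OF \<zeta>(1) \<omega>(1)] LIMSEQ_unique by simp
qed

lemma bl_move: "bl (blinfun_apply (T t) z) w = bl z (blinfun_apply (T (- t)) w)"
  using bl_preserved[of "- t" "blinfun_apply (T t) z" w] by simp

lemma T_locally_bounded: obtains K where "\<And>s. s \<in> {a..b} \<Longrightarrow> norm (T s) \<le> K"
proof -
  have "\<exists>K. \<forall>S\<in>T ` {a..b}. norm (blinfun_apply S z) \<le> K" for z
  proof -
    have "continuous_on {a..b} (\<lambda>t. norm (blinfun_apply (T t) z))"
      by (intro continuous_on_norm continuous_on_subset[OF T_continuous]) auto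
    then have "bounded ((\<lambda>t. norm (blinfun_apply (T t) z)) ` {a..b})"
      by (intro compact_imp_bounded compact_continuous_image) auto
    then show ?thesis by (auto simp: bounded_iff)
  qed
  then obtain K where "\<And>S. S \<in> T ` {a..b} \<Longrightarrow> norm S \<le> K" by (rule uniform_boundedness[of "T ` {a..b}"]) auto
  then show ?thesis using that by blast
qed

text \<open>T (- s) (d s) is constant. It identifies the group from an explicit solution, namely on
  eigenvectors and for reversed orbits.\<close>

lemma Cauchy_problem_unique:
  assumes dom: "\<And>s. d s \<in> dG" and der: "\<And>s. (d has_vector_derivative G (d s)) (at s)"
  shows "d s = blinfun_apply (T s) (d 0)"
proof -
  define e where "e s = blinfun_apply (T (- s)) (d s)" for s
  have "(e has_vector_derivative 0) (at s)" for s
    unfolding has_vector_derivative_at_iff_quotient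
  proof -
    obtain K where K: "\<And>r. r \<in> {- s - 1..- s + 1} \<Longrightarrow> norm (T r) \<le> K" by (rule T_locally_bounded) blast
    define q where "q h = (1 / h) *\<^sub>R (d (s + h) - d s) - (1 / h) *\<^sub>R (blinfun_apply (T h) (d s) - d s)" for h
    have "(q \<longlongrightarrow> G (d s) - G (d s)) (at 0)" unfolding q_def
      by (intro tendsto_diff der[unfolded has_vector_derivative_at_iff_quotient] generator_limit dom)
    then have "((\<lambda>h. K * norm (q h)) \<longlongrightarrow> K * norm (G (d s) - G (d s))) (at 0)" by (intro tendsto_intros)
    then have q0: "((\<lambda>h. K * norm (q h)) \<longlongrightarrow> 0) (at 0)" by simp
    \<comment> \<open>Pulling out T (- (s + h)) leaves the difference of the quotients of d and of
      the group at d s. Both tend to G (d s), and the operator pulled out is bounded for small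
      h.\<close>
    have eq: "(1 / h) *\<^sub>R (e (s + h) - e s) = blinfun_apply (T (- (s + h))) (q h)" for h
    proof -
      have "e s = blinfun_apply (T (- (s + h))) (blinfun_apply (T h) (d s))"
        by (simp add: e_def T_add[symmetric])
      then show ?thesis
        by (simp add: e_def q_def blinfun.diff_right blinfun.scaleR_right scaleR_diff_right)
    qed
    have ev: "\<forall>\<^sub>F h in at 0. norm ((1 / h) *\<^sub>R (e (s + h) - e s)) \<le> K * norm (q h)"
      unfolding eventually_at
    proof (intro exI[of _ 1] conjI ballI impI)
      fix h :: real assume "h \<noteq> 0 \<and> dist h 0 < 1"
      then have "norm (T (- (s + h))) \<le> K" by (intro K) auto
      then show "norm ((1 / h) *\<^sub>R (e (s + h) - e s)) \<le> K * norm (q h)"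
        unfolding eq by (meson mult_right_mono norm_blinfun norm_ge_zero order_trans)
    qed auto
    show "((\<lambda>h. (1 / h) *\<^sub>R (e (s + h) - e s)) \<longlongrightarrow> 0) (at 0)"
      by (rule Lim_null_comparison[OF ev q0])
  qed
  from constant_if_vector_derivative_zero[OF this, of s 0]
  have "blinfun_apply (T (- s)) (d s) = d 0" by (simp add: e_def)
  then have "blinfun_apply (T s) (d 0) = blinfun_apply (T (- (- s))) (blinfun_apply (T (- s)) (d s))" by simp
  then show ?thesis by (simp only: T_inverse)
qed

lemma T_eigenvector:
  assumes "z \<in> dG" and "G z = \<mu> *\<^sub>R z"
  shows "blinfun_apply (T t) z = exp (\<mu> * t) *\<^sub>R z"
proof -
  have "exp (\<mu> * s) *\<^sub>R z = blinfun_apply (T s) (exp (\<mu> * 0) *\<^sub>R z)" for s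
  proof (rule Cauchy_problem_unique[where d = "\<lambda>s. exp (\<mu> * s) *\<^sub>R z"])
    show "exp (\<mu> * s) *\<^sub>R z \<in> dG" for s by (rule subspace_scale[OF subspace_dG assms(1)])
    show "((\<lambda>s. exp (\<mu> * s) *\<^sub>R z) has_vector_derivative G (exp (\<mu> * s) *\<^sub>R z)) (at s)" for s
    proof -
      have "((\<lambda>s. exp (\<mu> * s)) has_real_derivative \<mu> * exp (\<mu> * s)) (at s)"
        by (auto intro!: derivative_eq_intros)
      then have "((\<lambda>s. exp (\<mu> * s)) has_vector_derivative \<mu> * exp (\<mu> * s)) (at s)"
        by (simp add: has_real_derivative_iff_has_vector_derivative)
      from bounded_linear.has_vector_derivative[OF bounded_linear_scaleR_left this, of z]
      show ?thesis by (simp add: G_scale assms mult.commute)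
    qed
  qed
  then show ?thesis by simp
qed

lemma T_fixes_kernel:
  assumes "z \<in> dG" and "G z = 0"
  shows "blinfun_apply (T t) z = z"
  using T_eigenvector[of z 0 t] assms by simp

lemma kernel_L: "z \<in> dG" "G z = 0" if "blinfun_apply L (fst z) = 0" "blinfun_apply A (snd z) = 0"
  using that subspace_0[OF subspace_D] by (auto simp: dG_iff G_eq Bd_0 B_0 zero_prod_def)

lemma reflect_dG: "reflect z \<in> dG" "G (reflect z) = - reflect (G z)" if "z \<in> dG"
proof -
  have "- blinfun_apply A (snd z) \<in> D" using that subspace_neg[OF subspace_D] by (simp add: dG_iff)
  then show "reflect z \<in> dG" using that by (simp add: dG_iff blinfun.minus_right)
  have "B (- blinfun_apply A (snd z)) = - B (blinfun_apply A (snd z))"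
    using B_scale[of "blinfun_apply A (snd z)" "-1"] that by (simp add: dG_iff)
  then show "G (reflect z) = - reflect (G z)" by (simp add: G_eq blinfun.minus_right reflect_def)
qed

text \<open>\<open>reflect\<close> anticommutes with G, so the reversed and reflected orbit solves
  the same Cauchy problem; density removes the domain condition.\<close>

lemma T_reflect: "blinfun_apply (T t) (reflect z) = reflect (blinfun_apply (T (- t)) z)"
proof -
  interpret R: bounded_linear "reflect :: 'x \<times> 'y \<Rightarrow> _" by (rule bounded_linear_reflect)
  have dom: "reflect (blinfun_apply (T (- t)) z) = blinfun_apply (T t) (reflect z)" if z: "z \<in> dG" for z t
  proof -
    have "reflect (blinfun_apply (T (- t)) z) = blinfun_apply (T t) (reflect (blinfun_apply (T (- 0)) z))"
    proof (rule Cauchy_problem_unique[where d = "\<lambda>t. reflect (blinfun_apply (T (- t)) z)"])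
      show "reflect (blinfun_apply (T (- s)) z) \<in> dG" for s by (intro reflect_dG T_commute_G z)
      show "((\<lambda>t. reflect (blinfun_apply (T (- t)) z)) has_vector_derivative G (reflect (blinfun_apply (T (- s)) z))) (at s)" for s
      proof -
        have "((\<lambda>t. - t) has_vector_derivative -1) (at s)" by (auto intro!: derivative_eq_intros)
        from vector_diff_chain_at[OF this T_has_vector_derivative[OF z]]
        have "((\<lambda>t. blinfun_apply (T (- t)) z) has_vector_derivative - blinfun_apply (T (- s)) (G z)) (at s)"
          by (simp add: o_def)
        from R.has_vector_derivative[OF this] show ?thesis
          by (simp add: reflect_dG(2)[OF T_commute_G(1)[OF z]] T_commute_G(2)[OF z] linear_neg[OF R.linear])
      qed
    qed
    then show ?thesis by simp
  qed
  obtain \<zeta> where \<zeta>: "\<And>n::nat. \<zeta> n \<in> dG" "\<zeta> \<longlonglongrightarrow> z" by (rule dG_dense) blast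
  have "(\<lambda>n. reflect (blinfun_apply (T (- t)) (\<zeta> n))) \<longlonglongrightarrow> reflect (blinfun_apply (T (- t)) z)"
    by (intro R.tendsto tendsto_intros \<zeta>)
  moreover have "(\<lambda>n. blinfun_apply (T t) (reflect (\<zeta> n))) \<longlonglongrightarrow> blinfun_apply (T t) (reflect z)"
    by (intro R.tendsto tendsto_intros \<zeta>)
  ultimately show ?thesis using dom[OF \<zeta>(1)] LIMSEQ_unique by simp
qed

lemma Ec_iff: "z \<in> Ec \<longleftrightarrow> (\<forall>\<mu> v. \<mu> \<noteq> 0 \<longrightarrow> v \<in> dG \<longrightarrow> G v = \<mu> *\<^sub>R v \<longrightarrow> bl z v = 0)"
proof
  interpret bl: bounded_bilinear bl by (rule bounded_bilinear_bl)
  assume z: "z \<in> Ec"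
  show "\<forall>\<mu> v. \<mu> \<noteq> 0 \<longrightarrow> v \<in> dG \<longrightarrow> G v = \<mu> *\<^sub>R v \<longrightarrow> bl z v = 0"
  proof (intro allI impI)
    fix \<mu> v assume v: "\<mu> \<noteq> 0" "v \<in> dG" "G v = \<mu> *\<^sub>R v"
    show "bl z v = 0"
    proof (cases "v = 0")
      case False
      then have e: "eigenvector_for dG G \<mu> v" using v by (simp add: eigenvector_for_def)
      have "v \<in> subspace_sum (E_s dG G) (E_u dG G)"
      proof (cases "\<mu> > 0")
        case True
        then have "v \<in> E_u dG G" "0 \<in> E_s dG G" using e by (auto simp: E_u_def E_s_def span_0 intro!: span_base)
        then show ?thesis unfolding subspace_sum_def by (metis (mono_tags, lifting) add_0 add_0_right mem_Collect_eq)
      next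
        case False
        then have "\<mu> < 0" using v(1) by simp
        then have "v \<in> E_s dG G" "0 \<in> E_u dG G" using e by (auto simp: E_u_def E_s_def span_0 intro!: span_base)
        then show ?thesis unfolding subspace_sum_def by (metis (mono_tags, lifting) add_0 add_0_right mem_Collect_eq)
      qed
      then show ?thesis using z by (simp add: E_c_def pairing_eq)
    qed (simp add: blinfun.zero_right)
  qed
next
  interpret bl: bounded_bilinear bl by (rule bounded_bilinear_bl)
  assume z: "\<forall>\<mu> v. \<mu> \<noteq> 0 \<longrightarrow> v \<in> dG \<longrightarrow> G v = \<mu> *\<^sub>R v \<longrightarrow> bl z v = 0"
  have sub: "subspace {v. bl z v = 0}"
    by (auto simp: subspace_def bl.zero_right bl.add_right bl.scaleR_right simp del: fst_add snd_add fst_scaleR snd_scaleR fst_zero snd_zero split_paired_All)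
  have ev: "bl z v = 0" if "eigenvector_for dG G \<mu> v" "\<mu> \<noteq> 0" for \<mu> v
    using z that unfolding eigenvector_for_def by blast
  have span: "span S \<subseteq> {v. bl z v = 0}" if S: "\<And>v. v \<in> S \<Longrightarrow> \<exists>\<mu>. \<mu> \<noteq> 0 \<and> eigenvector_for dG G \<mu> v" for S
  proof (rule span_minimal[OF _ sub], rule subsetI)
    fix v assume "v \<in> S"
    then obtain \<mu> where "\<mu> \<noteq> 0" "eigenvector_for dG G \<mu> v" using S by blast
    then show "v \<in> {v. bl z v = 0}" using ev by simp
  qed
  have Eu: "E_u dG G \<subseteq> {v. bl z v = 0}" unfolding E_u_def
  proof (rule span)
    fix v assume "v \<in> {z. \<exists>\<mu>>0. eigenvector_for dG G \<mu> z}"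
    then obtain \<mu> where "\<mu> > 0" "eigenvector_for dG G \<mu> v" by blast
    then show "\<exists>\<mu>. \<mu> \<noteq> 0 \<and> eigenvector_for dG G \<mu> v" by (intro exI[of _ \<mu>] conjI) simp_all
  qed
  have Es: "E_s dG G \<subseteq> {v. bl z v = 0}" unfolding E_s_def
  proof (rule span)
    fix v assume "v \<in> {z. \<exists>\<mu><0. eigenvector_for dG G \<mu> z}"
    then obtain \<mu> where "\<mu> < 0" "eigenvector_for dG G \<mu> v" by blast
    then show "\<exists>\<mu>. \<mu> \<noteq> 0 \<and> eigenvector_for dG G \<mu> v" by (intro exI[of _ \<mu>] conjI) simp_all
  qed
  have "bl z v = 0" if v: "v \<in> subspace_sum (E_s dG G) (E_u dG G)" for v
  proof -
    obtain a b where ab: "a \<in> E_s dG G" "b \<in> E_u dG G" "v = a + b" using v unfolding subspace_sum_def by blast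
    then have "bl z a = 0" "bl z b = 0" using subsetD[OF Es] subsetD[OF Eu] by simp_all
    then show ?thesis unfolding ab(3) bl.add_right by simp
  qed
  then show "z \<in> Ec" by (simp add: E_c_def pairing_eq)
qed

lemma Ec_D: "z \<in> Ec \<Longrightarrow> \<mu> \<noteq> 0 \<Longrightarrow> v \<in> dG \<Longrightarrow> G v = \<mu> *\<^sub>R v \<Longrightarrow> bl z v = 0"
  unfolding Ec_iff by blast

lemma Ec_I: "(\<And>\<mu> v. \<mu> \<noteq> 0 \<Longrightarrow> v \<in> dG \<Longrightarrow> G v = \<mu> *\<^sub>R v \<Longrightarrow> bl z v = 0) \<Longrightarrow> z \<in> Ec"
  unfolding Ec_iff by blast

lemma Ec_Inter: "Ec = \<Inter>{{z. bl z v = 0} |v. \<exists>\<mu>. \<mu> \<noteq> 0 \<and> v \<in> dG \<and> G v = \<mu> *\<^sub>R v}"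
  unfolding set_eq_iff Ec_iff by blast

lemma subspace_Ec: "subspace Ec"
proof -
  interpret bl: bounded_bilinear bl by (rule bounded_bilinear_bl)
  have "subspace {z. bl z v = 0}" for v
    unfolding subspace_def mem_Collect_eq bl.zero_left bl.add_left bl.scaleR_left by simp
  then show ?thesis unfolding Ec_Inter by (intro subspace_Inter) blast
qed

lemma closed_Ec: "closed Ec"
proof -
  have "closed {z. bl z v = 0}" for v by (intro closed_Collect_eq continuous_intros)
  then show ?thesis unfolding Ec_Inter by (intro closed_Inter) blast
qed

lemma T_Ec: "z \<in> Ec \<Longrightarrow> blinfun_apply (T t) z \<in> Ec"
proof -
  interpret bl: bounded_bilinear bl by (rule bounded_bilinear_bl)
  assume z: "z \<in> Ec"
  have "bl (blinfun_apply (T t) z) v = 0" if v: "\<mu> \<noteq> 0" "v \<in> dG" "G v = \<mu> *\<^sub>R v" for \<mu> v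
    unfolding bl_move T_eigenvector[OF v(2,3)] bl.scaleR_right Ec_D[OF z v] by simp
  then show ?thesis by (rule Ec_I)
qed

lemma reflect_Ec: "z \<in> Ec \<Longrightarrow> reflect z \<in> Ec"
proof -
  assume z: "z \<in> Ec"
  have "bl (reflect z) v = 0" if v: "\<mu> \<noteq> 0" "v \<in> dG" "G v = \<mu> *\<^sub>R v" for \<mu> v
  proof -
    have "G (reflect v) = (- \<mu>) *\<^sub>R reflect v"
      using reflect_dG(2)[OF v(2)] by (simp add: v(3) reflect_def)
    moreover have "- \<mu> \<noteq> 0" using v(1) by simp
    ultimately have "bl z (reflect v) = 0" using Ec_D[OF z _ reflect_dG(1)[OF v(2)]] by blast
    then show ?thesis by (simp add: blinfun.minus_left blinfun.minus_right)
  qed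
  then show ?thesis by (rule Ec_I)
qed

lemma G_kernel_Ec: "z \<in> dG \<Longrightarrow> G z = 0 \<Longrightarrow> z \<in> Ec"
proof -
  interpret bl: bounded_bilinear bl by (rule bounded_bilinear_bl)
  assume z: "z \<in> dG" "G z = 0"
  have "bl z v = 0" if v: "\<mu> \<noteq> 0" "v \<in> dG" "G v = \<mu> *\<^sub>R v" for \<mu> v
  proof -
    have "\<mu> * bl z v = bl z (G v)" by (simp only: v(3) bl.scaleR_right real_scaleR_def)
    also have "\<dots> = 0" using bl_skew[OF z(1) v(2)] by (simp add: z(2) blinfun.zero_left)
    finally show ?thesis using v(1) by simp
  qed
  then show ?thesis by (rule Ec_I)
qed

lemma G_Ec: "z \<in> dG \<Longrightarrow> z \<in> Ec \<Longrightarrow> G z \<in> Ec"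
proof -
  interpret bl: bounded_bilinear bl by (rule bounded_bilinear_bl)
  assume z: "z \<in> dG" "z \<in> Ec"
  have "bl (G z) v = 0" if v: "\<mu> \<noteq> 0" "v \<in> dG" "G v = \<mu> *\<^sub>R v" for \<mu> v
  proof -
    have "bl (G z) v = - (\<mu> * bl z v)"
      unfolding bl_skew[OF z(1) v(2)] v(3) bl.scaleR_right real_scaleR_def ..
    also have "bl z v = 0" by (rule Ec_D[OF z(2) v])
    finally show ?thesis by simp
  qed
  then show ?thesis by (rule Ec_I)
qed

lemma primitive_Ec:
  assumes z: "z \<in> Ec" and y: "y 0 = 0" "\<And>t. (y has_vector_derivative blinfun_apply (T t) z) (at t)"
  shows "y t \<in> Ec"
proof -
  interpret bl: bounded_bilinear bl by (rule bounded_bilinear_bl)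
  have "bl (y t) v = 0" if v: "\<mu> \<noteq> 0" "v \<in> dG" "G v = \<mu> *\<^sub>R v" for \<mu> v
  proof -
    have "((\<lambda>t. bl (y t) v) has_vector_derivative bl (blinfun_apply (T t) z) v) (at t)" for t
      by (rule bounded_linear.has_vector_derivative[OF bl.bounded_linear_left y(2)])
    moreover have "bl (blinfun_apply (T t) z) v = 0" for t
      by (rule Ec_D[OF T_Ec[OF z] v])
    ultimately have "((\<lambda>t. bl (y t) v) has_vector_derivative 0) (at t)" for t by (simp only:)
    from constant_if_vector_derivative_zero[OF this, of t 0]
    show ?thesis by (simp add: y(1) blinfun.zero_left)
  qed
  then show ?thesis by (rule Ec_I)
qed

section \<open>The two components of the center space\<close>

definition "Xc = {x. (x, 0) \<in> Ec}"
definition "Yc = {y. (0, y) \<in> Ec}"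

lemma Ec_split: "z \<in> Ec \<longleftrightarrow> fst z \<in> Xc \<and> snd z \<in> Yc"
proof
  assume z: "z \<in> Ec"
  \<comment> \<open>The even and odd parts of z under the reflection are its X and Y
    components.\<close>
  have "(1/2) *\<^sub>R (z + reflect z) \<in> Ec" "(1/2) *\<^sub>R (z - reflect z) \<in> Ec"
    using z reflect_Ec[OF z] subspace_Ec by (auto intro: subspace_scale subspace_add subspace_diff)
  moreover have "(1/2) *\<^sub>R (z + reflect z) = (fst z, 0)" "(1/2) *\<^sub>R (z - reflect z) = (0, snd z)"
    by (auto simp: prod_eq_iff scaleR_2[symmetric])
  ultimately show "fst z \<in> Xc \<and> snd z \<in> Yc" by (simp add: Xc_def Yc_def)
next
  assume "fst z \<in> Xc \<and> snd z \<in> Yc"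
  then have "(fst z, 0) + (0, snd z) \<in> Ec" by (intro subspace_add[OF subspace_Ec]) (auto simp: Xc_def Yc_def)
  then show "z \<in> Ec" by simp
qed

lemma subspace_Xc: "subspace Xc" and subspace_Yc: "subspace Yc"
proof -
  have "Xc = (\<lambda>x. (x, 0)) -` Ec" "Yc = (\<lambda>y. (0, y)) -` Ec" by (auto simp: Xc_def Yc_def)
  moreover have "linear (\<lambda>x. (x, 0 :: 'y))" "linear (\<lambda>y. (0 :: 'x, y))" by (auto intro!: linearI)
  ultimately show "subspace Xc" "subspace Yc" by (auto intro: linear_subspace_vimage subspace_Ec)
qed

lemma closed_Yc: "closed Yc"
proof -
  have "Yc = (\<lambda>y. (0, y)) -` Ec" by (auto simp: Yc_def)
  moreover have "closed ((\<lambda>y. (0, y)) -` Ec)" by (intro closed_vimage closed_Ec continuous_intros)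
  ultimately show ?thesis by simp
qed

lemma ker_A_Yc: "blinfun_apply A y = 0 \<Longrightarrow> y \<in> Yc"
  using G_kernel_Ec[OF kernel_L, of "(0, y)"] by (simp add: Yc_def blinfun.zero_right)

lemma BA_Xc: "y \<in> Yc \<Longrightarrow> blinfun_apply A y \<in> D \<Longrightarrow> B (blinfun_apply A y) \<in> Xc"
  using G_Ec[of "(0, y)"] Bd_0 by (simp add: Yc_def Xc_def dG_iff G_eq blinfun.zero_right)

end

section \<open>Nonnegativity of \<open>L\<close> on the range of \<open>BA\<close>\<close>

lemma Cauchy_if_square_dist_le:
  fixes w :: "nat \<Rightarrow> 'a::real_normed_vector"
  assumes le: "\<And>i j. (norm (w i - w j))\<^sup>2 \<le> \<rho> i + \<rho> j" and \<rho>: "\<rho> \<longlonglongrightarrow> 0"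
  shows "Cauchy w"
proof (rule metric_CauchyI)
  fix e :: real assume e: "0 < e"
  have "\<forall>\<^sub>F n in sequentially. \<rho> n < e\<^sup>2 / 2" using order_tendstoD(2)[OF \<rho>, of "e\<^sup>2 / 2"] e by simp
  then obtain N where N: "\<And>n. n \<ge> N \<Longrightarrow> \<rho> n < e\<^sup>2 / 2" by (auto simp: eventually_sequentially)
  have "dist (w i) (w j) < e" if "i \<ge> N" "j \<ge> N" for i j
  proof -
    have "(norm (w i - w j))\<^sup>2 < e\<^sup>2" using le[of i j] N[OF that(1)] N[OF that(2)] by linarith
    then show ?thesis using e by (simp add: dist_norm power2_less_imp_less)
  qed
  then show "\<exists>M. \<forall>m\<ge>M. \<forall>n\<ge>M. dist (w m) (w n) < e" by blast
qed

lemma bounded_bilinear_add_scaled: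
  fixes \<beta> \<gamma> :: "'a::real_normed_vector \<Rightarrow> 'b::real_normed_vector \<Rightarrow> real"
  assumes "bounded_bilinear \<beta>" and "bounded_bilinear \<gamma>"
  shows "bounded_bilinear (\<lambda>x y. \<beta> x y + c * \<gamma> x y)"
proof -
  interpret b: bounded_bilinear \<beta> by fact
  interpret g: bounded_bilinear \<gamma> by fact
  obtain K where K: "\<And>x y. norm (\<beta> x y) \<le> norm x * norm y * K" using b.bounded by blast
  obtain M where M: "\<And>x y. norm (\<gamma> x y) \<le> norm x * norm y * M" using g.bounded by blast
  have "norm (\<beta> x y + c * \<gamma> x y) \<le> norm x * norm y * (K + \<bar>c\<bar> * M)" for x y
  proof -
    have "norm (\<beta> x y + c * \<gamma> x y) \<le> norm (\<beta> x y) + \<bar>c\<bar> * norm (\<gamma> x y)"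
      by (rule order_trans[OF norm_triangle_ineq]) (simp add: abs_mult)
    also have "\<dots> \<le> norm x * norm y * K + \<bar>c\<bar> * (norm x * norm y * M)"
      by (intro add_mono mult_left_mono K M) auto
    finally show ?thesis by (simp add: algebra_simps)
  qed
  then have "\<exists>K. \<forall>x y. norm (\<beta> x y + c * \<gamma> x y) \<le> norm x * norm y * K" by blast
  then show ?thesis
    by unfold_locales (simp_all add: b.add_left b.add_right b.scaleR_left b.scaleR_right
        g.add_left g.add_right g.scaleR_left g.scaleR_right algebra_simps)
qed

section \<open>The cosine family\<close>

context separable_hamiltonian
begin

text \<open>The reflection symmetry makes \<open>Cos\<close> an even and \<open>Sin\<close> an odd function of time; \<open>Cos\<close> is
  the cosine family of the second order equation for the \<open>Y\<close>-component.\<close>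

definition Cos :: "real \<Rightarrow> 'y \<Rightarrow> 'y" where "Cos t y = snd (blinfun_apply (T t) (0, y))"
definition Sin :: "real \<Rightarrow> 'y \<Rightarrow> 'x" where "Sin t y = fst (blinfun_apply (T t) (0, y))"

lemma T_Cos_Sin: "blinfun_apply (T t) (0, y) = (Sin t y, Cos t y)"
  by (simp add: Cos_def Sin_def)

lemma T_neg_Cos_Sin: "blinfun_apply (T (- t)) (0, y) = (- Sin t y, Cos t y)"
proof -
  have "(0, y) = - reflect (0 :: 'x, y)" by (simp add: reflect_def)
  then have "blinfun_apply (T (- t)) (0, y) = - blinfun_apply (T (- t)) (reflect (0, y))"
    by (metis blinfun.minus_right)
  also have "\<dots> = - reflect (Sin t y, Cos t y)" by (simp add: T_reflect T_Cos_Sin)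
  finally show ?thesis by (simp add: reflect_def)
qed

lemma Cos_minus: "Cos (- t) y = Cos t y" and Sin_minus: "Sin (- t) y = - Sin t y"
  using T_neg_Cos_Sin[of t y] by (auto simp: T_Cos_Sin)

lemma bounded_linear_Cos: "bounded_linear (Cos t)" and bounded_linear_Sin: "bounded_linear (Sin t)"
proof -
  have "bounded_linear (\<lambda>y. blinfun_apply (T t) (0, y))"
    by (intro bounded_linear_compose[OF blinfun.bounded_linear_right] bounded_linear_Pair bounded_linear_zero bounded_linear_ident)
  from bounded_linear_compose[OF bounded_linear_snd this] bounded_linear_compose[OF bounded_linear_fst this]
  show "bounded_linear (Cos t)" "bounded_linear (Sin t)" by (simp_all add: Cos_def[abs_def] Sin_def[abs_def])
qed

lemma Cos_0 [simp]: "Cos 0 y = y"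
  by (simp add: Cos_def)

text \<open>d'Alembert's equation: T (s + t) and T (s - t) are T s after T t and T (- t), and adding
  these cancels the X component.\<close>

lemma Cos_add: "Cos (s + t) y + Cos (s - t) y = 2 *\<^sub>R Cos s (Cos t y)"
proof -
  have "blinfun_apply (T (s + t)) (0, y) + blinfun_apply (T (s - t)) (0, y)
     = blinfun_apply (T s) ((Sin t y, Cos t y) + (- Sin t y, Cos t y))"
    using T_add[of s t "(0, y)"] T_add[of s "- t" "(0, y)"]
    by (simp only: T_Cos_Sin[of t] T_neg_Cos_Sin[of t] blinfun.add_right) simp
  also have "(Sin t y, Cos t y) + (- Sin t y, Cos t y) = 2 *\<^sub>R (0, Cos t y)" by (simp add: scaleR_2)
  finally show ?thesis
    by (simp only: blinfun.scaleR_right T_Cos_Sin) (simp add: T_Cos_Sin)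
qed

lemma Cos_double: "Cos (2 * t) y = 2 *\<^sub>R Cos t (Cos t y) - y"
  using Cos_add[of t t y] by (simp add: algebra_simps)

lemma Cos_selfadjoint: "af (Cos t y) w = af y (Cos t w)"
  using bl_move[of t "(0, y)" "(0, w)"] by (simp add: T_Cos_Sin T_neg_Cos_Sin Cos_minus blinfun.zero_left blinfun.zero_right)

text \<open>Energy conservation and the duplication formula. A negative direction of L among the
  values of \<open>Sin t\<close> is the same as a direction in which \<open>Cos (2 * t)\<close>
  exceeds 1.\<close>

lemma lf_Sin: "lf (Sin t y) (Sin t w) = (af y w - af (Cos (2 * t) y) w) / 2"
proof -
  have "lf (Sin t y) (Sin t w) = af y w - af (Cos t y) (Cos t w)"
    using bl_preserved[of t "(0, y)" "(0, w)"] by (simp add: T_Cos_Sin blinfun.zero_left)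
  also have "af (Cos t y) (Cos t w) = af (Cos t (Cos t y)) w" by (rule Cos_selfadjoint[symmetric])
  finally show ?thesis
    by (simp add: Cos_double blinfun.diff_right blinfun.diff_left blinfun.scaleR_right blinfun.scaleR_left)
qed

lemma Cos_ker: "Cos t k = k" and Sin_ker: "Sin t k = 0" if "blinfun_apply A k = 0"
  using T_fixes_kernel[OF kernel_L, of "(0, k)" t] that by (simp_all add: T_Cos_Sin blinfun.zero_right)

text \<open>\<open>Cos t\<close> fixes \<open>ker A\<close> pointwise, so it descends to the
  quotient by \<open>ker A\<close>; eigenvalue equations are therefore stated after applying
  A.\<close>

lemma A_Cos_cong: "blinfun_apply A (Cos t y) = blinfun_apply A (Cos t w)" if "blinfun_apply A y = blinfun_apply A w"
proof -
  interpret C: bounded_linear "Cos t" by (rule bounded_linear_Cos)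
  have "Cos t (y - w) = y - w" by (rule Cos_ker) (simp add: that blinfun.diff_right)
  then have "blinfun_apply A (Cos t y - Cos t w) = 0" by (simp add: C.diff blinfun.diff_right that)
  then show ?thesis by (simp add: blinfun.diff_right)
qed

lemma Cos_Yc: "Cos t y \<in> Yc" if "y \<in> Yc"
proof -
  note that
  then have "(Sin t y, Cos t y) \<in> Ec" using T_Ec[of "(0, y)" t] by (simp add: Yc_def T_Cos_Sin)
  then show ?thesis unfolding Ec_split by simp
qed

text \<open>Minimises \<open>m\<close> relative to the form of A. The infimum - \<mu> is negative,
  and it is attained because the negative part of \<open>m\<close> is controlled by finitely many
  functionals, along which a minimising sequence can be made convergent. By \<open>lf_Sin\<close>
  the minimum - \<mu> is the eigenvalue 1 + 2 * \<mu> of \<open>Cos (2 * t)\<close>.\<close>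

lemma Cos_minimal_eigenvector:
  assumes v0: "v0 \<in> Yc" and neg: "lf (Sin t v0) (Sin t v0) < 0"
  obtains v \<mu> where "v \<in> Yc" "blinfun_apply A v \<noteq> 0" "0 < \<mu>"
    "blinfun_apply A (Cos (2 * t) v) = (1 + 2 * \<mu>) *\<^sub>R blinfun_apply A v"
proof -
  interpret U: bounded_linear "Sin t" by (rule bounded_linear_Sin)
  \<comment> \<open>A concrete model of the quotient of \<open>Yc\<close> by \<open>ker A\<close>:
    inside \<open>Yp\<close> the form of A is coercive.\<close>
  define H where "H = Yc \<inter> Yp"
  have subH: "subspace H" unfolding H_def by (rule subspace_inter[OF subspace_Yc subspace_Yp])
  have clH: "closed H" unfolding H_def by (intro closed_Int closed_Yc closed_Yp)
  have PyH: "Py y \<in> H" if "y \<in> Yc" for y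
  proof -
    have "y - Py y \<in> Yc" by (rule ker_A_Yc) (simp add: blinfun.diff_right Py)
    from subspace_diff[OF subspace_Yc that this] show ?thesis using Py by (simp add: H_def)
  qed
  define m where "m y w = lf (Sin t y) (Sin t w)" for y w
  have bbm: "bounded_bilinear m" unfolding m_def
    by (rule bounded_bilinear.comp[OF bounded_bilinear_lf bounded_linear_Sin bounded_linear_Sin])
  interpret m: bounded_bilinear m by fact
  interpret a: bounded_bilinear af by (rule bounded_bilinear_af)
  have msym: "m y w = m w y" for y w unfolding m_def by (rule lf_commute)
  obtain \<delta> where \<delta>: "0 < \<delta>" "\<And>w. w \<in> Yp \<Longrightarrow> \<delta> * (norm w)\<^sup>2 \<le> af w w" by (rule af_Yp) blast
  have \<delta>H: "\<delta> * (norm w)\<^sup>2 \<le> af w w" if "w \<in> H" for w using \<delta>(2) that by (simp add: H_def)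
  have apos: "0 < af w w" if "w \<in> H" "w \<noteq> 0" for w
    by (rule less_le_trans[OF _ \<delta>H[OF that(1)]]) (use \<delta>(1) that(2) in simp)
  define w0 where "w0 = Py v0"
  have w0H: "w0 \<in> H" unfolding w0_def by (rule PyH[OF v0])
  have "Sin t (v0 - w0) = 0" by (rule Sin_ker) (simp add: w0_def blinfun.diff_right Py)
  then have "Sin t w0 = Sin t v0" by (simp add: U.diff)
  then have m0: "m w0 w0 < 0" using neg by (simp add: m_def)
  then have w00: "w0 \<noteq> 0" by (auto simp: m.zero_left)
  define Q where "Q = (\<lambda>v. m v v / af v v) ` (H - {0})"
  obtain K where K: "0 \<le> K" "\<And>a b. norm (m a b) \<le> norm a * norm b * K" using m.nonneg_bounded by blast
  have Qlow: "- (K / \<delta>) \<le> m v v / af v v" if "v \<in> H - {0}" for v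
  proof -
    have p: "0 < af v v" using apos that by blast
    have "- m v v \<le> (norm v)\<^sup>2 * K" using K(2)[of v v] by (simp add: power2_eq_square abs_le_iff)
    also have "\<dots> \<le> (af v v / \<delta>) * K"
      using \<delta>H[of v] that \<delta>(1) K(1) by (intro mult_right_mono) (auto simp: field_simps)
    finally have "- m v v \<le> (K / \<delta>) * af v v" by (simp add: mult.commute)
    then show ?thesis using p by (simp add: field_simps)
  qed
  have bdd: "bdd_below Q" unfolding Q_def using Qlow by (rule bdd_belowI2)
  define \<mu> where "\<mu> = - Inf Q"
  have "Inf Q \<le> m w0 w0 / af w0 w0" using bdd w0H w00 unfolding Q_def by (intro cINF_lower) auto
  also have "\<dots> < 0" using m0 apos[OF w0H w00] by (simp add: divide_neg_pos)
  finally have \<mu>: "0 < \<mu>" by (simp add: \<mu>_def)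
  \<comment> \<open>Shifted by its infimum the form is semidefinite on \<open>H\<close> and tends to
    0 along a minimising sequence. A limit is then null, and Cauchy-Schwarz makes it orthogonal to
    all of \<open>H\<close>, which is the eigenvalue equation.\<close>
  define \<beta> where "\<beta> y w = m y w + \<mu> * af y w" for y w
  have bb\<beta>: "bounded_bilinear \<beta>" unfolding \<beta>_def
    by (rule bounded_bilinear_add_scaled[OF bbm bounded_bilinear_af])
  interpret \<beta>: bounded_bilinear \<beta> by fact
  have \<beta>sym: "\<beta> y w = \<beta> w y" for y w by (simp add: \<beta>_def msym[of y w] af_commute[of y w])
  have \<beta>pos: "0 \<le> \<beta> w w" if w: "w \<in> H" for w
  proof (cases "w = 0")
    case False
    then have "m w w / af w w \<in> Q" using w by (auto simp: Q_def)
    then have "- \<mu> \<le> m w w / af w w" unfolding \<mu>_def using cInf_lower[OF _ bdd] by simp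
    then show ?thesis using apos[OF w False] by (simp add: \<beta>_def field_simps)
  qed (simp add: \<beta>.zero_left)
  have "\<exists>v\<in>H. af v v = 1 \<and> \<beta> v v \<le> 1 / real (Suc n)" for n
  proof -
    have "\<exists>q\<in>Q. q < Inf Q + 1 / real (Suc n)"
      by (rule cInf_lessD) (use w0H w00 Q_def in auto)
    then obtain v where v: "v \<in> H" "v \<noteq> 0" "m v v / af v v < - \<mu> + 1 / real (Suc n)"
      by (auto simp: Q_def \<mu>_def)
    have p: "0 < af v v" by (rule apos[OF v(1,2)])
    define w where "w = (1 / sqrt (af v v)) *\<^sub>R v"
    have sc: "\<gamma> w w = \<gamma> v v / af v v" if "bounded_bilinear \<gamma>" for \<gamma> :: "'y \<Rightarrow> 'y \<Rightarrow> real"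
    proof -
      interpret g: bounded_bilinear \<gamma> by fact
      have "\<gamma> w w = (1 / sqrt (af v v)) * (1 / sqrt (af v v)) * \<gamma> v v"
        by (simp only: w_def g.scaleR_left g.scaleR_right real_scaleR_def mult.assoc)
      also have "(1 / sqrt (af v v)) * (1 / sqrt (af v v)) = 1 / af v v" using p by simp
      finally show ?thesis by simp
    qed
    have "\<beta> w w = m v v / af v v + \<mu>" unfolding sc[OF bb\<beta>] using p by (simp add: \<beta>_def field_simps)
    then have "\<beta> w w \<le> 1 / real (Suc n)" using v(3) by simp
    moreover have "af w w = 1" using p sc[OF bounded_bilinear_af] by simp
    moreover have "w \<in> H" unfolding w_def by (rule subspace_scale[OF subH v(1)])
    ultimately show ?thesis by blast
  qed
  then have "\<forall>n. \<exists>v. v \<in> H \<and> af v v = 1 \<and> \<beta> v v \<le> 1 / real (Suc n)" by blast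
  then obtain v where v: "\<And>n. v n \<in> H" "\<And>n. af (v n) (v n) = 1" "\<And>n. \<beta> (v n) (v n) \<le> 1 / real (Suc n)"
    by (auto dest!: choice)
  have \<beta>v0: "(\<lambda>n. \<beta> (v n) (v n)) \<longlonglongrightarrow> 0"
    by (rule tendsto_sandwich[OF _ _ tendsto_const LIMSEQ_Suc[OF lim_const_over_n[of 1]]])
      (use \<beta>pos v in auto)
  obtain I :: "'x set" and g and c :: real where g: "finite I" "0 < c" "\<And>e. e \<in> I \<Longrightarrow> g e \<in> Dd"
    "\<And>x. c * (norm (Px x))\<^sup>2 \<le> lf x x + (\<Sum>e\<in>I. (blinfun_apply (g e) x)\<^sup>2)"
    by (rule coercive_functionals) blast
  define s where "s e n = blinfun_apply (g e) (Sin t (v n))" for e n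
  have "bounded (range (s e))" for e
  proof -
    have "bounded_linear (\<lambda>y. blinfun_apply (g e) (Sin t y))"
      by (rule bounded_linear_compose[OF blinfun.bounded_linear_right bounded_linear_Sin])
    then obtain M where M: "0 \<le> M" "\<And>y. norm (blinfun_apply (g e) (Sin t y)) \<le> norm y * M"
      using bounded_linear.nonneg_bounded by blast
    have "norm (s e n) \<le> sqrt (1 / \<delta>) * M" for n
    proof -
      have "(norm (v n))\<^sup>2 \<le> 1 / \<delta>" using \<delta>H[OF v(1), of n] v(2)[of n] \<delta>(1) by (simp add: field_simps)
      then have "norm (v n) \<le> sqrt (1 / \<delta>)" by (rule real_le_rsqrt)
      then have "norm (v n) * M \<le> sqrt (1 / \<delta>) * M" using M(1) by (rule mult_right_mono)
      then show ?thesis using M(2)[of "v n"] unfolding s_def by (rule order_trans[rotated])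
    qed
    then show ?thesis unfolding bounded_iff by blast
  qed
  then obtain r where r: "strict_mono r" "\<forall>e\<in>I. convergent (s e \<circ> r)"
    using common_convergent_subsequence[OF g(1), of s] by blast
  define w where "w = v \<circ> r"
  define l where "l e = lim (s e \<circ> r)" for e
  have l: "(\<lambda>n. s e (r n)) \<longlonglongrightarrow> l e" if "e \<in> I" for e
    using r(2) that convergent_LIMSEQ_iff unfolding l_def by (fastforce simp: o_def)
  have \<beta>w0: "(\<lambda>n. \<beta> (w n) (w n)) \<longlonglongrightarrow> 0"
    using LIMSEQ_subseq_LIMSEQ[OF \<beta>v0 r(1)] by (simp add: w_def o_def)
  \<comment> \<open>For d = w i - w j one has \<mu> * \<delta> * |d|^2 <= \<beta> d d - m d d. The
    first term is small by minimality, and - m d d is at most the sum of the squared values of the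
    convergent functionals.\<close>
  define \<rho> where "\<rho> n = (2 * \<beta> (w n) (w n) + 2 * (\<Sum>e\<in>I. (s e (r n) - l e)\<^sup>2)) / (\<mu> * \<delta>)" for n
  have "Cauchy w"
  proof (rule Cauchy_if_square_dist_le)
    have "\<rho> \<longlonglongrightarrow> (2 * 0 + 2 * (\<Sum>e\<in>I. (l e - l e)\<^sup>2)) / (\<mu> * \<delta>)" unfolding \<rho>_def
      by (intro tendsto_intros \<beta>w0 l) (use \<mu> \<delta>(1) in auto)
    then show "\<rho> \<longlonglongrightarrow> 0" by simp
    fix i j
    have wH: "w n \<in> H" for n by (simp add: w_def v)
    define d where "d = w i - w j"
    have dH: "d \<in> H" unfolding d_def by (rule subspace_diff[OF subH wH wH])
    have g_d: "blinfun_apply (g e) (Sin t d) = s e (r i) - s e (r j)" for e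
      by (simp add: d_def w_def s_def U.diff blinfun.diff_right)
    have "0 \<le> c * (norm (Px (Sin t d)))\<^sup>2" using g(2) by simp
    then have md: "- m d d \<le> (\<Sum>e\<in>I. (s e (r i) - s e (r j))\<^sup>2)" using g(4)[of "Sin t d"] by (simp add: m_def g_d)
    have "(\<Sum>e\<in>I. (s e (r i) - s e (r j))\<^sup>2) \<le> (\<Sum>e\<in>I. 2 * (s e (r i) - l e)\<^sup>2 + 2 * (s e (r j) - l e)\<^sup>2)"
    proof (rule sum_mono)
      fix e
      show "(s e (r i) - s e (r j))\<^sup>2 \<le> 2 * (s e (r i) - l e)\<^sup>2 + 2 * (s e (r j) - l e)\<^sup>2"
        using zero_le_power2[of "s e (r i) - l e + (s e (r j) - l e)"] by (simp add: power2_eq_square algebra_simps)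
    qed
    also have "\<dots> = 2 * (\<Sum>e\<in>I. (s e (r i) - l e)\<^sup>2) + 2 * (\<Sum>e\<in>I. (s e (r j) - l e)\<^sup>2)"
      by (simp add: sum.distrib sum_distrib_left)
    finally have sd: "(\<Sum>e\<in>I. (s e (r i) - s e (r j))\<^sup>2) \<le> 2 * (\<Sum>e\<in>I. (s e (r i) - l e)\<^sup>2) + 2 * (\<Sum>e\<in>I. (s e (r j) - l e)\<^sup>2)" .
    have \<beta>d: "\<beta> d d \<le> 2 * \<beta> (w i) (w i) + 2 * \<beta> (w j) (w j)"
      using \<beta>pos[OF subspace_add[OF subH wH[of i] wH[of j]]]
      by (simp add: d_def \<beta>.add_left \<beta>.add_right \<beta>.diff_left \<beta>.diff_right)
    have "\<mu> * (\<delta> * (norm d)\<^sup>2) \<le> \<mu> * af d d" using \<delta>H[OF dH] \<mu> by (intro mult_left_mono) auto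
    also have "\<dots> = \<beta> d d - m d d" by (simp add: \<beta>_def)
    also have "\<dots> \<le> (\<rho> i + \<rho> j) * (\<mu> * \<delta>)"
    proof -
      have "\<rho> n * (\<mu> * \<delta>) = 2 * \<beta> (w n) (w n) + 2 * (\<Sum>e\<in>I. (s e (r n) - l e)\<^sup>2)" for n
        using \<mu> \<delta>(1) by (simp add: \<rho>_def)
      then show ?thesis using md sd \<beta>d by (simp only: distrib_right)
    qed
    finally have "(norm d)\<^sup>2 * (\<mu> * \<delta>) \<le> (\<rho> i + \<rho> j) * (\<mu> * \<delta>)" by (simp only: mult_ac)
    then show "(norm (w i - w j))\<^sup>2 \<le> \<rho> i + \<rho> j" using \<mu> \<delta>(1) by (simp add: d_def)
  qed
  then obtain u where u: "w \<longlonglongrightarrow> u" using Cauchy_convergent convergent_def by blast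
  have uH: "u \<in> H" by (rule closed_sequentially[OF clH _ u]) (simp add: w_def v)
  have "(\<lambda>n. af (w n) (w n)) \<longlonglongrightarrow> af u u" by (intro a.tendsto u)
  moreover have "(\<lambda>n. af (w n) (w n)) = (\<lambda>n. 1)" by (simp add: w_def v)
  ultimately have au: "af u u = 1" by (simp add: LIMSEQ_const_iff)
  have "(\<lambda>n. \<beta> (w n) (w n)) \<longlonglongrightarrow> \<beta> u u" by (intro \<beta>.tendsto u)
  then have \<beta>u: "\<beta> u u = 0" using \<beta>w0 LIMSEQ_unique by blast
  have orth: "\<beta> u h = 0" if h: "h \<in> H" for h
    using form_Cauchy_Schwarz[OF bb\<beta> \<beta>sym subH \<beta>pos uH h] \<beta>u by simp
  have uYc: "u \<in> Yc" using uH by (simp add: H_def)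
  \<comment> \<open>By \<open>lf_Sin\<close>, \<beta> u h = - af e h / 2. Testing with Py e, which
    lies in \<open>H\<close>, gives af e e = 0.\<close>
  define e where "e = Cos (2 * t) u - (1 + 2 * \<mu>) *\<^sub>R u"
  have eYc: "e \<in> Yc" unfolding e_def
    by (intro subspace_diff[OF subspace_Yc] subspace_scale[OF subspace_Yc] Cos_Yc uYc)
  have "\<beta> u h = - af e h / 2" for h
    by (simp add: \<beta>_def m_def lf_Sin e_def a.diff_left a.add_left a.scaleR_left field_simps)
  then have "af e (Py e) = 0" using orth[OF PyH[OF eYc]] by simp
  then have "af e e = 0" using af_commute[of e "Py e"] by (simp add: Py(2))
  then have "blinfun_apply A (Cos (2 * t) u) = (1 + 2 * \<mu>) *\<^sub>R blinfun_apply A u"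
    unfolding af_zero_iff by (simp add: e_def blinfun.diff_right blinfun.scaleR_right)
  moreover have "blinfun_apply A u \<noteq> 0" using au by (auto simp: blinfun.zero_left)
  ultimately show ?thesis using that uYc \<mu> by blast
qed

text \<open>Modulo \<open>ker A\<close> the product of \<open>Cos s\<close> + cosh r and
  \<open>Cos s\<close> - cosh r annihilates v. The first factor is injective there:
  \<open>Cos s\<close> + 1 = 2 (Cos (s / 2))^2 is nonnegative and cosh r > 1. So the eigenvalue at
  half the time is + cosh r and not - cosh r.\<close>

lemma Cos_eigenvector_halve:
  assumes v: "blinfun_apply A (Cos (2 * s) v) = cosh (2 * r) *\<^sub>R blinfun_apply A v" and r: "r \<noteq> 0"
  shows "blinfun_apply A (Cos s v) = cosh r *\<^sub>R blinfun_apply A v"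
proof -
  interpret C: bounded_linear "Cos s" by (rule bounded_linear_Cos)
  interpret a: bounded_bilinear af by (rule bounded_bilinear_af)
  define w where "w = Cos s v - cosh r *\<^sub>R v"
  have "Cos s w + cosh r *\<^sub>R w = Cos s (Cos s v) - (cosh r)\<^sup>2 *\<^sub>R v"
    by (simp add: w_def C.diff C.scaleR scaleR_diff_right power2_eq_square)
  moreover have "blinfun_apply A (2 *\<^sub>R Cos s (Cos s v)) = (2 * (cosh r)\<^sup>2) *\<^sub>R blinfun_apply A v"
  proof -
    have "2 *\<^sub>R Cos s (Cos s v) = Cos (2 * s) v + v" by (simp add: Cos_double)
    then show ?thesis using v by (simp add: blinfun.add_right cosh_double_cosh scaleR_diff_left)
  qed
  then have "blinfun_apply A (Cos s (Cos s v)) = (cosh r)\<^sup>2 *\<^sub>R blinfun_apply A v"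
    by (simp add: blinfun.scaleR_right scaleR_scaleR[symmetric] del: scaleR_scaleR)
  ultimately have "blinfun_apply A (Cos s w + cosh r *\<^sub>R w) = 0"
    by (simp add: blinfun.diff_right blinfun.scaleR_right)
  then have "af (Cos s w + cosh r *\<^sub>R w) w = 0" by (simp only: blinfun.zero_left)
  then have "af (Cos s w) w + cosh r * af w w = 0"
    by (simp only: a.add_left a.scaleR_left real_scaleR_def)
  moreover have "af (Cos s w) w + af w w = 2 * af (Cos (s / 2) w) (Cos (s / 2) w)"
    using Cos_double[of "s / 2" w] Cos_selfadjoint[of "s / 2" "Cos (s / 2) w" w]
    by (simp add: a.diff_left a.scaleR_left)
  ultimately have "(cosh r - 1) * af w w \<le> 0" using af_nonneg[of "Cos (s / 2) w"] by (simp add: algebra_simps)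
  moreover have "cosh r > 1" using r cosh_real_ge_1[of r] cosh_real_one_iff[of r] by linarith
  ultimately have "af w w = 0" using af_nonneg[of w] by (simp add: mult_le_0_iff)
  then show ?thesis unfolding af_zero_iff by (simp add: w_def blinfun.diff_right blinfun.scaleR_right)
qed

text \<open>Chebyshev recursion: d'Alembert's equation for \<open>Cos\<close> matches the addition
  formula for cosh.\<close>

lemma Cos_eigenvector_multiple:
  assumes v: "blinfun_apply A (Cos s v) = cosh r *\<^sub>R blinfun_apply A v"
  shows "blinfun_apply A (Cos (real n * s) v) = cosh (real n * r) *\<^sub>R blinfun_apply A v"
proof (induction n rule: less_induct)
  case (less n)
  consider "n = 0" | "n = 1" | m where "n = Suc (Suc m)" by (metis One_nat_def not0_implies_Suc)
  then show ?case
  proof cases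
    case 3
    define m' where "m' = real (Suc m)"
    have IH: "blinfun_apply A (Cos (m' * s) v) = blinfun_apply A (cosh (m' * r) *\<^sub>R v)"
      "blinfun_apply A (Cos ((m' - 1) * s) v) = cosh ((m' - 1) * r) *\<^sub>R blinfun_apply A v"
      using less.IH[of "Suc m"] less.IH[of m] 3 by (simp_all add: m'_def blinfun.scaleR_right)
    have n: "real n = m' + 1" by (simp add: m'_def 3)
    have "Cos (s + m' * s) v + Cos (s - m' * s) v = 2 *\<^sub>R Cos s (Cos (m' * s) v)" by (rule Cos_add)
    moreover have "Cos (s - m' * s) v = Cos ((m' - 1) * s) v" using Cos_minus[of "(m' - 1) * s" v] by (simp add: algebra_simps)
    ultimately have "Cos (real n * s) v = 2 *\<^sub>R Cos s (Cos (m' * s) v) - Cos ((m' - 1) * s) v"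
      by (simp add: n algebra_simps)
    moreover have "blinfun_apply A (Cos s (Cos (m' * s) v)) = (cosh (m' * r) * cosh r) *\<^sub>R blinfun_apply A v"
      unfolding A_Cos_cong[OF IH(1)] linear_scale[OF bounded_linear.linear[OF bounded_linear_Cos]]
      by (simp add: blinfun.scaleR_right v)
    ultimately have "blinfun_apply A (Cos (real n * s) v)
       = (2 * (cosh (m' * r) * cosh r) - cosh ((m' - 1) * r)) *\<^sub>R blinfun_apply A v"
      by (simp add: blinfun.diff_right blinfun.scaleR_right IH(2) scaleR_diff_left)
    also have "2 * (cosh (m' * r) * cosh r) - cosh ((m' - 1) * r) = cosh (real n * r)"
      using cosh_add[of "m' * r" r] cosh_diff[of "m' * r" r] by (simp add: n algebra_simps)
    finally show ?thesis .
  qed (simp_all add: v)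
qed

text \<open>Halving and multiples reach the dyadic multiples of \<open>s0\<close>; the set of good
  times is closed by strong continuity, and negative times follow since both sides are even.\<close>

lemma Cos_eigenvector_all_times:
  assumes v: "blinfun_apply A (Cos s0 v) = cosh (r * s0) *\<^sub>R blinfun_apply A v" and r: "r \<noteq> 0" and s0: "0 < s0"
  shows "blinfun_apply A (Cos s v) = cosh (r * s) *\<^sub>R blinfun_apply A v"
proof -
  define E where "E = {s. blinfun_apply A (Cos s v) = cosh (r * s) *\<^sub>R blinfun_apply A v}"
  have cl: "closed E" unfolding E_def Cos_def
    by (intro closed_Collect_eq continuous_intros T_continuous)
  have halves: "s0 / 2 ^ n \<in> E" for n
  proof (induction n)
    case 0 show ?case using v by (simp add: E_def)
  next
    case (Suc n)
    define h where "h = s0 / 2 ^ Suc n"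
    have "2 * h \<in> E" using Suc by (simp add: h_def)
    then have "blinfun_apply A (Cos (2 * h) v) = cosh (2 * (r * h)) *\<^sub>R blinfun_apply A v"
      by (simp add: E_def mult.left_commute)
    from Cos_eigenvector_halve[OF this] show ?case using r s0 unfolding h_def[symmetric] E_def by (simp add: h_def)
  qed
  have pos: "s \<in> E" if s: "0 \<le> s" for s
  proof -
    \<comment> \<open>The largest multiple of s0 / 2^n not exceeding s.\<close>
    define a where "a n = real (nat \<lfloor>s * 2 ^ n / s0\<rfloor>) * (s0 / 2 ^ n)" for n
    have "a n \<in> E" for n
      using Cos_eigenvector_multiple[of "s0 / 2 ^ n" v "r * (s0 / 2 ^ n)" "nat \<lfloor>s * 2 ^ n / s0\<rfloor>"] halves[of n]
      by (simp add: E_def a_def mult.left_commute)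
    moreover have "a \<longlonglongrightarrow> s"
    proof (rule LIM_zero_cancel, rule Lim_null_comparison)
      have "norm (a n - s) \<le> s0 * (1/2) ^ n" for n
      proof -
        have "real (nat \<lfloor>s * 2 ^ n / s0\<rfloor>) = of_int \<lfloor>s * 2 ^ n / s0\<rfloor>" using s s0 by (simp add: of_nat_nat)
        then have "\<bar>real (nat \<lfloor>s * 2 ^ n / s0\<rfloor>) - s * 2 ^ n / s0\<bar> \<le> 1" by linarith
        then have "\<bar>real (nat \<lfloor>s * 2 ^ n / s0\<rfloor>) - s * 2 ^ n / s0\<bar> * (s0 / 2 ^ n) \<le> 1 * (s0 / 2 ^ n)"
          using s0 by (intro mult_right_mono) auto
        moreover have "a n - s = (real (nat \<lfloor>s * 2 ^ n / s0\<rfloor>) - s * 2 ^ n / s0) * (s0 / 2 ^ n)"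
          using s0 by (simp add: a_def field_simps)
        ultimately show ?thesis using s0 by (simp add: abs_mult power_divide)
      qed
      then show "\<forall>\<^sub>F n in sequentially. norm (a n - s) \<le> s0 * (1/2) ^ n" by simp
      have "(\<lambda>n. s0 * (1/2) ^ n) \<longlonglongrightarrow> s0 * 0" by (intro tendsto_intros LIMSEQ_realpow_zero) auto
      then show "(\<lambda>n. s0 * (1/2) ^ n) \<longlonglongrightarrow> 0" by simp
    qed
    ultimately show ?thesis using closed_sequentially[OF cl] by blast
  qed
  show ?thesis
  proof (cases "0 \<le> s")
    case True then show ?thesis using pos by (simp add: E_def)
  next
    case False
    then have "- s \<in> E" by (intro pos) simp
    then show ?thesis by (simp add: E_def Cos_minus)
  qed
qed

text \<open>An eigenvector of the cosine family integrates to eigenvectors of \<open>JL\<close> with eigenvalues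
  \<open>\<plusminus>r\<close>; these lie in \<open>Ec\<close> and so would have to be orthogonal to themselves and to each other.\<close>

lemma no_growing_Cos_eigenvector:
  assumes vYc: "v \<in> Yc" and r: "r \<noteq> 0"
    and v: "\<And>s. blinfun_apply A (Cos s v) = cosh (r * s) *\<^sub>R blinfun_apply A v"
  shows "blinfun_apply A v = 0"
proof -
  obtain y where y: "y 0 = 0" "\<And>t. (y has_vector_derivative blinfun_apply (T t) (0, v)) (at t)"
    "\<And>t. y t \<in> dG" "\<And>t. G (y t) = blinfun_apply (T t) (0, v) - (0, v)" by (rule primitive_exists) blast
  have y': "((\<lambda>t. y (- t)) has_vector_derivative (Sin t v, - Cos t v)) (at t)" for t
  proof -
    have "((\<lambda>t. - t) has_vector_derivative -1) (at t)" by (auto intro!: derivative_eq_intros)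
    from vector_diff_chain_at[OF this y(2)] show ?thesis by (simp add: o_def T_neg_Cos_Sin)
  qed
  \<comment> \<open>Twice the integral of (0, Cos s v), as the odd \<open>Sin\<close> parts cancel.
    \<open>Z\<close> below is the opposite combination, twice the integral of (Sin s v, 0).\<close>
  define Yp' where "Yp' h = y h - y (- h)" for h
  have Yp'_der: "(Yp' has_vector_derivative (0, 2 *\<^sub>R Cos t v)) (at t)" for t
    using has_vector_derivative_diff[OF y(2)[of t] y'[of t]] unfolding Yp'_def[abs_def]
    by (simp add: T_Cos_Sin scaleR_2)
  have "((\<lambda>t. fst (Yp' t)) has_vector_derivative 0) (at t)" for t
    using bounded_linear.has_vector_derivative[OF bounded_linear_fst Yp'_der] by simp
  from constant_if_vector_derivative_zero[OF this, of _ 0] have fY: "fst (Yp' h) = 0" for h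
    by (simp add: Yp'_def y(1))
  have "((\<lambda>t. blinfun_apply A (snd (Yp' t)) - (2 * sinh (r * t) / r) *\<^sub>R blinfun_apply A v) has_vector_derivative 0) (at t)" for t
  proof -
    have "((\<lambda>t. blinfun_apply A (snd (Yp' t))) has_vector_derivative blinfun_apply A (2 *\<^sub>R Cos t v)) (at t)"
      using bounded_linear.has_vector_derivative[OF bounded_linear_compose[OF blinfun.bounded_linear_right bounded_linear_snd] Yp'_der]
      by simp
    moreover have "((\<lambda>t. 2 * sinh (r * t) / r) has_vector_derivative 2 * cosh (r * t)) (at t)"
      unfolding has_real_derivative_iff_has_vector_derivative[symmetric]
      using r by (auto intro!: derivative_eq_intros)
    then have "((\<lambda>t. (2 * sinh (r * t) / r) *\<^sub>R blinfun_apply A v) has_vector_derivative (2 * cosh (r * t)) *\<^sub>R blinfun_apply A v) (at t)"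
      by (rule bounded_linear.has_vector_derivative[OF bounded_linear_scaleR_left])
    ultimately show ?thesis using has_vector_derivative_diff by (fastforce simp: blinfun.scaleR_right v)
  qed
  from constant_if_vector_derivative_zero[OF this, of _ 0]
  have sY: "blinfun_apply A (snd (Yp' h)) = (2 * sinh (r * h) / r) *\<^sub>R blinfun_apply A v" for h
    by (simp add: Yp'_def y(1) blinfun.zero_right)
  define c where "c h = 2 * sinh (r * h) / r" for h
  have Yp'D: "Yp' h \<in> dG" for h unfolding Yp'_def by (intro subspace_diff[OF subspace_dG] y)
  have GY: "G (Yp' h) = (2 *\<^sub>R Sin h v, 0)" for h
    unfolding Yp'_def G_diff[OF y(3) y(3)] y(4) T_Cos_Sin by (simp add: scaleR_2 Sin_minus Cos_minus)
  \<comment> \<open>(0, v) need not be in the domain, but the integrated vector \<open>Yp' 1\<close>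
    is, and A maps its Y component to a nonzero multiple of A v.\<close>
  have AvD: "blinfun_apply A v \<in> D"
  proof -
    have "c 1 *\<^sub>R blinfun_apply A v \<in> D" using Yp'D[of 1] by (simp add: dG_iff sY c_def)
    then have "(1 / c 1) *\<^sub>R c 1 *\<^sub>R blinfun_apply A v \<in> D" by (rule subspace_scale[OF subspace_D])
    moreover have "c 1 \<noteq> 0" using r by (simp add: c_def)
    ultimately show ?thesis by simp
  qed
  define x where "x = B (blinfun_apply A v)"
  have Sin_eq: "2 *\<^sub>R Sin h v = c h *\<^sub>R x" for h
    using arg_cong[OF GY[of h], of fst] by (simp add: G_eq sY x_def B_scale[OF AvD] c_def)
  define Z where "Z h = y h + y (- h)" for h
  have Z_der: "(Z has_vector_derivative (c t *\<^sub>R x, 0)) (at t)" for t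
    using has_vector_derivative_add[OF y(2)[of t] y'[of t]] unfolding Z_def[abs_def]
    by (simp add: T_Cos_Sin Sin_eq[symmetric] scaleR_2)
  have "((\<lambda>t. Z t - (2 * (cosh (r * t) - 1) / r\<^sup>2) *\<^sub>R (x, 0)) has_vector_derivative 0) (at t)" for t
  proof -
    have "((\<lambda>t. 2 * (cosh (r * t) - 1) / r\<^sup>2) has_vector_derivative c t) (at t)"
      unfolding has_real_derivative_iff_has_vector_derivative[symmetric] c_def
      using r by (auto intro!: derivative_eq_intros simp: power2_eq_square)
    then have "((\<lambda>t. (2 * (cosh (r * t) - 1) / r\<^sup>2) *\<^sub>R (x, 0 :: 'y)) has_vector_derivative c t *\<^sub>R (x, 0)) (at t)"
      by (rule bounded_linear.has_vector_derivative[OF bounded_linear_scaleR_left])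
    from has_vector_derivative_diff[OF Z_der this] show ?thesis by simp
  qed
  from constant_if_vector_derivative_zero[OF this, of 1 0]
  have "Z 1 - (2 * (cosh r - 1) / r\<^sup>2) *\<^sub>R (x, 0) = 0" by (simp add: Z_def y(1) zero_prod_def)
  then have Z1: "Z 1 = (2 * (cosh r - 1) / r\<^sup>2) *\<^sub>R (x, 0)" by (simp only: right_minus_eq)
  \<comment> \<open>Z 1 is in the domain and equals d (x, 0) with d nonzero; this is how (x, 0)
    enters the domain.\<close>
  define d where "d = 2 * (cosh r - 1) / r\<^sup>2"
  have d: "d \<noteq> 0" using r by (simp add: d_def)
  have ZD: "Z 1 \<in> dG" unfolding Z_def by (intro subspace_add[OF subspace_dG] y)
  have GZ: "G (Z 1) = (0, 2 *\<^sub>R Cos 1 v - 2 *\<^sub>R v)"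
    unfolding Z_def G_add[OF y(3) y(3)] y(4) T_Cos_Sin by (simp add: scaleR_2 Sin_minus Cos_minus)
  have "(1 / d) *\<^sub>R Z 1 = (x, 0)" using d unfolding Z1 d_def[symmetric] by simp
  then have xD: "(x, 0) \<in> dG" and Gx: "G (x, 0) = (1 / d) *\<^sub>R (0, 2 *\<^sub>R Cos 1 v - 2 *\<^sub>R v)"
    using subspace_scale[OF subspace_dG ZD, of "1 / d"] G_scale[OF ZD, of "1 / d"] GZ by metis+
  define q where "q = (1 / d) *\<^sub>R (2 *\<^sub>R Cos 1 v - 2 *\<^sub>R v)"
  have Gx: "G (x, 0) = (0, q)" using Gx by (simp add: q_def)
  have "blinfun_apply A q = ((1 / d) * (2 * cosh r - 2)) *\<^sub>R blinfun_apply A v"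
    using v[of 1] by (simp add: q_def blinfun.scaleR_right blinfun.diff_right scaleR_diff_left[symmetric])
  also have "(1 / d) * (2 * cosh r - 2) = r\<^sup>2"
  proof -
    have "cosh r - 1 \<noteq> 0" using r by simp
    then show ?thesis using r by (simp add: d_def field_simps)
  qed
  finally have Aq: "blinfun_apply A q = r\<^sup>2 *\<^sub>R blinfun_apply A v" .
  have Aqr: "blinfun_apply A ((1 / s) *\<^sub>R q) = s *\<^sub>R blinfun_apply A v" if "s\<^sup>2 = r\<^sup>2" for s
  proof -
    have "s \<noteq> 0" using r that by auto
    then show ?thesis unfolding blinfun.scaleR_right Aq that[symmetric] by (simp add: power2_eq_square)
  qed
  have eig: "(x, (1 / s) *\<^sub>R q) \<in> dG" "G (x, (1 / s) *\<^sub>R q) = s *\<^sub>R (x, (1 / s) *\<^sub>R q)" if s: "s\<^sup>2 = r\<^sup>2" for s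
  proof -
    have s0: "s \<noteq> 0" using s r by auto
    have "s *\<^sub>R blinfun_apply A v \<in> D" using AvD by (rule subspace_scale[OF subspace_D])
    then show "(x, (1 / s) *\<^sub>R q) \<in> dG" using xD unfolding dG_iff fst_conv snd_conv Aqr[OF s] by blast
    have "- Bd (blinfun_apply L x) = q" using Gx by (simp add: G_eq)
    then show "G (x, (1 / s) *\<^sub>R q) = s *\<^sub>R (x, (1 / s) *\<^sub>R q)"
      unfolding G_eq fst_conv snd_conv Aqr[OF s] using s0 by (simp add: B_scale[OF AvD] x_def)
  qed
  have "x \<in> Xc" unfolding x_def by (rule BA_Xc[OF vYc AvD])
  then have xEc: "(x, 0) \<in> Ec" by (simp add: Xc_def)
  then have "(0, q) \<in> Ec" using G_Ec[OF xD] Gx by simp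
  from subspace_add[OF subspace_Ec xEc subspace_scale[OF subspace_Ec this, of "1 / r"]]
  have zEc: "(x, (1 / r) *\<^sub>R q) \<in> Ec" by simp
  \<comment> \<open>The two orthogonality relations read lf x x + af q q / r^2 = 0 and lf x x - af q
    q / r^2 = 0, which forces af q q = 0.\<close>
  have "bl (x, (1 / r) *\<^sub>R q) (x, (1 / r) *\<^sub>R q) = 0" "bl (x, (1 / r) *\<^sub>R q) (x, (1 / - r) *\<^sub>R q) = 0"
    using Ec_D[OF zEc _ eig[of r]] Ec_D[OF zEc _ eig[of "- r"]] r by simp_all
  then have "af q q = 0" using r by (simp add: blinfun.scaleR_right blinfun.scaleR_left blinfun.minus_right)
  then have "blinfun_apply A q = 0" by (simp only: af_zero_iff)
  then show ?thesis using Aq r by simp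
qed

lemma Sin_nonneg:
  assumes "v \<in> Yc"
  shows "0 \<le> lf (Sin t v) (Sin t v)"
proof (rule ccontr)
  assume "\<not> ?thesis"
  then have neg: "lf (Sin t v) (Sin t v) < 0" by simp
  have t: "t \<noteq> 0" using neg by (auto simp: Sin_def blinfun.zero_left)
  obtain w \<mu> where w: "w \<in> Yc" "blinfun_apply A w \<noteq> 0" "0 < \<mu>"
    "blinfun_apply A (Cos (2 * t) w) = (1 + 2 * \<mu>) *\<^sub>R blinfun_apply A w"
    using Cos_minimal_eigenvector[OF assms neg] by blast
  define s0 where "s0 = \<bar>2 * t\<bar>"
  have s0: "0 < s0" using t by (simp add: s0_def)
  have Cs0: "Cos s0 w = Cos (2 * t) w" by (cases "0 \<le> t") (auto simp: s0_def Cos_minus[of "2 * t", simplified])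
  define r where "r = arcosh (1 + 2 * \<mu>) / s0"
  have "0 < arcosh (1 + 2 * \<mu>)" using w(3) by simp
  then have r: "r \<noteq> 0" using s0 by (simp add: r_def)
  have "cosh (r * s0) = 1 + 2 * \<mu>" using s0 w(3) by (simp add: r_def)
  then have "blinfun_apply A (Cos s0 w) = cosh (r * s0) *\<^sub>R blinfun_apply A w" by (simp add: Cs0 w(4))
  from no_growing_Cos_eigenvector[OF w(1) r Cos_eigenvector_all_times[OF this r s0]]
  show False using w(2) by simp
qed

text \<open>B A y is the derivative of \<open>Sin\<close> at time 0, so the sign passes to the limit
  of Sin h y / h.\<close>

lemma BA_nonneg:
  assumes "y \<in> Yc" and "blinfun_apply A y \<in> D"
  shows "0 \<le> lf (B (blinfun_apply A y)) (B (blinfun_apply A y))"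
proof -
  interpret l: bounded_bilinear lf by (rule bounded_bilinear_lf)
  have "(0, y) \<in> dG" using assms Bd_0 by (simp add: dG_iff blinfun.zero_right)
  from tendsto_fst[OF generator_limit[OF this]]
  have lim: "((\<lambda>h. (1 / h) *\<^sub>R Sin h y) \<longlongrightarrow> B (blinfun_apply A y)) (at 0)" by (simp add: T_Cos_Sin G_eq)
  have "0 \<le> lf ((1 / h) *\<^sub>R Sin h y) ((1 / h) *\<^sub>R Sin h y)" for h
    using Sin_nonneg[OF assms(1), of h] by (simp add: l.scaleR_left l.scaleR_right)
  then show ?thesis by (intro tendsto_lowerbound[OF l.tendsto[OF lim lim]]) auto
qed

end

section \<open>The unstable subspace\<close>

context separable_hamiltonian
begin

abbreviation "Eu \<equiv> E_u dG G"

lemma subspace_Eu: "subspace Eu"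
  by (simp add: E_u_def)

lemma Eu_induct [consumes 1, case_names eigen add scale]:
  assumes "z \<in> Eu"
    and eigen: "\<And>z \<mu>. 0 < \<mu> \<Longrightarrow> z \<in> dG \<Longrightarrow> G z = \<mu> *\<^sub>R z \<Longrightarrow> z \<in> Eu \<Longrightarrow> P z"
    and add: "\<And>z w. P z \<Longrightarrow> P w \<Longrightarrow> P (z + w)" and scale: "\<And>c z. P z \<Longrightarrow> P (c *\<^sub>R z)"
  shows "P z"
proof -
  have z: "z \<in> span {z. \<exists>\<mu>>0. eigenvector_for dG G \<mu> z}" using assms(1) by (simp only: E_u_def)
  have "P 0"
    \<comment> \<open>The zero vector satisfies the eigenvalue equation with \<mu> = 1, so the
      induction rule needs no case for it.\<close>
    by (rule eigen[of 1 0]) (use subspace_0[OF subspace_dG] subspace_0[OF subspace_Eu] G_scale[OF subspace_0[OF subspace_dG], of 0] in simp_all)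
  have "{z. P z} \<noteq> {} \<and> subspace {z. P z}" using \<open>P 0\<close> add scale unfolding subspace_def by blast
  moreover have "P w" if w: "w \<in> {z. \<exists>\<mu>>0. eigenvector_for dG G \<mu> z}" for w
  proof -
    have "w \<in> Eu" unfolding E_u_def by (rule span_base[OF w])
    moreover obtain \<mu> where "0 < \<mu>" "eigenvector_for dG G \<mu> w" using w by blast
    ultimately show ?thesis using eigen unfolding eigenvector_for_def by blast
  qed
  ultimately show ?thesis using span_induct[OF z, of P] by blast
qed

lemma Eu_dG: "z \<in> Eu \<Longrightarrow> z \<in> dG \<and> G z \<in> Eu"
proof (induction rule: Eu_induct)
  case (eigen z \<mu>)
  then show ?case using subspace_scale[OF subspace_Eu] by simp
next
  case (add z w)
  then show ?case using subspace_add[OF subspace_Eu] subspace_add[OF subspace_dG] by (simp add: G_add)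
next
  case (scale c z)
  then show ?case using subspace_scale[OF subspace_Eu] subspace_scale[OF subspace_dG] by (simp add: G_scale)
qed

text \<open>For eigenvectors, skewness gives (\<mu> + \<nu>) * bl z w = 0 with \<mu> + \<nu> >
  0.\<close>

lemma Eu_isotropic: assumes z: "z \<in> Eu" and w: "w \<in> Eu" shows "bl z w = 0"
proof -
  interpret bl: bounded_bilinear bl by (rule bounded_bilinear_bl)
  show ?thesis using z
  proof (induction rule: Eu_induct)
    case (eigen z \<mu>)
    note z = this
    show ?case using w
    proof (induction rule: Eu_induct)
      case (eigen w \<nu>)
      have "\<mu> * bl z w = bl (G z) w" by (simp only: z(3) bl.scaleR_left real_scaleR_def)
      also have "\<dots> = - (\<nu> * bl z w)" by (simp only: bl_skew[OF z(2) eigen(2)] eigen(3) bl.scaleR_right real_scaleR_def)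
      finally have "(\<mu> + \<nu>) * bl z w = 0" by (simp only: distrib_right)
      then show ?case using z(1) eigen(1) by auto
    next
      case (add v w)
      then show ?case unfolding bl.add_right by simp
    next
      case (scale c w)
      then show ?case unfolding bl.scaleR_right by simp
    qed
  next
    case (add v w)
    then show ?case unfolding bl.add_left by simp
  next
    case (scale c w)
    then show ?case unfolding bl.scaleR_left by simp
  qed
qed

text \<open>Backward decay along integer times is enough to show that \<open>Eu\<close> contains no
  nonzero stationary vector.\<close>

lemma Eu_decay: "z \<in> Eu \<Longrightarrow> (\<lambda>n. blinfun_apply (T (- real n)) z) \<longlonglongrightarrow> 0"
proof (induction rule: Eu_induct)
  case (eigen z \<mu>)
  have "blinfun_apply (T (- real n)) z = (exp (- \<mu>)) ^ n *\<^sub>R z" for n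
    using T_eigenvector[OF eigen(2,3), of "- real n"] by (simp add: exp_of_nat_mult[symmetric] mult.commute)
  moreover have "(\<lambda>n. (exp (- \<mu>)) ^ n *\<^sub>R z) \<longlonglongrightarrow> 0 *\<^sub>R z"
    by (intro tendsto_intros LIMSEQ_realpow_zero) (use eigen(1) in auto)
  ultimately show ?case by simp
next
  case (add v w)
  from tendsto_add[OF this] show ?case by (simp add: blinfun.add_right)
next
  case (scale c w)
  from tendsto_scaleR[OF tendsto_const this, of c] show ?case by (simp add: blinfun.scaleR_right)
qed

lemma Eu_G_eq_0: "z \<in> Eu \<Longrightarrow> G z = 0 \<Longrightarrow> z = 0"
  using Eu_decay[of z] Eu_dG[of z] T_fixes_kernel[of z] by (simp add: LIMSEQ_const_iff)

text \<open>If A kills the Y component, then G z has X component 0 and isotropy makes A kill its Y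
  component too. Hence G (G z) = 0, and \<open>Eu_G_eq_0\<close> applies twice.\<close>

lemma Eu_A_eq_0:
  assumes z: "z \<in> Eu" and A0: "blinfun_apply A (snd z) = 0"
  shows "z = 0"
proof -
  define w where "w = G z"
  have w: "w \<in> Eu" using Eu_dG[OF z] by (simp add: w_def)
  have fw: "fst w = 0" by (simp add: w_def G_eq A0 B_0)
  then have "af (snd w) (snd w) = 0" using Eu_isotropic[OF w w] by (simp add: blinfun.zero_left)
  then have "blinfun_apply A (snd w) = 0" by (simp only: af_zero_iff)
  then have "G w = 0" by (simp add: G_eq fw B_0 Bd_0 blinfun.zero_right zero_prod_def)
  then have "w = 0" by (rule Eu_G_eq_0[OF w])
  then show ?thesis using Eu_G_eq_0[OF z] by (simp add: w_def)
qed

definition "EuX = fst ` Eu"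
definition "EuY = snd ` Eu"

lemma subspace_EuX: "subspace EuX" and subspace_EuY: "subspace EuY"
  unfolding EuX_def EuY_def
  by (auto intro!: linear_subspace_image subspace_Eu linear_fst linear_snd)

text \<open>Isotropy of z says lf x x = - af y y, and af y y = 0 would force z = 0.\<close>

lemma lf_EuX_neg: "x \<in> EuX \<Longrightarrow> x \<noteq> 0 \<Longrightarrow> lf x x < 0"
proof -
  assume "x \<in> EuX" and x0: "x \<noteq> 0"
  then obtain z where z: "z \<in> Eu" "x = fst z" by (auto simp: EuX_def)
  have "af (snd z) (snd z) \<noteq> 0" using Eu_A_eq_0[OF z(1)] x0 z(2) unfolding af_zero_iff by auto
  then show ?thesis using af_nonneg[of "snd z"] Eu_isotropic[OF z(1) z(1)] z(2) by simp
qed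

lemma af_EuY_pos: "y \<in> EuY \<Longrightarrow> y \<noteq> 0 \<Longrightarrow> 0 < af y y"
proof -
  assume "y \<in> EuY" and y0: "y \<noteq> 0"
  then obtain z where z: "z \<in> Eu" "y = snd z" by (auto simp: EuY_def)
  have "af y y \<noteq> 0" using Eu_A_eq_0[OF z(1)] y0 z(2) unfolding af_zero_iff by auto
  then show ?thesis using af_nonneg[of y] by simp
qed

lemma EuY_BA: "y \<in> EuY \<Longrightarrow> blinfun_apply A y \<in> D" "y \<in> EuY \<Longrightarrow> B (blinfun_apply A y) \<in> EuX"
proof -
  assume "y \<in> EuY"
  then obtain z where z: "z \<in> Eu" "y = snd z" by (auto simp: EuY_def)
  show "blinfun_apply A y \<in> D" using Eu_dG[OF z(1)] z(2) by (simp add: dG_iff)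
  have "B (blinfun_apply A y) = fst (G z)" by (simp add: G_eq z(2))
  then show "B (blinfun_apply A y) \<in> EuX" using Eu_dG[OF z(1)] by (simp add: EuX_def)
qed

text \<open>Supplies the injectivity through which functionals on X separate the points of
  \<open>EuY\<close>.\<close>

lemma EuY_BA_eq_0: "y \<in> EuY \<Longrightarrow> B (blinfun_apply A y) = 0 \<Longrightarrow> y = 0"
proof -
  assume "y \<in> EuY" and B0: "B (blinfun_apply A y) = 0"
  then obtain z where z: "z \<in> Eu" "y = snd z" by (auto simp: EuY_def)
  have w: "G z \<in> Eu" using Eu_dG[OF z(1)] by simp
  have "fst (G z) = 0" using B0 by (simp add: G_eq z(2))
  then have "af (snd (G z)) (snd (G z)) = 0" using Eu_isotropic[OF w w] by (simp add: blinfun.zero_left)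
  then have "G z = 0" using Eu_A_eq_0[OF w] by (simp only: af_zero_iff)
  then show "y = 0" using Eu_G_eq_0[OF z(1)] z(2) by simp
qed

lemma Ec_orthogonal_Eu: "z \<in> Ec \<Longrightarrow> w \<in> Eu \<Longrightarrow> bl z w = 0"
proof -
  interpret bl: bounded_bilinear bl by (rule bounded_bilinear_bl)
  assume z: "z \<in> Ec"
  show "w \<in> Eu \<Longrightarrow> bl z w = 0"
  proof (induction rule: Eu_induct)
    case (eigen w \<mu>)
    then show ?case by (intro Ec_D[OF z, of \<mu>]) auto
  next
    case (add v w)
    then show ?case unfolding bl.add_right by simp
  next
    case (scale c w)
    then show ?case unfolding bl.scaleR_right by simp
  qed
qed

text \<open>Reflection changes the sign of the eigenvalue, so orthogonality on X and Y separately
  needs to be tested on \<open>Eu\<close> only.\<close>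

lemma eigenvector_in_Eu:
  assumes "\<mu> \<noteq> 0" and "v \<in> dG" and "G v = \<mu> *\<^sub>R v"
  shows "v \<in> Eu \<or> reflect v \<in> Eu"
proof (cases "v = 0")
  case True
  then show ?thesis using subspace_0[OF subspace_Eu] by simp
next
  case v0: False
  show ?thesis
  proof (cases "0 < \<mu>")
    case True
    then have "v \<in> Eu" unfolding E_u_def eigenvector_for_def using assms v0 by (intro span_base) blast
    then show ?thesis ..
  next
    case False
    have "reflect v \<noteq> 0" using v0 by (metis norm_eq_zero norm_reflect)
    moreover have "G (reflect v) = (- \<mu>) *\<^sub>R reflect v"
      using reflect_dG(2)[OF assms(2)] by (simp add: assms(3) reflect_def)
    moreover have "0 < - \<mu>" using False assms(1) by simp
    ultimately have "reflect v \<in> Eu" unfolding E_u_def eigenvector_for_def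
      using reflect_dG(1)[OF assms(2)] by (intro span_base) blast
    then show ?thesis ..
  qed
qed

lemma Xc_iff: "x \<in> Xc \<longleftrightarrow> (\<forall>s\<in>EuX. lf x s = 0)"
proof
  assume "x \<in> Xc"
  then have x: "(x, 0) \<in> Ec" by (simp add: Xc_def)
  show "\<forall>s\<in>EuX. lf x s = 0" using Ec_orthogonal_Eu[OF x] by (force simp: EuX_def blinfun.zero_left)
next
  assume x: "\<forall>s\<in>EuX. lf x s = 0"
  have "(x, 0) \<in> Ec"
  proof (rule Ec_I)
    fix \<mu> v assume v: "\<mu> \<noteq> 0" "v \<in> dG" "G v = \<mu> *\<^sub>R v"
    have "fst v \<in> EuX" using eigenvector_in_Eu[OF v] unfolding EuX_def
      by (metis image_eqI reflect_simps(1))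
    then show "bl (x, 0) v = 0" using x by (simp add: blinfun.zero_left)
  qed
  then show "x \<in> Xc" by (simp add: Xc_def)
qed

lemma Yc_iff: "y \<in> Yc \<longleftrightarrow> (\<forall>s\<in>EuY. af y s = 0)"
proof
  assume "y \<in> Yc"
  then have y: "(0, y) \<in> Ec" by (simp add: Yc_def)
  show "\<forall>s\<in>EuY. af y s = 0" using Ec_orthogonal_Eu[OF y] by (force simp: EuY_def blinfun.zero_left)
next
  assume y: "\<forall>s\<in>EuY. af y s = 0"
  have "(0, y) \<in> Ec"
  proof (rule Ec_I)
    fix \<mu> v assume v: "\<mu> \<noteq> 0" "v \<in> dG" "G v = \<mu> *\<^sub>R v"
    have "snd v \<in> EuY \<or> - snd v \<in> EuY" using eigenvector_in_Eu[OF v] unfolding EuY_def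
      by (metis image_eqI reflect_simps(2))
    then have "af y (snd v) = 0" using y by (auto simp: blinfun.minus_right)
    then show "bl (0, y) v = 0" by (simp add: blinfun.zero_left)
  qed
  then show "y \<in> Yc" by (simp add: Yc_def)
qed

text \<open>L is negative definite on \<open>EuX\<close>, and a vector on which all
  \<open>g e\<close> vanish has lf u u >= 0, so the \<open>g e\<close> separate \<open>EuX\<close>
  and \<open>definite_projection_exists\<close> applies to - L. Definiteness makes the component
  unique; hence the bound holds for every such f.\<close>

lemma X_decomposition:
  obtains C where "0 \<le> C" "\<And>x. \<exists>f\<in>EuX. x - f \<in> Xc" "\<And>x f. f \<in> EuX \<Longrightarrow> x - f \<in> Xc \<Longrightarrow> norm f \<le> C * norm x"
proof -
  interpret l: bounded_bilinear lf by (rule bounded_bilinear_lf)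
  obtain I :: "'x set" and g and c :: real where g: "finite I" "0 < c" "\<And>e. e \<in> I \<Longrightarrow> g e \<in> Dd"
    "\<And>x. c * (norm (Px x))\<^sup>2 \<le> lf x x + (\<Sum>e\<in>I. (blinfun_apply (g e) x)\<^sup>2)"
    by (rule coercive_functionals) blast
  have bb: "bounded_bilinear (\<lambda>x y. - lf x y)"
    using bounded_bilinear.comp1[OF bounded_bilinear_lf bounded_linear_minus[OF bounded_linear_ident]]
    by (simp add: l.minus_left)
  have "\<exists>C. \<forall>x. \<exists>f\<in>EuX. (\<forall>s\<in>EuX. - lf (x - f) s = 0) \<and> norm f \<le> C * norm x"
  proof (rule definite_projection_exists[OF bb g(1), where g = "\<lambda>e. blinfun_apply (g e)"])
    show "linear (blinfun_apply (g i))" for i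
      by (rule bounded_linear.linear[OF blinfun.bounded_linear_right])
    show "0 < - lf u u" if "u \<in> EuX" "u \<noteq> 0" for u using lf_EuX_neg[OF that] by simp
    show "u = 0" if u: "u \<in> EuX" and "\<And>i. i \<in> I \<Longrightarrow> blinfun_apply (g i) u = 0" for u
    proof (rule ccontr)
      assume "u \<noteq> 0"
      then have "lf u u < 0" by (rule lf_EuX_neg[OF u])
      moreover have "0 \<le> c * (norm (Px u))\<^sup>2" using g(2) by simp
      ultimately show False using g(4)[of u] that(2) by simp
    qed
  qed (rule subspace_EuX)
  then obtain C where C: "\<And>x. \<exists>f\<in>EuX. (\<forall>s\<in>EuX. - lf (x - f) s = 0) \<and> norm f \<le> C * norm x" by blast
  have ex: "\<exists>f\<in>EuX. x - f \<in> Xc \<and> norm f \<le> C * norm x" for x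
    using C[of x] unfolding Xc_iff by simp
  have "norm f \<le> \<bar>C\<bar> * norm x" if f: "f \<in> EuX" "x - f \<in> Xc" for x f
  proof -
    obtain h where h: "h \<in> EuX" "x - h \<in> Xc" "norm h \<le> C * norm x" using ex by blast
    have d: "f - h \<in> EuX" using f(1) h(1) by (rule subspace_diff[OF subspace_EuX])
    have "(x - h) - (x - f) \<in> Xc" using h(2) f(2) by (rule subspace_diff[OF subspace_Xc])
    then have "lf (f - h) (f - h) = 0" using d by (simp add: Xc_iff)
    then have "f = h" using lf_EuX_neg[OF d] by fastforce
    then have "norm f \<le> C * norm x" using h(3) by simp
    also have "\<dots> \<le> \<bar>C\<bar> * norm x" by (rule mult_right_mono) auto
    finally show ?thesis .
  qed
  moreover have "\<exists>f\<in>EuX. x - f \<in> Xc" for x using ex by blast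
  ultimately show ?thesis using that[of "\<bar>C\<bar>"] by simp
qed

text \<open>A is positive definite on \<open>EuY\<close>; the separating functionals are y -> g e (B
  A y), which are bounded because they equal af y (Bd (g e)).\<close>

lemma Y_decomposition: "\<exists>f\<in>EuY. y - f \<in> Yc"
proof -
  obtain I :: "'x set" and g and c :: real where g: "finite I" "0 < c" "\<And>e. e \<in> I \<Longrightarrow> g e \<in> Dd"
    "\<And>x. c * (norm (Px x))\<^sup>2 \<le> lf x x + (\<Sum>e\<in>I. (blinfun_apply (g e) x)\<^sup>2)"
    by (rule coercive_functionals) blast
  have "\<exists>C. \<forall>y. \<exists>f\<in>EuY. (\<forall>s\<in>EuY. af (y - f) s = 0) \<and> norm f \<le> C * norm y"
  proof (rule definite_projection_exists[OF bounded_bilinear_af g(1), where g = "\<lambda>e y. af y (Bd (g e))"])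
    show "linear (\<lambda>y. af y (Bd (g i)))" for i
      by (rule bounded_linear.linear[OF bounded_bilinear.bounded_linear_left[OF bounded_bilinear_af]])
    show "u = 0" if u: "u \<in> EuY" and "\<And>i. i \<in> I \<Longrightarrow> af u (Bd (g i)) = 0" for u
    proof (rule EuY_BA_eq_0[OF u], rule ccontr)
      assume "B (blinfun_apply A u) \<noteq> 0"
      then have "lf (B (blinfun_apply A u)) (B (blinfun_apply A u)) < 0" by (rule lf_EuX_neg[OF EuY_BA(2)[OF u]])
      moreover have "blinfun_apply (g i) (B (blinfun_apply A u)) = 0" if "i \<in> I" for i
        using dual_op_eq[OF g(3)[OF that] EuY_BA(1)[OF u]] \<open>\<And>i. i \<in> I \<Longrightarrow> af u (Bd (g i)) = 0\<close>[OF that] by simp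
      moreover have "0 \<le> c * (norm (Px (B (blinfun_apply A u))))\<^sup>2" using g(2) by simp
      ultimately show False using g(4)[of "B (blinfun_apply A u)"] by simp
    qed
  qed (rule subspace_EuY, rule af_EuY_pos)
  then show ?thesis unfolding Yc_iff by blast
qed

text \<open>\<open>BA_nonneg\<close> needs the argument of A in \<open>Yc\<close>, which an
  approximation of x by B A y does not respect. Splitting off the unstable part f leaves h with lf h
  h >= 0, and f tends to 0 because x itself has no unstable part.\<close>

lemma lf_nonneg_on_closure_range:
  assumes x: "x \<in> Xc" and cl: "x \<in> closure (range_BA A D B)"
  shows "0 \<le> lf x x"
proof -
  interpret l: bounded_bilinear lf by (rule bounded_bilinear_lf)
  obtain C where C: "0 \<le> C" "\<And>x f. f \<in> EuX \<Longrightarrow> x - f \<in> Xc \<Longrightarrow> norm f \<le> C * norm x"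
    by (rule X_decomposition) blast
  obtain \<xi> where \<xi>: "\<And>n. \<xi> n \<in> range_BA A D B" "\<xi> \<longlonglongrightarrow> x" using cl unfolding closure_sequential by blast
  have "\<exists>f h. f \<in> EuX \<and> h \<in> Xc \<and> 0 \<le> lf h h \<and> \<xi> n = f + h" for n
  proof -
    obtain y where y: "\<xi> n = B (blinfun_apply A y)" "blinfun_apply A y \<in> D"
      using \<xi>(1)[of n] by (auto simp: range_BA_def)
    obtain f where f: "f \<in> EuY" "y - f \<in> Yc" using Y_decomposition by blast
    have D': "blinfun_apply A (y - f) \<in> D"
      using subspace_diff[OF subspace_D y(2) EuY_BA(1)[OF f(1)]] by (simp add: blinfun.diff_right)
    have "\<xi> n = B (blinfun_apply A f) + B (blinfun_apply A (y - f))"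
      using B_add[OF EuY_BA(1)[OF f(1)] D'] by (simp add: y(1) blinfun.diff_right)
    then show ?thesis using EuY_BA(2)[OF f(1)] BA_Xc[OF f(2) D'] BA_nonneg[OF f(2) D'] by blast
  qed
  then obtain f h where fh: "\<And>n. f n \<in> EuX" "\<And>n. h n \<in> Xc" "\<And>n. 0 \<le> lf (h n) (h n)" "\<And>n. \<xi> n = f n + h n" by metis
  have le: "norm (f n) \<le> C * norm (\<xi> n - x)" for n
  proof (rule C(2)[OF fh(1)])
    have "h n - x \<in> Xc" using fh(2) x by (rule subspace_diff[OF subspace_Xc])
    then show "\<xi> n - x - f n \<in> Xc" by (simp add: fh(4) algebra_simps)
  qed
  have "(\<lambda>n. C * norm (\<xi> n - x)) \<longlonglongrightarrow> C * norm (x - x)" by (intro tendsto_intros \<xi>)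
  then have "(\<lambda>n. C * norm (\<xi> n - x)) \<longlonglongrightarrow> 0" by simp
  then have "f \<longlonglongrightarrow> 0" by (rule Lim_null_comparison[OF always_eventually[OF allI[OF le]]])
  then have "(\<lambda>n. \<xi> n - f n) \<longlonglongrightarrow> x - 0" by (intro tendsto_diff \<xi>)
  moreover have "(\<lambda>n. \<xi> n - f n) = h" by (rule ext) (simp add: fh(4))
  ultimately have hx: "h \<longlonglongrightarrow> x" by simp
  show ?thesis by (rule LIMSEQ_le_const[OF l.tendsto[OF hx hx]]) (simp add: fh(3))
qed

end

section \<open>Growth on the center space\<close>

lemma form_le_norm_square:
  fixes \<beta> :: "'a::real_normed_vector \<Rightarrow> 'a \<Rightarrow> real"
  assumes "bounded_bilinear \<beta>"
  obtains K where "0 < K" "\<And>a b. \<bar>\<beta> a b\<bar> \<le> K * norm a * norm b" "\<And>a. sqrt (\<beta> a a) \<le> K * norm a"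
proof -
  obtain K where K: "0 \<le> K" "\<And>a b. norm (\<beta> a b) \<le> norm a * norm b * K"
    using bounded_bilinear.nonneg_bounded[OF assms] by blast
  \<comment> \<open>M >= 1 gives M <= M^2, so one constant bounds both the form and its square
    root.\<close>
  define M where "M = K + 1"
  have M: "\<bar>\<beta> a b\<bar> \<le> M * norm a * norm b" for a b
  proof -
    have "norm a * norm b * K \<le> norm a * norm b * M" by (intro mult_left_mono) (auto simp: M_def)
    then show ?thesis using K(2)[of a b] by (simp add: mult_ac)
  qed
  have "sqrt (\<beta> a a) \<le> M * norm a" for a
  proof (rule real_le_lsqrt)
    have "\<beta> a a \<le> M * (norm a)\<^sup>2" using M[of a a] by (simp add: power2_eq_square mult.assoc abs_le_iff)
    also have "\<dots> \<le> M\<^sup>2 * (norm a)\<^sup>2" using K(1) by (intro mult_right_mono) (auto simp: M_def power2_eq_square)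
    finally show "\<beta> a a \<le> (M * norm a)\<^sup>2" by (simp add: power_mult_distrib)
    show "0 \<le> M * norm a" using K(1) by (simp add: M_def)
  qed
  then show ?thesis using that[of M] M K(1) by (simp add: M_def)
qed

section \<open>Integrated orbits and growth rates\<close>

context separable_hamiltonian
begin

text \<open>The integral of T s z over [0, t], fixed by choice together with its membership in the
  domain.\<close>

definition prim :: "'x \<times> 'y \<Rightarrow> real \<Rightarrow> 'x \<times> 'y" where
  "prim z = (SOME y. y 0 = 0 \<and> (\<forall>t. (y has_vector_derivative blinfun_apply (T t) z) (at t)) \<and>
     (\<forall>t. y t \<in> dG) \<and> (\<forall>t. G (y t) = blinfun_apply (T t) z - z))"

lemma prim: "prim z 0 = 0" "(prim z has_vector_derivative blinfun_apply (T t) z) (at t)"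
  "prim z t \<in> dG" "G (prim z t) = blinfun_apply (T t) z - z"
proof -
  have "\<exists>y. y 0 = 0 \<and> (\<forall>t. (y has_vector_derivative blinfun_apply (T t) z) (at t)) \<and>
     (\<forall>t. y t \<in> dG) \<and> (\<forall>t. G (y t) = blinfun_apply (T t) z - z)"
    by (rule primitive_exists[of z]) blast
  from someI_ex[OF this] show "prim z 0 = 0" "(prim z has_vector_derivative blinfun_apply (T t) z) (at t)"
    "prim z t \<in> dG" "G (prim z t) = blinfun_apply (T t) z - z" unfolding prim_def[symmetric] by blast+
qed

lemma prim_Ec: "z \<in> Ec \<Longrightarrow> prim z t \<in> Ec"
  by (rule primitive_Ec[OF _ prim(1,2)])

lemma fst_T: "fst (blinfun_apply (T t) z) = fst z + B (blinfun_apply A (snd (prim z t)))"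
  and snd_T: "snd (blinfun_apply (T t) z) = snd z - Bd (blinfun_apply L (fst (prim z t)))"
proof -
  have "blinfun_apply (T t) z = z + G (prim z t)" by (simp add: prim(4))
  then show "fst (blinfun_apply (T t) z) = fst z + B (blinfun_apply A (snd (prim z t)))"
    "snd (blinfun_apply (T t) z) = snd z - Bd (blinfun_apply L (fst (prim z t)))" by (simp_all add: G_eq)
qed

lemma prim_dom: "blinfun_apply L (fst (prim z t)) \<in> Dd" "blinfun_apply A (snd (prim z t)) \<in> D"
  using prim(3)[of z t] by (auto simp: dG_iff)

lemma bounded_prim:
  assumes \<Psi>: "bounded_linear \<Psi>" and t: "0 \<le> t"
    and le: "\<And>s. 0 \<le> s \<Longrightarrow> s \<le> t \<Longrightarrow> norm (\<Psi> (blinfun_apply (T s) z)) \<le> \<alpha>"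
  shows "norm (\<Psi> (prim z t)) \<le> \<alpha> * t"
proof -
  interpret P: bounded_linear \<Psi> by fact
  have der: "((\<lambda>s. \<Psi> (prim z s)) has_derivative (\<lambda>h. h *\<^sub>R \<Psi> (blinfun_apply (T s) z))) (at s within {0..t})" for s
    using P.has_vector_derivative[OF prim(2)[of z s]] unfolding has_vector_derivative_def
    by (rule has_derivative_at_withinI)
  have "norm (\<Psi> (prim z t) - \<Psi> (prim z 0)) \<le> \<alpha> * norm (t - 0)"
  proof (rule differentiable_bound[of "{0..t}" _ "\<lambda>s h. h *\<^sub>R \<Psi> (blinfun_apply (T s) z)"])
    show "onorm (\<lambda>h. h *\<^sub>R \<Psi> (blinfun_apply (T s) z)) \<le> \<alpha>" if "s \<in> {0..t}" for s
    proof (rule onorm_le)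
      fix h :: real
      have "norm (\<Psi> (blinfun_apply (T s) z)) \<le> \<alpha>" using le that by simp
      then have "norm (\<Psi> (blinfun_apply (T s) z)) * \<bar>h\<bar> \<le> \<alpha> * \<bar>h\<bar>" by (rule mult_right_mono) simp
      then show "norm (h *\<^sub>R \<Psi> (blinfun_apply (T s) z)) \<le> \<alpha> * norm h" by (simp add: mult.commute)
    qed
  qed (use der t in auto)
  then show ?thesis using t by (simp add: prim(1) P.zero)
qed

text \<open>Uniform over \<open>Ec\<close> and for t >= 0 only, since reflection supplies negative
  times; powers of 1 + t are stable under sums and gain one degree under integration.\<close>

definition grows :: "nat \<Rightarrow> (real \<Rightarrow> 'x \<times> 'y \<Rightarrow> 'b::real_normed_vector) \<Rightarrow> bool" where
  "grows p F \<longleftrightarrow> (\<exists>M. \<forall>t\<ge>0. \<forall>z\<in>Ec. norm (F t z) \<le> M * (1 + t) ^ p * norm z)"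

lemma growsI: "(\<And>t z. 0 \<le> t \<Longrightarrow> z \<in> Ec \<Longrightarrow> norm (F t z) \<le> M * (1 + t) ^ p * norm z) \<Longrightarrow> grows p F"
  unfolding grows_def by blast

lemma growsE:
  assumes "grows p F"
  obtains M where "0 \<le> M" "\<And>t z. 0 \<le> t \<Longrightarrow> z \<in> Ec \<Longrightarrow> norm (F t z) \<le> M * (1 + t) ^ p * norm z"
proof -
  obtain M where M: "\<And>t z. 0 \<le> t \<Longrightarrow> z \<in> Ec \<Longrightarrow> norm (F t z) \<le> M * (1 + t) ^ p * norm z"
    using assms unfolding grows_def by blast
  have "norm (F t z) \<le> \<bar>M\<bar> * (1 + t) ^ p * norm z" if "0 \<le> t" "z \<in> Ec" for t z
  proof -
    have "M * (1 + t) ^ p * norm z \<le> \<bar>M\<bar> * (1 + t) ^ p * norm z" using that(1) by (intro mult_right_mono) auto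
    then show ?thesis using M[OF that] by simp
  qed
  then show ?thesis using that[of "\<bar>M\<bar>"] by simp
qed

lemma grows_le: "grows p H \<Longrightarrow> (\<And>t z. 0 \<le> t \<Longrightarrow> z \<in> Ec \<Longrightarrow> norm (F t z) \<le> norm (H t z)) \<Longrightarrow> grows p F"
  unfolding grows_def by (meson order_trans)

lemma grows_norm: "grows p F \<Longrightarrow> grows p (\<lambda>t z. norm (F t z))"
  by (erule grows_le) simp

lemma grows_add: "grows p F \<Longrightarrow> grows p H \<Longrightarrow> grows p (\<lambda>t z. F t z + H t z)"
proof -
  assume "grows p F" "grows p H"
  then obtain M N where M: "\<And>t z. 0 \<le> t \<Longrightarrow> z \<in> Ec \<Longrightarrow> norm (F t z) \<le> M * (1 + t) ^ p * norm z"
    and N: "\<And>t z. 0 \<le> t \<Longrightarrow> z \<in> Ec \<Longrightarrow> norm (H t z) \<le> N * (1 + t) ^ p * norm z"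
    unfolding grows_def by blast
  show ?thesis
  proof (rule growsI[of _ "M + N"])
    show "norm (F t z + H t z) \<le> (M + N) * (1 + t) ^ p * norm z" if "0 \<le> t" "z \<in> Ec" for t z
      using norm_triangle_ineq[of "F t z" "H t z"] M[OF that] N[OF that] by (simp add: distrib_right)
  qed
qed

lemma grows_linear: "bounded_linear \<Psi> \<Longrightarrow> grows p F \<Longrightarrow> grows p (\<lambda>t z. \<Psi> (F t z))"
proof -
  assume "bounded_linear \<Psi>" and F: "grows p F"
  then obtain K where K: "0 \<le> K" "\<And>x. norm (\<Psi> x) \<le> norm x * K" using bounded_linear.nonneg_bounded by blast
  obtain M where M: "\<And>t z. 0 \<le> t \<Longrightarrow> z \<in> Ec \<Longrightarrow> norm (F t z) \<le> M * (1 + t) ^ p * norm z"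
    using F unfolding grows_def by blast
  show ?thesis
  proof (rule growsI[of _ "K * M"])
    show "norm (\<Psi> (F t z)) \<le> K * M * (1 + t) ^ p * norm z" if "0 \<le> t" "z \<in> Ec" for t z
      using K(2)[of "F t z"] mult_right_mono[OF M[OF that] K(1)] by (simp add: mult_ac)
  qed
qed

lemma grows_cmult: "grows p F \<Longrightarrow> grows p (\<lambda>t z. c * F t z)" for F :: "real \<Rightarrow> 'x \<times> 'y \<Rightarrow> real"
  by (rule grows_linear[OF bounded_linear_mult_right])

lemma grows_sum: "finite I \<Longrightarrow> (\<And>i. i \<in> I \<Longrightarrow> grows p (F i)) \<Longrightarrow> grows p (\<lambda>t z. \<Sum>i\<in>I. F i t z)"
proof (induction I rule: finite_induct)
  case empty
  show ?case by (rule growsI[of _ 0]) simp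
next
  case (insert k I)
  then show ?case using grows_add[of p "F k" "\<lambda>t z. \<Sum>i\<in>I. F i t z"] by simp
qed

lemma grows_mono: "grows p F \<Longrightarrow> p \<le> q \<Longrightarrow> grows q F"
proof (elim growsE, rule growsI)
  fix M t :: real and z :: "'x \<times> 'y"
  assume "p \<le> q" "0 \<le> M" "0 \<le> t" "z \<in> Ec"
    and M: "\<And>t z. 0 \<le> t \<Longrightarrow> z \<in> Ec \<Longrightarrow> norm (F t z) \<le> M * (1 + t) ^ p * norm z"
  have "M * (1 + t) ^ p * norm z \<le> M * (1 + t) ^ q * norm z"
    using \<open>0 \<le> M\<close> \<open>0 \<le> t\<close> \<open>p \<le> q\<close> by (intro mult_right_mono mult_left_mono power_increasing) auto
  then show "norm (F t z) \<le> M * (1 + t) ^ q * norm z" using M[OF \<open>0 \<le> t\<close> \<open>z \<in> Ec\<close>] by simp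
qed

lemma grows_initial: "bounded_linear \<Psi> \<Longrightarrow> grows p (\<lambda>t z. \<Psi> z)"
proof (rule grows_mono[of 0])
  assume "bounded_linear \<Psi>"
  then obtain K where "\<And>x. norm (\<Psi> x) \<le> norm x * K" using bounded_linear.bounded by blast
  then show "grows 0 (\<lambda>t. \<Psi>)" by (intro growsI[of _ K]) (simp add: mult.commute)
qed simp

lemma grows_prim:
  assumes \<Psi>: "bounded_linear \<Psi>" and "grows p (\<lambda>t z. \<Psi> (blinfun_apply (T t) z))"
  shows "grows (Suc p) (\<lambda>t z. \<Psi> (prim z t))"
proof -
  obtain M where M: "0 \<le> M" "\<And>t z. 0 \<le> t \<Longrightarrow> z \<in> Ec \<Longrightarrow> norm (\<Psi> (blinfun_apply (T t) z)) \<le> M * (1 + t) ^ p * norm z"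
    by (rule growsE[OF assms(2)]) blast
  show ?thesis
  proof (rule growsI[of _ M])
    fix t :: real and z assume t: "0 \<le> t" and z: "z \<in> Ec"
    have "norm (\<Psi> (prim z t)) \<le> (M * (1 + t) ^ p * norm z) * t"
    proof (rule bounded_prim[OF \<Psi> t])
      fix s assume s: "0 \<le> s" "s \<le> t"
      have "M * (1 + s) ^ p * norm z \<le> M * (1 + t) ^ p * norm z"
        using M(1) s by (intro mult_right_mono mult_left_mono power_mono) auto
      then show "norm (\<Psi> (blinfun_apply (T s) z)) \<le> M * (1 + t) ^ p * norm z" using M(2)[OF s(1) z] by simp
    qed
    also have "\<dots> \<le> (M * (1 + t) ^ p * norm z) * (1 + t)" using M(1) t by (intro mult_left_mono) auto
    finally show "norm (\<Psi> (prim z t)) \<le> M * (1 + t) ^ Suc p * norm z" by (simp add: mult_ac)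
  qed
qed

lemma grows_both_directions:
  assumes "grows p (\<lambda>t. blinfun_apply (T t))"
  obtains M where "0 < M" "\<And>t z. z \<in> Ec \<Longrightarrow> norm (blinfun_apply (T t) z) \<le> M * (1 + \<bar>t\<bar>) ^ p * norm z"
proof -
  obtain M where M: "0 \<le> M" "\<And>t z. 0 \<le> t \<Longrightarrow> z \<in> Ec \<Longrightarrow> norm (blinfun_apply (T t) z) \<le> M * (1 + t) ^ p * norm z"
    by (rule growsE[OF assms]) blast
  have "norm (blinfun_apply (T t) z) \<le> (M + 1) * (1 + \<bar>t\<bar>) ^ p * norm z" if z: "z \<in> Ec" for t z
  proof -
    have "norm (blinfun_apply (T t) z) \<le> M * (1 + \<bar>t\<bar>) ^ p * norm z"
    proof (cases "0 \<le> t")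
      case True
      then show ?thesis using M(2)[OF True z] by simp
    next
      case False
      have "norm (blinfun_apply (T t) z) = norm (blinfun_apply (T (- t)) (reflect z))" by (simp add: T_reflect)
      then show ?thesis using M(2)[OF _ reflect_Ec[OF z], of "- t"] False by simp
    qed
    also have "\<dots> \<le> (M + 1) * (1 + \<bar>t\<bar>) ^ p * norm z" by (intro mult_right_mono) auto
    finally show ?thesis .
  qed
  then show ?thesis using that[of "M + 1"] M(1) by simp
qed

lemma bounded_linear_A_snd: "bounded_linear (\<lambda>z::'x \<times> 'y. blinfun_apply A (snd z))"
  and bounded_linear_L_fst: "bounded_linear (\<lambda>z::'x \<times> 'y. blinfun_apply L (fst z))"
  by (intro bounded_linear_compose[OF blinfun.bounded_linear_right] bounded_linear_fst bounded_linear_snd)+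

lemma grows_Py:
  assumes "grows p (\<lambda>t z. blinfun_apply A (snd (blinfun_apply (T t) z)))"
  shows "grows p (\<lambda>t z. Py (snd (blinfun_apply (T t) z)))"
proof -
  obtain C where C: "0 \<le> C" "\<And>y. norm (Py y) \<le> C * norm (blinfun_apply A y)" by (rule Py_bound) blast
  show ?thesis
  proof (rule grows_le[OF grows_cmult[OF grows_norm[OF assms], of C]])
    fix t z
    show "norm (Py (snd (blinfun_apply (T t) z))) \<le> norm (C * norm (blinfun_apply A (snd (blinfun_apply (T t) z))))"
      using C(2)[of "snd (blinfun_apply (T t) z)"] C(1) by (simp add: abs_mult)
  qed
qed

text \<open>The displacement is B of A (snd (prim z t)), and the component of B in
  \<open>ker L\<close> is bounded.\<close>

lemma grows_ker_component_fst:
  assumes "grows p (\<lambda>t z. blinfun_apply A (snd (prim z t)))"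
  shows "grows p (\<lambda>t z. fst (blinfun_apply (T t) z) - Px (fst (blinfun_apply (T t) z)))"
proof -
  interpret P: bounded_linear Px by (rule bounded_linear_Px)
  obtain C where C: "0 \<le> C" "\<And>h. h \<in> D \<Longrightarrow> norm (B h - Px (B h)) \<le> C * norm h" by (rule ker_component_B_bound) blast
  have "grows p (\<lambda>t z. B (blinfun_apply A (snd (prim z t))) - Px (B (blinfun_apply A (snd (prim z t)))))"
  proof (rule grows_le[OF grows_cmult[OF grows_norm[OF assms], of C]])
    fix t z
    show "norm (B (blinfun_apply A (snd (prim z t))) - Px (B (blinfun_apply A (snd (prim z t)))))
        \<le> norm (C * norm (blinfun_apply A (snd (prim z t))))"
      using C(2)[OF prim_dom(2)[of z t]] C(1) by (simp add: abs_mult)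
  qed
  moreover have "grows p (\<lambda>t z. fst z - Px (fst z))"
    by (intro grows_initial bounded_linear_sub bounded_linear_fst bounded_linear_compose[OF bounded_linear_Px])
  ultimately have "grows p (\<lambda>t z. (fst z - Px (fst z)) + (B (blinfun_apply A (snd (prim z t))) - Px (B (blinfun_apply A (snd (prim z t))))))"
    by (rule grows_add[rotated])
  then show ?thesis by (simp add: fst_T P.add algebra_simps)
qed

lemma grows_ker_component_snd:
  assumes "grows p (\<lambda>t z. Bd (blinfun_apply L (fst (prim z t))) - Py (Bd (blinfun_apply L (fst (prim z t)))))"
  shows "grows p (\<lambda>t z. snd (blinfun_apply (T t) z) - Py (snd (blinfun_apply (T t) z)))"
proof -
  interpret P: bounded_linear Py by (rule bounded_linear_Py)
  have "grows p (\<lambda>t z. snd z - Py (snd z))"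
    by (intro grows_initial bounded_linear_sub bounded_linear_snd bounded_linear_compose[OF bounded_linear_Py])
  from grows_add[OF this grows_linear[OF bounded_linear_minus[OF bounded_linear_ident] assms]]
  show ?thesis by (simp add: snd_T P.diff algebra_simps)
qed

lemma grows_T:
  assumes "grows p (\<lambda>t z. Px (fst (blinfun_apply (T t) z)))"
    and "grows p (\<lambda>t z. fst (blinfun_apply (T t) z) - Px (fst (blinfun_apply (T t) z)))"
    and "grows p (\<lambda>t z. Py (snd (blinfun_apply (T t) z)))"
    and "grows p (\<lambda>t z. snd (blinfun_apply (T t) z) - Py (snd (blinfun_apply (T t) z)))"
  shows "grows p (\<lambda>t. blinfun_apply (T t))"
proof -
  have x: "grows p (\<lambda>t z. fst (blinfun_apply (T t) z))" using grows_add[OF assms(1,2)] by simp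
  have y: "grows p (\<lambda>t z. snd (blinfun_apply (T t) z))" using grows_add[OF assms(3,4)] by simp
  show ?thesis
  proof (rule grows_le[OF grows_add[OF grows_norm[OF x] grows_norm[OF y]]])
    fix t and z :: "'x \<times> 'y"
    show "norm (blinfun_apply (T t) z) \<le> norm (norm (fst (blinfun_apply (T t) z)) + norm (snd (blinfun_apply (T t) z)))"
      using norm_Pair_le[of "fst (blinfun_apply (T t) z)" "snd (blinfun_apply (T t) z)"] by simp
  qed
qed

text \<open>Cauchy-Schwarz is available only where L is semidefinite, but u is arbitrary in
  \<open>X1\<close>. Its unstable part is orthogonal to x and stays in \<open>X1\<close>, so it may
  be removed at bounded cost. \<open>X1\<close> is the whole space under (ii) and the closed range
  of B under (iii).\<close>

lemma L_le_sqrt: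
  assumes X1: "subspace X1" "EuX \<subseteq> X1" and pos: "\<And>x. x \<in> X1 \<inter> Xc \<Longrightarrow> 0 \<le> lf x x"
  obtains C where "0 \<le> C" "\<And>u x. u \<in> X1 \<Longrightarrow> x \<in> X1 \<inter> Xc \<Longrightarrow> \<bar>lf u x\<bar> \<le> C * sqrt (lf x x) * norm u"
proof -
  interpret l: bounded_bilinear lf by (rule bounded_bilinear_lf)
  obtain C where C: "0 \<le> C" "\<And>x. \<exists>f\<in>EuX. x - f \<in> Xc" "\<And>x f. f \<in> EuX \<Longrightarrow> x - f \<in> Xc \<Longrightarrow> norm f \<le> C * norm x"
    by (rule X_decomposition) blast
  obtain K where K: "0 < K" "\<And>a b. \<bar>lf a b\<bar> \<le> K * norm a * norm b" "\<And>a. sqrt (lf a a) \<le> K * norm a"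
    by (rule form_le_norm_square[OF bounded_bilinear_lf]) blast
  have "\<bar>lf u x\<bar> \<le> (K * (1 + C)) * sqrt (lf x x) * norm u" if u: "u \<in> X1" and x: "x \<in> X1 \<inter> Xc" for u x
  proof -
    obtain f where f: "f \<in> EuX" "u - f \<in> Xc" using C(2) by blast
    have h: "u - f \<in> X1 \<inter> Xc" using f u X1 by (auto intro: subspace_diff)
    have "lf x f = 0" using x f(1) by (simp add: Xc_iff)
    then have "lf u x = lf (u - f) x" using lf_commute[of f x] by (simp add: l.diff_left)
    then have "\<bar>lf u x\<bar> \<le> sqrt (lf (u - f) (u - f)) * sqrt (lf x x)"
      using form_Cauchy_Schwarz_sqrt[OF bounded_bilinear_lf lf_commute subspace_inter[OF X1(1) subspace_Xc] pos h x] by simp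
    also have "\<dots> \<le> (K * ((1 + C) * norm u)) * sqrt (lf x x)"
    proof (rule mult_right_mono)
      have "norm (u - f) \<le> (1 + C) * norm u"
        using norm_triangle_ineq4[of u f] C(3)[OF f] by (simp add: algebra_simps)
      then have "K * norm (u - f) \<le> K * ((1 + C) * norm u)" using K(1) by simp
      then show "sqrt (lf (u - f) (u - f)) \<le> K * ((1 + C) * norm u)" using K(3)[of "u - f"] by simp
    qed (use pos[OF x] in simp)
    finally show ?thesis by (simp add: mult_ac)
  qed
  then show ?thesis using that[of "K * (1 + C)"] K(1) C(1) by simp
qed

lemma energy: "lf (fst (blinfun_apply (T t) z)) (fst (blinfun_apply (T t) z)) + af (snd (blinfun_apply (T t) z)) (snd (blinfun_apply (T t) z))
   = lf (fst z) (fst z) + af (snd z) (snd z)"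
  using bl_preserved[of t z z] .

text \<open>Both energy terms are nonnegative on the center space, so L x and A y stay bounded.
  Linear growth has two sources: the functionals \<open>g e\<close> at x(t), and the components in
  \<open>ker L\<close> and \<open>ker A\<close>; each is governed by A or L of an integrated
  orbit.\<close>

lemma growth_dense_range:
  assumes dense: "closure (range_BA A D B) = UNIV"
  shows "grows 1 (\<lambda>t. blinfun_apply (T t))"
proof -
  have pos: "0 \<le> lf x x" if "x \<in> Xc" for x using lf_nonneg_on_closure_range[OF that] dense by simp
  obtain C where C: "0 \<le> C" "\<And>u x. u \<in> UNIV \<Longrightarrow> x \<in> UNIV \<inter> Xc \<Longrightarrow> \<bar>lf u x\<bar> \<le> C * sqrt (lf x x) * norm u"
    by (rule L_le_sqrt[OF subspace_UNIV]) (use pos in auto)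
  have L_le: "norm (blinfun_apply L x) \<le> C * sqrt (lf x x)" if x: "x \<in> Xc" for x
  proof (rule norm_blinfun_bound)
    show "0 \<le> C * sqrt (lf x x)" using C(1) pos[OF x] by simp
    show "norm (lf x u) \<le> C * sqrt (lf x x) * norm u" for u
      using C(2)[of u x] x unfolding lf_commute[of u x] by simp
  qed
  obtain CA where CA: "0 < CA" "\<And>y. norm (blinfun_apply A y) \<le> CA * sqrt (af y y)" by (rule A_bound) blast
  obtain K where K: "0 < K" "\<And>z w. \<bar>bl z w\<bar> \<le> K * norm z * norm w" "\<And>z. sqrt (bl z z) \<le> K * norm z"
    by (rule form_le_norm_square[OF bounded_bilinear_bl]) blast
  have XcT: "fst (blinfun_apply (T t) z) \<in> Xc" if "z \<in> Ec" for t z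
    using T_Ec[OF that, of t] by (simp add: Ec_split)
  have sq: "grows 0 (\<lambda>t z. sqrt (lf (fst (blinfun_apply (T t) z)) (fst (blinfun_apply (T t) z))))"
    "grows 0 (\<lambda>t z. sqrt (af (snd (blinfun_apply (T t) z)) (snd (blinfun_apply (T t) z))))"
  proof -
    have "sqrt (lf (fst (blinfun_apply (T t) z)) (fst (blinfun_apply (T t) z))) \<le> sqrt (bl z z)"
      "sqrt (af (snd (blinfun_apply (T t) z)) (snd (blinfun_apply (T t) z))) \<le> sqrt (bl z z)" if "z \<in> Ec" for t z
      using energy[of t z] pos[OF XcT[OF that, of t]] af_nonneg[of "snd (blinfun_apply (T t) z)"]
      by (auto intro!: real_sqrt_le_mono)
    then have le: "sqrt (lf (fst (blinfun_apply (T t) z)) (fst (blinfun_apply (T t) z))) \<le> K * norm z"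
      "sqrt (af (snd (blinfun_apply (T t) z)) (snd (blinfun_apply (T t) z))) \<le> K * norm z" if "z \<in> Ec" for t z
      using K(3)[of z] that order_trans by blast+
    show "grows 0 (\<lambda>t z. sqrt (lf (fst (blinfun_apply (T t) z)) (fst (blinfun_apply (T t) z))))"
      by (rule growsI[of _ K]) (use le(1) pos[OF XcT] in simp)
    show "grows 0 (\<lambda>t z. sqrt (af (snd (blinfun_apply (T t) z)) (snd (blinfun_apply (T t) z))))"
      by (rule growsI[of _ K]) (use le(2) af_nonneg in simp)
  qed
  have gL: "grows 0 (\<lambda>t z. blinfun_apply L (fst (blinfun_apply (T t) z)))"
    by (rule grows_le[OF grows_cmult[OF sq(1), of C]])
      (use L_le[OF XcT] C(1) pos[OF XcT] in \<open>simp add: abs_mult\<close>)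
  have gA: "grows 0 (\<lambda>t z. blinfun_apply A (snd (blinfun_apply (T t) z)))"
    by (rule grows_le[OF grows_cmult[OF sq(2), of CA]]) (use CA af_nonneg in \<open>simp add: abs_mult\<close>)
  have gLp: "grows 1 (\<lambda>t z. blinfun_apply L (fst (prim z t)))"
    using grows_prim[OF bounded_linear_L_fst gL] by simp
  have gAp: "grows 1 (\<lambda>t z. blinfun_apply A (snd (prim z t)))"
    using grows_prim[OF bounded_linear_A_snd gA] by simp
  obtain I :: "'x set" and g and CP where g: "finite I" "0 \<le> CP" "\<And>e. e \<in> I \<Longrightarrow> g e \<in> Dd"
    "\<And>x. 0 \<le> lf x x \<Longrightarrow> norm (Px x) \<le> CP * (sqrt (lf x x) + (\<Sum>e\<in>I. \<bar>blinfun_apply (g e) x\<bar>))"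
    by (rule Px_le_seminorm) blast
  \<comment> \<open>Moved through B', g e of the displacement is A (snd (prim z t)) evaluated at the
    fixed vector Bd (g e).\<close>
  have gg: "grows 1 (\<lambda>t z. blinfun_apply (g e) (fst (blinfun_apply (T t) z)))" if e: "e \<in> I" for e
  proof -
    have "grows 1 (\<lambda>t z. blinfun_apply (g e) (fst z))"
      by (intro grows_initial bounded_linear_compose[OF blinfun.bounded_linear_right] bounded_linear_fst)
    from grows_add[OF this grows_linear[OF blinfun.bounded_linear_left gAp, of "Bd (g e)"]]
    show ?thesis by (simp add: fst_T blinfun.add_right dual_op_eq[OF g(3)[OF e] prim_dom(2)])
  qed
  have gPx: "grows 1 (\<lambda>t z. Px (fst (blinfun_apply (T t) z)))"
  proof (rule grows_le)
    show "grows 1 (\<lambda>t z. CP * (sqrt (lf (fst (blinfun_apply (T t) z)) (fst (blinfun_apply (T t) z))) +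
      (\<Sum>e\<in>I. \<bar>blinfun_apply (g e) (fst (blinfun_apply (T t) z))\<bar>)))"
    proof (intro grows_cmult grows_add grows_sum g(1))
      show "grows 1 (\<lambda>t z. sqrt (lf (fst (blinfun_apply (T t) z)) (fst (blinfun_apply (T t) z))))"
        by (rule grows_mono[OF sq(1)]) simp
      show "grows 1 (\<lambda>t z. \<bar>blinfun_apply (g e) (fst (blinfun_apply (T t) z))\<bar>)" if "e \<in> I" for e
        using grows_norm[OF gg[OF that]] by simp
    qed
    show "norm (Px (fst (blinfun_apply (T t) z))) \<le> norm (CP * (sqrt (lf (fst (blinfun_apply (T t) z)) (fst (blinfun_apply (T t) z))) +
      (\<Sum>e\<in>I. \<bar>blinfun_apply (g e) (fst (blinfun_apply (T t) z))\<bar>)))" if "z \<in> Ec" for t z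
      using g(4)[OF pos[OF XcT[OF that, of t]]] unfolding real_norm_def by (rule order_trans[OF _ abs_ge_self])
  qed
  obtain C4 where C4: "0 \<le> C4" "\<And>f. f \<in> Dd \<Longrightarrow> norm (Bd f - Py (Bd f)) \<le> C4 * norm f"
    by (rule ker_component_Bd_bound) blast
  have "grows 1 (\<lambda>t z. Bd (blinfun_apply L (fst (prim z t))) - Py (Bd (blinfun_apply L (fst (prim z t)))))"
    by (rule grows_le[OF grows_cmult[OF grows_norm[OF gLp], of C4]])
      (use C4(2)[OF prim_dom(1)] C4(1) in \<open>simp add: abs_mult\<close>)
  from grows_T[OF gPx grows_ker_component_fst[OF gAp] grows_Py[OF grows_mono[OF gA]] grows_ker_component_snd[OF this]]
  show ?thesis by simp
qed

end

section \<open>Non-degenerate forms on the closed ranges\<close>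

lemma nondegenerate_on_represents:
  fixes b :: "'a::real_normed_vector \<Rightarrow> 'a \<Rightarrow> real"
  assumes nd: "nondegenerate_on W b" and W: "subspace W" and f: "bounded_linear f"
  obtains w where "w \<in> W" "\<And>u. u \<in> W \<Longrightarrow> b u w = f u"
proof -
  interpret f: bounded_linear f by fact
  obtain K where K: "\<And>x. norm (f x) \<le> norm x * K" using f.bounded by blast
  have "restrict f W \<in> dual_of W"
    unfolding dual_of_def linear_operator_on_def
    using W K by (auto simp: f.add f.scaleR subspace_add subspace_scale mult.commute intro!: exI[of _ K])
  then have "restrict f W \<in> (\<lambda>v. restrict (\<lambda>u. b u v) W) ` W"
    using nd by (simp add: nondegenerate_on_def bij_betw_def)
  then obtain w where w: "w \<in> W" "restrict f W = restrict (\<lambda>u. b u w) W" by blast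
  have "b u w = f u" if "u \<in> W" for u using fun_cong[OF w(2), of u] that by simp
  then show ?thesis using that w(1) by blast
qed

lemma nondegenerate_on_lower_bound:
  fixes b :: "'a::real_normed_vector \<Rightarrow> 'a \<Rightarrow> real"
  assumes nd: "nondegenerate_on W b" and W: "subspace W"
  obtains c where "0 < c" "\<And>v K. v \<in> W \<Longrightarrow> 0 \<le> K \<Longrightarrow> (\<And>u. u \<in> W \<Longrightarrow> \<bar>b u v\<bar> \<le> K * norm u) \<Longrightarrow> c * norm v \<le> K"
proof -
  obtain c where c: "0 < c" "\<And>v. v \<in> W \<Longrightarrow> c * norm v \<le> dual_norm W (restrict (\<lambda>u. b u v) W)"
    using nd unfolding nondegenerate_on_def by blast
  have "c * norm v \<le> K" if v: "v \<in> W" and K: "0 \<le> K" "\<And>u. u \<in> W \<Longrightarrow> \<bar>b u v\<bar> \<le> K * norm u" for v K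
  proof -
    have "dual_norm W (restrict (\<lambda>u. b u v) W) \<le> K" unfolding dual_norm_def
    proof (rule cSUP_least)
      show "{x \<in> W. norm x \<le> 1} \<noteq> {}" using subspace_0[OF W] by force
      fix u assume u: "u \<in> {x \<in> W. norm x \<le> 1}"
      then have "K * norm u \<le> K * 1" using K(1) by (intro mult_left_mono) auto
      then show "\<bar>restrict (\<lambda>u. b u v) W u\<bar> \<le> K" using u K(2)[of u] by simp
    qed
    then show ?thesis using c(2)[OF v] by simp
  qed
  then show ?thesis using that c(1) by blast
qed

lemma subspace_closure:
  fixes S :: "'a::real_normed_vector set"
  assumes S: "subspace S"
  shows "subspace (closure S)"
  unfolding subspace_def
proof (intro conjI ballI allI)
  show "0 \<in> closure S" using subspace_0[OF S] closure_subset by blast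
  fix x assume "x \<in> closure S"
  then obtain a where a: "\<And>n. a n \<in> S" "a \<longlonglongrightarrow> x" unfolding closure_sequential by blast
  show "c *\<^sub>R x \<in> closure S" for c
    unfolding closure_sequential
    by (intro exI[of _ "\<lambda>n. c *\<^sub>R a n"] conjI allI subspace_scale[OF S] tendsto_intros a)
  fix y assume "y \<in> closure S"
  then obtain b where b: "\<And>n. b n \<in> S" "b \<longlonglongrightarrow> y" unfolding closure_sequential by blast
  show "x + y \<in> closure S"
    unfolding closure_sequential
    by (intro exI[of _ "\<lambda>n. a n + b n"] conjI allI subspace_add[OF S] tendsto_intros a b)
qed

lemma quadratic_bound_imp_linear:
  fixes \<alpha> a b :: real
  assumes "\<alpha>\<^sup>2 \<le> a\<^sup>2 + b * \<alpha>" and "0 \<le> a" "0 \<le> b" "0 \<le> \<alpha>"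
  shows "\<alpha> \<le> a + b"
proof (rule ccontr)
  assume n: "\<not> ?thesis"
  then have "a * (a + b) \<le> a * \<alpha>" using assms(2) by (intro mult_left_mono) auto
  then have "a\<^sup>2 \<le> a * \<alpha>" using mult_nonneg_nonneg[OF assms(2,3)] by (simp add: power2_eq_square distrib_left)
  moreover have "(a + b) * \<alpha> < \<alpha> * \<alpha>" using n assms(2-4) by (intro mult_strict_right_mono) auto
  ultimately show False using assms(1) by (simp add: power2_eq_square distrib_right)
qed

context separable_hamiltonian
begin

lemma subspace_range_B: "subspace (B ` D)"
  unfolding subspace_def
proof (intro conjI ballI allI)
  show "0 \<in> B ` D" using B_0 subspace_0[OF subspace_D] by (metis image_eqI)
  fix x assume "x \<in> B ` D"
  then obtain g where g: "g \<in> D" "x = B g" by blast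
  show "c *\<^sub>R x \<in> B ` D" for c using B_scale[OF g(1)] subspace_scale[OF subspace_D g(1)] g(2) by (metis image_eqI)
  fix y assume "y \<in> B ` D"
  then obtain h where h: "h \<in> D" "y = B h" by blast
  show "x + y \<in> B ` D" using B_add[OF g(1) h(1)] subspace_add[OF subspace_D g(1) h(1)] g(2) h(2) by (metis image_eqI)
qed

lemma subspace_range_Bd: "subspace (Bd ` Dd)"
  unfolding subspace_def
proof (intro conjI ballI allI)
  show "0 \<in> Bd ` Dd" using Bd_0 by (metis image_eqI)
  fix x assume "x \<in> Bd ` Dd"
  then obtain g where g: "g \<in> Dd" "x = Bd g" by blast
  show "c *\<^sub>R x \<in> Bd ` Dd" for c using Bd_scale[OF g(1)] g(2) by (metis image_eqI)
  fix y assume "y \<in> Bd ` Dd"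
  then obtain h where h: "h \<in> Dd" "y = Bd h" by blast
  show "x + y \<in> Bd ` Dd" using Bd_add[OF g(1) h(1)] g(2) h(2) by (metis image_eqI)
qed

lemma EuX_range_B: "EuX \<subseteq> B ` D"
proof
  fix x assume "x \<in> EuX"
  then obtain z where z: "z \<in> Eu" "x = fst z" by (auto simp: EuX_def)
  have "fst z \<in> B ` D" using z(1)
  proof (induction rule: Eu_induct)
    case (eigen z \<mu>)
    have "\<mu> *\<^sub>R fst z = fst (G z)" by (simp add: eigen(3))
    then have "\<mu> *\<^sub>R fst z \<in> B ` D" using eigen(2) by (simp add: G_eq dG_iff)
    then have "(1 / \<mu>) *\<^sub>R \<mu> *\<^sub>R fst z \<in> B ` D" by (rule subspace_scale[OF subspace_range_B])
    then show ?case using eigen(1) by simp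
  next
    case (add z w)
    then show ?case using subspace_add[OF subspace_range_B] by simp
  next
    case (scale c z)
    then show ?case using subspace_scale[OF subspace_range_B] by simp
  qed
  then show "x \<in> B ` D" by (simp add: z(2))
qed

text \<open>A stationary vector is split off: represent L x and A y on the closed ranges by x1 and
  y1; the remainder is killed by B' L and B A. The orbit of (x1, y1) stays in the closed ranges,
  where the conserved energy of center vectors dominates the squared norm.\<close>

lemma bounded_nondegenerate:
  assumes ndX: "nondegenerate_on (closure (B ` D)) (\<lambda>u v. lf u v)"
    and ndY: "nondegenerate_on (closure (Bd ` Dd)) (\<lambda>u v. af u v)"
  obtains M where "0 < M" "\<And>t z. z \<in> Ec \<Longrightarrow> norm (blinfun_apply (T t) z) \<le> M * norm z"
proof -
  define X1 where "X1 = closure (B ` D)"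
  define Y1 where "Y1 = closure (Bd ` Dd)"
  have subX: "subspace X1" unfolding X1_def by (rule subspace_closure[OF subspace_range_B])
  have subY: "subspace Y1" unfolding Y1_def by (rule subspace_closure[OF subspace_range_Bd])
  have BX: "B g \<in> X1" if "g \<in> D" for g unfolding X1_def by (rule subsetD[OF closure_subset imageI[OF that]])
  have BY: "Bd f \<in> Y1" if "f \<in> Dd" for f unfolding Y1_def by (rule subsetD[OF closure_subset imageI[OF that]])
  note ndX = ndX[folded X1_def] and ndY = ndY[folded Y1_def]
  obtain cX where cX: "0 < cX" "\<And>v K. v \<in> X1 \<Longrightarrow> 0 \<le> K \<Longrightarrow> (\<And>u. u \<in> X1 \<Longrightarrow> \<bar>lf u v\<bar> \<le> K * norm u) \<Longrightarrow> cX * norm v \<le> K"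
    by (rule nondegenerate_on_lower_bound[OF ndX subX]) blast
  obtain cY where cY: "0 < cY" "\<And>v K. v \<in> Y1 \<Longrightarrow> 0 \<le> K \<Longrightarrow> (\<And>u. u \<in> Y1 \<Longrightarrow> \<bar>af u v\<bar> \<le> K * norm u) \<Longrightarrow> cY * norm v \<le> K"
    by (rule nondegenerate_on_lower_bound[OF ndY subY]) blast
  \<comment> \<open>Non-degeneracy represents g on \<open>Y1\<close> by some A y; g - A y kills the
    range of B', so \<open>B_kernel\<close> gives B g = B A y. Thus
    \<open>lf_nonneg_on_closure_range\<close> reaches all of \<open>X1\<close>.\<close>
  have "B ` D \<subseteq> range_BA A D B"
  proof
    fix x assume "x \<in> B ` D"
    then obtain g where g: "g \<in> D" "x = B g" by blast
    obtain y where y: "y \<in> Y1" "\<And>u. u \<in> Y1 \<Longrightarrow> af u y = blinfun_apply g u"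
      by (rule nondegenerate_on_represents[OF ndY subY blinfun.bounded_linear_right[of g]]) blast
    have "blinfun_apply (g - blinfun_apply A y) (Bd f) = 0" if "f \<in> Dd" for f
      using y(2)[OF BY[OF that]] by (simp add: blinfun.diff_left af_commute[of y])
    note k = B_kernel[OF this]
    have "g - (g - blinfun_apply A y) \<in> D" using g(1) k(1) by (rule subspace_diff[OF subspace_D])
    moreover have "B (g - (g - blinfun_apply A y)) = x" using B_diff[OF g(1) k(1)] k(2) g(2) by simp
    ultimately show "x \<in> range_BA A D B" by (auto simp: range_BA_def)
  qed
  then have "X1 \<subseteq> closure (range_BA A D B)" unfolding X1_def by (rule closure_mono)
  then have pos: "0 \<le> lf x x" if "x \<in> X1 \<inter> Xc" for x using lf_nonneg_on_closure_range that by blast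
  have EuX1: "EuX \<subseteq> X1" unfolding X1_def by (rule order_trans[OF EuX_range_B closure_subset])
  obtain C where C: "0 \<le> C" "\<And>u x. u \<in> X1 \<Longrightarrow> x \<in> X1 \<inter> Xc \<Longrightarrow> \<bar>lf u x\<bar> \<le> C * sqrt (lf x x) * norm u"
  proof (rule L_le_sqrt[OF subX EuX1 pos])
    fix C assume a: "0 \<le> C" and b: "\<And>u x. u \<in> X1 \<Longrightarrow> x \<in> X1 \<inter> Xc \<Longrightarrow> \<bar>lf u x\<bar> \<le> C * sqrt (lf x x) * norm u"
    show thesis
      by (rule that[OF a]) (rule b)
  qed
  obtain CA where CA: "0 < CA" "\<And>y. norm (blinfun_apply A y) \<le> CA * sqrt (af y y)" by (rule A_bound) blast
  have lowX: "cX * norm x \<le> C * sqrt (lf x x)" if x: "x \<in> X1 \<inter> Xc" for x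
    by (rule cX(2)) (use x C pos[OF x] in auto)
  have lowY: "cY * norm y \<le> CA * sqrt (af y y)" if y: "y \<in> Y1" for y
  proof (rule cY(2)[OF y])
    show "0 \<le> CA * sqrt (af y y)" using CA(1) af_nonneg by simp
    show "\<bar>af u y\<bar> \<le> CA * sqrt (af y y) * norm u" for u
    proof -
      have "\<bar>af y u\<bar> \<le> norm (blinfun_apply A y) * norm u" using norm_blinfun[of "blinfun_apply A y" u] by simp
      also have "\<dots> \<le> CA * sqrt (af y y) * norm u" by (intro mult_right_mono CA) auto
      finally show ?thesis by (simp only: af_commute[of u y])
    qed
  qed
  obtain K where K: "0 < K" "\<And>z w. \<bar>bl z w\<bar> \<le> K * norm z * norm w" "\<And>z. sqrt (bl z z) \<le> K * norm z"
    by (rule form_le_norm_square[OF bounded_bilinear_bl]) blast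
  obtain KL where KL: "0 < KL" "\<And>z w. \<bar>lf z w\<bar> \<le> KL * norm z * norm w" "\<And>z. sqrt (lf z z) \<le> KL * norm z"
    by (rule form_le_norm_square[OF bounded_bilinear_lf]) blast
  obtain KA where KA: "0 < KA" "\<And>z w. \<bar>af z w\<bar> \<le> KA * norm z * norm w" "\<And>z. sqrt (af z z) \<le> KA * norm z"
    by (rule form_le_norm_square[OF bounded_bilinear_af]) blast
  define N where "N = (C / cX + CA / cY) * K"
  define P where "P = KL / cX + KA / cY"
  have N: "0 \<le> N" using C(1) CA(1) cX(1) cY(1) K(1) by (simp add: N_def)
  have P: "0 \<le> P" using KL(1) KA(1) cX(1) cY(1) by (simp add: P_def)
  have on1: "norm (blinfun_apply (T t) z) \<le> N * norm z" if z: "z \<in> Ec" "fst z \<in> X1" "snd z \<in> Y1" for t z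
  proof -
    define u where "u = blinfun_apply (T t) z"
    have "u \<in> Ec" unfolding u_def by (rule T_Ec[OF z(1)])
    moreover have "fst u \<in> X1" unfolding u_def fst_T by (intro subspace_add[OF subX] z BX prim_dom)
    moreover have "snd u \<in> Y1" unfolding u_def snd_T by (intro subspace_diff[OF subY] z BY prim_dom)
    ultimately have ux: "fst u \<in> X1 \<inter> Xc" and uy: "snd u \<in> Y1" by (auto simp: Ec_split)
    have E: "lf (fst u) (fst u) + af (snd u) (snd u) = bl z z" unfolding u_def by (rule energy)
    have "sqrt (lf (fst u) (fst u)) \<le> sqrt (bl z z)" using E af_nonneg[of "snd u"] by (intro real_sqrt_le_mono) linarith
    also note K(3)
    finally have "C * sqrt (lf (fst u) (fst u)) \<le> C * (K * norm z)" by (rule mult_left_mono[OF _ C(1)])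
    then have 1: "norm (fst u) \<le> C / cX * (K * norm z)"
      using lowX[OF ux] cX(1) by (simp add: field_simps)
    have "sqrt (af (snd u) (snd u)) \<le> sqrt (bl z z)" using E pos[OF ux] by (intro real_sqrt_le_mono) linarith
    also note K(3)
    finally have "CA * sqrt (af (snd u) (snd u)) \<le> CA * (K * norm z)" using CA(1) by simp
    then have 2: "norm (snd u) \<le> CA / cY * (K * norm z)"
      using lowY[OF uy] cY(1) by (simp add: field_simps)
    have "norm u \<le> norm (fst u) + norm (snd u)" using norm_Pair_le[of "fst u" "snd u"] by simp
    then show ?thesis using 1 2 unfolding u_def N_def by (simp add: distrib_right mult.assoc)
  qed
  have "norm (blinfun_apply (T t) z) \<le> (1 + P + N * P + 1) * norm z" if z: "z \<in> Ec" for t z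
  proof -
    obtain x1 where x1: "x1 \<in> X1" "\<And>u. u \<in> X1 \<Longrightarrow> lf u x1 = lf u (fst z)"
      by (rule nondegenerate_on_represents[OF ndX subX
            bounded_bilinear.bounded_linear_left[OF bounded_bilinear_lf, of "fst z"]]) blast
    obtain y1 where y1: "y1 \<in> Y1" "\<And>u. u \<in> Y1 \<Longrightarrow> af u y1 = af u (snd z)"
      by (rule nondegenerate_on_represents[OF ndY subY
            bounded_bilinear.bounded_linear_left[OF bounded_bilinear_af, of "snd z"]]) blast
    have "cX * norm x1 \<le> KL * norm (fst z)"
      by (rule cX(2)[OF x1(1)]) (use KL x1(2) in \<open>auto simp: mult_ac\<close>)
    then have "norm x1 \<le> KL / cX * norm (fst z)" using cX(1) by (simp add: field_simps)
    also have "\<dots> \<le> KL / cX * norm z" using KL(1) cX(1) norm_fst_le[of "fst z" "snd z"] by (intro mult_left_mono) auto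
    finally have nx: "norm x1 \<le> KL / cX * norm z" .
    have "cY * norm y1 \<le> KA * norm (snd z)"
      by (rule cY(2)[OF y1(1)]) (use KA y1(2) in \<open>auto simp: mult_ac\<close>)
    then have "norm y1 \<le> KA / cY * norm (snd z)" using cY(1) by (simp add: field_simps)
    also have "\<dots> \<le> KA / cY * norm z" using KA(1) cY(1) norm_snd_le[of "snd z" "fst z"] by (intro mult_left_mono) auto
    finally have ny: "norm y1 \<le> KA / cY * norm z" .
    define z1 where "z1 = (x1, y1)"
    have nz1: "norm z1 \<le> P * norm z" using norm_Pair_le[of x1 y1] nx ny by (simp add: z1_def P_def distrib_right)
    have "blinfun_apply (blinfun_apply L (fst z - x1)) (B g) = blinfun_apply g 0" if "g \<in> D" for g
      using x1(2)[OF BX[OF that]] lf_commute[of "B g" x1] lf_commute[of "B g" "fst z"]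
      by (simp add: blinfun.diff_right blinfun.diff_left blinfun.zero_right)
    note k1 = dual_op_eqI[OF this]
    have "blinfun_apply (blinfun_apply A (snd z - y1)) (Bd f) = 0" if "f \<in> Dd" for f
      using y1(2)[OF BY[OF that]] af_commute[of "Bd f" y1] af_commute[of "Bd f" "snd z"]
      by (simp add: blinfun.diff_right blinfun.diff_left)
    note k2 = B_kernel[OF this]
    have z0: "z - z1 \<in> dG" "G (z - z1) = 0"
      using k1 k2 by (simp_all add: dG_iff G_eq z1_def zero_prod_def)
    have z1Ec: "z1 \<in> Ec" using subspace_diff[OF subspace_Ec z G_kernel_Ec[OF z0]] by simp
    have "blinfun_apply (T t) z = blinfun_apply (T t) (z - z1) + blinfun_apply (T t) z1" by (simp add: blinfun.diff_right)
    also have "blinfun_apply (T t) (z - z1) = z - z1" by (rule T_fixes_kernel[OF z0])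
    finally have "norm (blinfun_apply (T t) z) \<le> norm (z - z1) + norm (blinfun_apply (T t) z1)"
      using norm_triangle_ineq by metis
    also have "\<dots> \<le> (norm z + norm z1) + N * norm z1"
      using on1[OF z1Ec, of t] x1(1) y1(1) by (intro add_mono norm_triangle_ineq4) (simp add: z1_def)
    also have "\<dots> \<le> (norm z + P * norm z) + N * (P * norm z)" using nz1 N by (intro add_mono mult_left_mono) auto
    also have "\<dots> \<le> (1 + P + N * P + 1) * norm z" by (simp add: algebra_simps)
    finally show ?thesis .
  qed
  moreover have "0 < 1 + P + N * P + 1" using P mult_nonneg_nonneg[OF N P] by linarith
  ultimately show ?thesis using that by blast
qed

section \<open>Growth of the velocity on the center space\<close>

definition "RBc = {B (blinfun_apply A c) |c. c \<in> Yc \<and> blinfun_apply A c \<in> D}"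

lemma subspace_RBc: "subspace RBc"
  unfolding subspace_def
proof (intro conjI ballI allI)
  have "B (blinfun_apply A 0) = 0" "blinfun_apply A 0 \<in> D"
    using subspace_0[OF subspace_D] by (simp_all add: blinfun.zero_right B_0)
  then show "0 \<in> RBc" using subspace_0[OF subspace_Yc] unfolding RBc_def by force
  fix x assume "x \<in> RBc"
  then obtain c where c: "c \<in> Yc" "blinfun_apply A c \<in> D" "x = B (blinfun_apply A c)" unfolding RBc_def by blast
  have "r *\<^sub>R c \<in> Yc" "blinfun_apply A (r *\<^sub>R c) \<in> D" "r *\<^sub>R x = B (blinfun_apply A (r *\<^sub>R c))" for r
    using c subspace_scale[OF subspace_Yc] subspace_scale[OF subspace_D] by (simp_all add: blinfun.scaleR_right B_scale)
  then show "r *\<^sub>R x \<in> RBc" for r unfolding RBc_def by blast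
  fix y assume "y \<in> RBc"
  then obtain d where d: "d \<in> Yc" "blinfun_apply A d \<in> D" "y = B (blinfun_apply A d)" unfolding RBc_def by blast
  have "c + d \<in> Yc" "blinfun_apply A (c + d) \<in> D" "x + y = B (blinfun_apply A (c + d))"
    using c d subspace_add[OF subspace_Yc] subspace_add[OF subspace_D] by (simp_all add: blinfun.add_right B_add)
  then show "x + y \<in> RBc" unfolding RBc_def by blast
qed

text \<open>Displacements of center orbits lie in this subspace, so sqrt (lf x x) is a seminorm on
  them although L may be indefinite on \<open>Xc\<close>.\<close>

lemma RBc_nonneg: "x \<in> RBc \<Longrightarrow> 0 \<le> lf x x" and RBc_Xc: "x \<in> RBc \<Longrightarrow> x \<in> Xc"
  using BA_nonneg BA_Xc by (auto simp: RBc_def)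

lemma displacement_RBc: "z \<in> Ec \<Longrightarrow> B (blinfun_apply A (snd (prim z t))) \<in> RBc"
  using prim_Ec[of z t] prim_dom(2)[of z t] unfolding RBc_def by (auto simp: Ec_split)

text \<open>The functionals of \<open>Px_le_seminorm\<close> are moved through B', where they cost
  at most |Bd (g e)| |A y|.\<close>

lemma Px_RBc_bound:
  obtains C where "0 \<le> C" "\<And>y. y \<in> Yc \<Longrightarrow> blinfun_apply A y \<in> D \<Longrightarrow>
    norm (Px (B (blinfun_apply A y))) \<le> C * (sqrt (lf (B (blinfun_apply A y)) (B (blinfun_apply A y))) + norm (blinfun_apply A y))"
proof -
  obtain I :: "'x set" and g and CP where g: "finite I" "0 \<le> CP" "\<And>e. e \<in> I \<Longrightarrow> g e \<in> Dd"
    "\<And>x. 0 \<le> lf x x \<Longrightarrow> norm (Px x) \<le> CP * (sqrt (lf x x) + (\<Sum>e\<in>I. \<bar>blinfun_apply (g e) x\<bar>))"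
    by (rule Px_le_seminorm) blast
  define N where "N = (\<Sum>e\<in>I. norm (Bd (g e)))"
  have N: "0 \<le> N" by (simp add: N_def sum_nonneg)
  have "norm (Px (B (blinfun_apply A y))) \<le> (CP * (1 + N)) * (sqrt (lf (B (blinfun_apply A y)) (B (blinfun_apply A y))) + norm (blinfun_apply A y))"
    if y: "y \<in> Yc" "blinfun_apply A y \<in> D" for y
  proof -
    define x where "x = B (blinfun_apply A y)"
    have x: "0 \<le> lf x x" unfolding x_def by (rule BA_nonneg[OF y])
    have "(\<Sum>e\<in>I. \<bar>blinfun_apply (g e) x\<bar>) \<le> (\<Sum>e\<in>I. norm (Bd (g e)) * norm (blinfun_apply A y))"
    proof (rule sum_mono)
      fix e assume "e \<in> I"
      then show "\<bar>blinfun_apply (g e) x\<bar> \<le> norm (Bd (g e)) * norm (blinfun_apply A y)"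
        using dual_op_eq[OF g(3) y(2)] norm_blinfun[of "blinfun_apply A y" "Bd (g e)"] by (simp add: x_def mult.commute)
    qed
    also have "\<dots> = N * norm (blinfun_apply A y)" by (simp add: N_def sum_distrib_right)
    finally have "sqrt (lf x x) + (\<Sum>e\<in>I. \<bar>blinfun_apply (g e) x\<bar>) \<le> (1 + N) * (sqrt (lf x x) + norm (blinfun_apply A y))"
      using N mult_nonneg_nonneg[OF N, of "sqrt (lf x x)"] x norm_ge_zero[of "blinfun_apply A y"]
      by (simp add: distrib_left distrib_right add_increasing add_increasing2 del: norm_ge_zero)
    then have "CP * (sqrt (lf x x) + (\<Sum>e\<in>I. \<bar>blinfun_apply (g e) x\<bar>)) \<le> CP * ((1 + N) * (sqrt (lf x x) + norm (blinfun_apply A y)))"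
      by (rule mult_left_mono[OF _ g(2)])
    then show ?thesis using g(4)[OF x] unfolding x_def by (simp add: mult.assoc)
  qed
  then show ?thesis using that[of "CP * (1 + N)"] g(2) N by simp
qed

text \<open>Energy conservation with \<open>x(t) = x(0) + \<xi>(t)\<close>, \<open>\<xi> = B A \<integral>v\<close>: the form is nonnegative at \<open>\<xi>\<close>,
  and the only indefinite term \<open>\<langle>L \<xi>, x(0)\<rangle>\<close> is controlled by \<open>\<integral>v\<close>.\<close>

lemma linear_growth_of_velocity:
  shows "grows 1 (\<lambda>t z. blinfun_apply A (snd (blinfun_apply (T t) z)))"
    and "grows 1 (\<lambda>t z. sqrt (lf (B (blinfun_apply A (snd (prim z t)))) (B (blinfun_apply A (snd (prim z t))))))"
proof -
  obtain C where C: "0 \<le> C" "\<And>y. y \<in> Yc \<Longrightarrow> blinfun_apply A y \<in> D \<Longrightarrow>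
    norm (Px (B (blinfun_apply A y))) \<le> C * (sqrt (lf (B (blinfun_apply A y)) (B (blinfun_apply A y))) + norm (blinfun_apply A y))"
    by (rule Px_RBc_bound) blast
  obtain CA where CA: "0 < CA" "\<And>y. norm (blinfun_apply A y) \<le> CA * sqrt (af y y)" by (rule A_bound) blast
  obtain KL where KL: "0 < KL" "\<And>z w. \<bar>lf z w\<bar> \<le> KL * norm z * norm w" "\<And>z. sqrt (lf z z) \<le> KL * norm z"
    by (rule form_le_norm_square[OF bounded_bilinear_lf]) blast
  obtain KA where KA: "0 < KA" "\<And>z w. \<bar>af z w\<bar> \<le> KA * norm z * norm w" "\<And>z. sqrt (af z z) \<le> KA * norm z"
    by (rule form_le_norm_square[OF bounded_bilinear_af]) blast
  define P where "P = 2 * KL * C"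
  have P: "0 \<le> P" using KL(1) C(1) by (simp add: P_def)
  \<comment> \<open>KA^2 accounts for the initial value of af; P^2 / 2 is left by Young's inequality
    when half of q^2 absorbs the cross term. The initial value of lf cancels from the energy
    balance.\<close>
  define Q where "Q = sqrt (KA\<^sup>2 + P\<^sup>2 / 2)"
  define M where "M = Q + P * CA"
  have Q: "0 \<le> Q" by (simp add: Q_def)
  have M: "0 \<le> M" using Q P CA(1) by (simp add: M_def)
  have main: "sqrt (af (snd (blinfun_apply (T t) z)) (snd (blinfun_apply (T t) z))) \<le> M * (1 + t) * norm z \<and>
     sqrt (lf (B (blinfun_apply A (snd (prim z t)))) (B (blinfun_apply A (snd (prim z t))))) \<le> 2 * M * (1 + t) * norm z"
    if t: "0 \<le> t" and z: "z \<in> Ec" for t z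
  proof -
    interpret l: bounded_bilinear lf by (rule bounded_bilinear_lf)
    interpret a: bounded_bilinear af by (rule bounded_bilinear_af)
    define n where "n = norm z"
    have n: "0 \<le> n" by (simp add: n_def)
    define w where "w s = sqrt (af (snd (blinfun_apply (T s) z)) (snd (blinfun_apply (T s) z)))" for s
    define \<xi> where "\<xi> s = B (blinfun_apply A (snd (prim z s)))" for s
    define q where "q s = sqrt (lf (\<xi> s) (\<xi> s))" for s
    have \<xi>: "0 \<le> lf (\<xi> s) (\<xi> s)" for s unfolding \<xi>_def by (rule RBc_nonneg[OF displacement_RBc[OF z]])
    have q: "0 \<le> q s" "(q s)\<^sup>2 = lf (\<xi> s) (\<xi> s)" for s using \<xi> by (simp_all add: q_def)
    have w: "0 \<le> w s" "(w s)\<^sup>2 = af (snd (blinfun_apply (T s) z)) (snd (blinfun_apply (T s) z))" for s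
      using af_nonneg by (simp_all add: w_def)
    have "continuous_on {0..t} w" unfolding w_def
      by (intro continuous_intros continuous_on_subset[OF T_continuous]) auto
    then obtain s0 where s0: "s0 \<in> {0..t}" "\<And>s. s \<in> {0..t} \<Longrightarrow> w s \<le> w s0"
      using continuous_attains_sup[of "{0..t}" w] t by auto
    \<comment> \<open>The maximum of the velocity seminorm on [0, t] bounds every integral of A y up
      to t.\<close>
    define \<alpha> where "\<alpha> = w s0"
    have \<alpha>: "0 \<le> \<alpha>" by (simp add: \<alpha>_def w)
    have bal: "(q s)\<^sup>2 / 2 + (w s)\<^sup>2 \<le> (Q * n)\<^sup>2 + (P * CA * t * n) * \<alpha>" if s: "0 \<le> s" "s \<le> t" for s
    proof -
      have "norm (blinfun_apply A (snd (prim z s))) \<le> (CA * \<alpha>) * s"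
      proof (rule bounded_prim[OF bounded_linear_A_snd s(1)])
        fix r assume "0 \<le> r" "r \<le> s"
        then have "w r \<le> \<alpha>" using s0(2)[of r] s by (simp add: \<alpha>_def)
        then have "CA * w r \<le> CA * \<alpha>" using CA(1) by simp
        then show "norm (blinfun_apply A (snd (blinfun_apply (T r) z))) \<le> CA * \<alpha>"
          using CA(2)[of "snd (blinfun_apply (T r) z)"] unfolding w_def by simp
      qed
      also have "\<dots> \<le> (CA * \<alpha>) * t" using CA(1) \<alpha> s by (intro mult_left_mono) auto
      finally have Ap: "norm (blinfun_apply A (snd (prim z s))) \<le> CA * \<alpha> * t" .
      have "snd (prim z s) \<in> Yc" using prim_Ec[OF z, of s] by (simp add: Ec_split)
      from C(2)[OF this prim_dom(2)] have "norm (Px (\<xi> s)) \<le> C * (q s + norm (blinfun_apply A (snd (prim z s))))"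
        unfolding \<xi>_def q_def .
      also have "\<dots> \<le> C * (q s + CA * \<alpha> * t)" using Ap C(1) by (intro mult_left_mono) auto
      finally have P\<xi>: "norm (Px (\<xi> s)) \<le> C * (q s + CA * \<alpha> * t)" .
      have nf: "norm (fst z) \<le> n" "norm (snd z) \<le> n" unfolding n_def
        using norm_fst_le[of "fst z" "snd z"] norm_snd_le[of "snd z" "fst z"] by simp_all
      have "\<bar>lf (\<xi> s) (fst z)\<bar> = \<bar>lf (Px (\<xi> s)) (fst z)\<bar>" by (simp add: L_Px)
      also have "\<dots> \<le> KL * norm (Px (\<xi> s)) * norm (fst z)" by (rule KL(2))
      also have "\<dots> \<le> KL * (C * (q s + CA * \<alpha> * t)) * n"
        using P\<xi> nf KL(1) by (intro mult_mono) (auto simp: C(1) q(1) CA(1) less_imp_le \<alpha> t)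
      finally have cross: "2 * \<bar>lf (\<xi> s) (fst z)\<bar> \<le> P * n * q s + (P * CA * t * n) * \<alpha>"
        by (simp add: P_def algebra_simps)
      have "af (snd z) (snd z) \<le> (KA * n)\<^sup>2"
      proof -
        have "sqrt (af (snd z) (snd z)) \<le> KA * n" using KA(3)[of "snd z"] nf(2) KA(1) by (meson mult_left_mono less_imp_le order_trans)
        then show ?thesis using af_nonneg[of "snd z"] by (metis real_sqrt_ge_0_iff power_mono real_sqrt_pow2)
      qed
      moreover have "lf (fst z + \<xi> s) (fst z + \<xi> s) + (w s)\<^sup>2 = lf (fst z) (fst z) + af (snd z) (snd z)"
        using energy[of s z] by (simp only: w(2) fst_T \<xi>_def)
      then have "lf (\<xi> s) (\<xi> s) + 2 * lf (\<xi> s) (fst z) + (w s)\<^sup>2 = af (snd z) (snd z)"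
        using form_add_scaled[OF bounded_bilinear_lf lf_commute, of "fst z" 1 "\<xi> s"] lf_commute[of "fst z" "\<xi> s"]
        by simp
      moreover have "P * n * q s \<le> (q s)\<^sup>2 / 2 + (P * n)\<^sup>2 / 2"
        using zero_le_power2[of "q s - P * n"] by (simp add: power2_diff algebra_simps)
      ultimately have "(q s)\<^sup>2 / 2 + (w s)\<^sup>2 \<le> (KA * n)\<^sup>2 + (P * n)\<^sup>2 / 2 + (P * CA * t * n) * \<alpha>"
        using cross unfolding q(2) by linarith
      also have "(KA * n)\<^sup>2 + (P * n)\<^sup>2 / 2 = (Q * n)\<^sup>2"
        by (simp add: Q_def power_mult_distrib add_nonneg_nonneg algebra_simps)
      finally show ?thesis .
    qed
    define c where "c = P * CA * t * n"
    have c: "0 \<le> c" using P CA(1) t n by (simp add: c_def)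
    have Qn: "0 \<le> Q * n" using Q n by simp
    \<comment> \<open>The balance at the maximising time closes into a quadratic inequality for
      \<alpha>. As c carries the single factor t, its solution grows linearly.\<close>
    have "\<alpha>\<^sup>2 \<le> (Q * n)\<^sup>2 + c * \<alpha>"
    proof -
      have "0 \<le> (q s0)\<^sup>2 / 2" by simp
      moreover have "0 \<le> s0" "s0 \<le> t" using s0(1) by auto
      note bal[OF this]
      ultimately show ?thesis unfolding \<alpha>_def[symmetric] c_def by linarith
    qed
    from quadratic_bound_imp_linear[OF this Qn c \<alpha>] have \<alpha>le: "\<alpha> \<le> Q * n + c" .
    have S: "Q * n + c \<le> M * (1 + t) * n"
    proof -
      have "0 \<le> Q * t * n" "0 \<le> P * CA * n" using Q P CA(1) t n by simp_all
      then show ?thesis by (simp add: M_def c_def algebra_simps)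
    qed
    have "w t \<le> M * (1 + t) * n" using s0(2)[of t] t \<alpha>le S by (simp add: \<alpha>_def)
    moreover have "q t \<le> 2 * (M * (1 + t) * n)"
    proof -
      have "c * \<alpha> \<le> c * (Q * n + c)" using \<alpha>le c by (rule mult_left_mono)
      moreover have "(Q * n)\<^sup>2 + c * (Q * n + c) \<le> (Q * n + c)\<^sup>2"
        using mult_nonneg_nonneg[OF Qn c] by (simp add: power2_eq_square algebra_simps)
      moreover have "0 \<le> (w t)\<^sup>2" by simp
      ultimately have "(q t)\<^sup>2 \<le> 2 * (Q * n + c)\<^sup>2" using bal[of t] t unfolding c_def[symmetric] by linarith
      also have "\<dots> \<le> (2 * (Q * n + c))\<^sup>2" unfolding power_mult_distrib by (rule mult_right_mono) auto
      finally have "q t \<le> 2 * (Q * n + c)" by (rule power2_le_imp_le) (use Qn c in simp)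
      then show ?thesis using S by simp
    qed
    ultimately show ?thesis unfolding w_def q_def \<xi>_def n_def by (simp add: mult_ac)
  qed
  show "grows 1 (\<lambda>t z. sqrt (lf (B (blinfun_apply A (snd (prim z t)))) (B (blinfun_apply A (snd (prim z t))))))"
    by (rule growsI[of _ "2 * M"]) (use main RBc_nonneg[OF displacement_RBc] in simp)
  have "grows 1 (\<lambda>t z. sqrt (af (snd (blinfun_apply (T t) z)) (snd (blinfun_apply (T t) z))))"
    by (rule growsI[of _ M]) (use main af_nonneg in simp)
  then show "grows 1 (\<lambda>t z. blinfun_apply A (snd (blinfun_apply (T t) z)))"
    by (rule grows_le[OF grows_cmult[of _ _ CA]]) (use CA af_nonneg in \<open>simp add: abs_mult\<close>)
qed

end

section \<open>The component in \<open>ker A\<close> when A is injective on the closed range of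
  B'LBA\<close>

context separable_hamiltonian
begin

lemma subspace_range_BLBA: "subspace (range_BLBA L A D B)"
  unfolding subspace_def
proof (intro conjI ballI allI)
  show "0 \<in> range_BLBA L A D B" unfolding range_BLBA_def
    by (intro CollectI exI[of _ 0]) (simp add: blinfun.zero_right B_0 Bd_0 subspace_0[OF subspace_D])
  fix x assume "x \<in> range_BLBA L A D B"
  then obtain c where c: "blinfun_apply A c \<in> D" "blinfun_apply L (B (blinfun_apply A c)) \<in> Dd"
    "x = Bd (blinfun_apply L (B (blinfun_apply A c)))" unfolding range_BLBA_def by blast
  have "blinfun_apply A (r *\<^sub>R c) \<in> D" "blinfun_apply L (B (blinfun_apply A (r *\<^sub>R c))) \<in> Dd"
    "r *\<^sub>R x = Bd (blinfun_apply L (B (blinfun_apply A (r *\<^sub>R c))))" for r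
    using c subspace_scale[OF subspace_D] by (simp_all add: blinfun.scaleR_right B_scale Bd_scale)
  then show "r *\<^sub>R x \<in> range_BLBA L A D B" for r unfolding range_BLBA_def by blast
  fix y assume "y \<in> range_BLBA L A D B"
  then obtain d where d: "blinfun_apply A d \<in> D" "blinfun_apply L (B (blinfun_apply A d)) \<in> Dd"
    "y = Bd (blinfun_apply L (B (blinfun_apply A d)))" unfolding range_BLBA_def by blast
  have "blinfun_apply A (c + d) \<in> D" "blinfun_apply L (B (blinfun_apply A (c + d))) \<in> Dd"
    "x + y = Bd (blinfun_apply L (B (blinfun_apply A (c + d))))"
    using c d subspace_add[OF subspace_D] by (simp_all add: blinfun.add_right B_add Bd_add)
  then show "x + y \<in> range_BLBA L A D B" unfolding range_BLBA_def by blast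
qed

text \<open>(\<xi>, 0) = G (0, c), so its displacement is G applied twice to an integrated orbit,
  and the Y component of G (G p) is - B' L B A (snd p).\<close>

lemma snd_T_RBc: "\<xi> \<in> RBc \<Longrightarrow> snd (blinfun_apply (T h) (\<xi>, 0)) \<in> range_BLBA L A D B"
proof -
  assume "\<xi> \<in> RBc"
  then obtain c where c: "blinfun_apply A c \<in> D" "\<xi> = B (blinfun_apply A c)" unfolding RBc_def by blast
  have cD: "(0, c) \<in> dG" and Gc: "G (0, c) = (\<xi>, 0)"
    using c Bd_0 by (simp_all add: dG_iff G_eq blinfun.zero_right)
  define p where "p = prim (0, c) h"
  have Gp: "G p = blinfun_apply (T h) (0, c) - (0, c)" unfolding p_def by (rule prim(4))
  have GpD: "G p \<in> dG" unfolding Gp by (intro subspace_diff[OF subspace_dG] T_commute_G cD)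
  have "G (G p) = blinfun_apply (T h) (\<xi>, 0) - (\<xi>, 0)"
    unfolding Gp G_diff[OF T_commute_G(1)[OF cD] cD] T_commute_G(2)[OF cD] Gc ..
  then have "snd (blinfun_apply (T h) (\<xi>, 0)) = snd (G (G p))" by simp
  also have "\<dots> = - Bd (blinfun_apply L (B (blinfun_apply A (snd p))))" by (simp add: G_eq)
  also have "\<dots> \<in> range_BLBA L A D B"
  proof (rule subspace_neg[OF subspace_range_BLBA])
    have "blinfun_apply A (snd p) \<in> D" unfolding p_def by (rule prim_dom)
    moreover have "blinfun_apply L (B (blinfun_apply A (snd p))) \<in> Dd" using GpD by (simp add: dG_iff G_eq)
    ultimately show "Bd (blinfun_apply L (B (blinfun_apply A (snd p)))) \<in> range_BLBA L A D B"
      unfolding range_BLBA_def by blast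
  qed
  finally show ?thesis .
qed

text \<open>The functional \<open>\<Phi> x\<close> represents the part of \<open>B' L x\<close> in \<open>ker A\<close>; it is defined for all \<open>x\<close>.\<close>

definition Phi :: "'x \<Rightarrow> 'y \<Rightarrow>\<^sub>L real" where "Phi x = blinfun_apply L x o\<^sub>L Blinfun kap"

lemma Phi_apply: "blinfun_apply (Phi x) \<eta> = lf x (kap \<eta>)"
  by (simp add: Phi_def bounded_linear_Blinfun_apply[OF bounded_linear_kap])

lemma bounded_linear_Phi: "bounded_linear Phi"
  unfolding Phi_def[abs_def]
  by (rule bounded_linear_compose[OF bounded_bilinear.bounded_linear_left[OF bounded_bilinear_blinfun_compose]
        blinfun.bounded_linear_right])

lemma Phi_Px: "Phi (Px x) = Phi x"
  by (simp add: Phi_def L_Px)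

text \<open>By \<open>kap_dual\<close> the component is its own test vector for
  \<open>Phi x\<close>.\<close>

lemma ker_component_le_Phi:
  assumes "blinfun_apply L x \<in> Dd"
  shows "norm (Bd (blinfun_apply L x) - Py (Bd (blinfun_apply L x))) \<le> norm (Phi x)"
proof -
  define \<eta> where "\<eta> = Bd (blinfun_apply L x) - Py (Bd (blinfun_apply L x))"
  have "norm \<eta> * norm \<eta> = blinfun_apply (Phi x) \<eta>"
    unfolding Phi_apply kap_dual[OF assms] \<eta>_def[symmetric] by (simp add: power2_norm_eq_inner[symmetric] power2_eq_square)
  also have "\<dots> \<le> norm (Phi x) * norm \<eta>" using norm_blinfun[of "Phi x" \<eta>] by simp
  finally show ?thesis unfolding \<eta>_def[symmetric] by (cases "\<eta> = 0") auto
qed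

text \<open>L n kills \<open>RBc\<close> by Cauchy-Schwarz and \<open>EuX\<close> by orthogonality,
  hence the whole range of B A; so y = B' L n exists and A y = 0. But y also lies in the closure of
  the range of B' L B A, where A is injective, so y = 0 and with it Phi n.\<close>

lemma Phi_null_limit:
  assumes inj: "inj_on (blinfun_apply A) (closure (range_BLBA L A D B))"
    and v: "\<And>j. v j \<in> RBc" and q0: "(\<lambda>j. sqrt (lf (v j) (v j))) \<longlonglongrightarrow> 0"
    and n: "(\<lambda>j. Px (v j)) \<longlonglongrightarrow> n"
  shows "Phi n = 0"
proof -
  interpret l: bounded_bilinear lf by (rule bounded_bilinear_lf)
  have Lv: "(\<lambda>j. lf (v j) x) \<longlonglongrightarrow> lf n x" for x
    using l.tendsto[OF n tendsto_const[of x]] by (simp add: L_Px)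
  have 1: "lf n x = 0" if x: "x \<in> RBc" for x
  proof -
    have "(\<lambda>j. sqrt (lf (v j) (v j)) * sqrt (lf x x)) \<longlonglongrightarrow> 0 * sqrt (lf x x)" by (intro tendsto_mult q0 tendsto_const)
    then have a0: "(\<lambda>j. sqrt (lf (v j) (v j)) * sqrt (lf x x)) \<longlonglongrightarrow> 0" by simp
    have le: "norm (lf (v j) x) \<le> sqrt (lf (v j) (v j)) * sqrt (lf x x)" for j
      using form_Cauchy_Schwarz_sqrt[OF bounded_bilinear_lf lf_commute subspace_RBc RBc_nonneg v x] by simp
    have "(\<lambda>j. lf (v j) x) \<longlonglongrightarrow> 0" by (rule Lim_null_comparison[OF always_eventually[OF allI[OF le]] a0])
    then show ?thesis using Lv LIMSEQ_unique by blast
  qed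
  have 2: "lf n x = 0" if x: "x \<in> EuX" for x
  proof -
    have "lf (v j) x = 0" for j using RBc_Xc[OF v] x by (simp add: Xc_iff)
    then show ?thesis using Lv[of x] by (simp add: LIMSEQ_const_iff)
  qed
  have ann: "lf n (B (blinfun_apply A c)) = 0" if c: "blinfun_apply A c \<in> D" for c
  proof -
    obtain f where f: "f \<in> EuY" "c - f \<in> Yc" using Y_decomposition by blast
    have D': "blinfun_apply A (c - f) \<in> D"
      using subspace_diff[OF subspace_D c EuY_BA(1)[OF f(1)]] by (simp add: blinfun.diff_right)
    have "B (blinfun_apply A c) = B (blinfun_apply A f) + B (blinfun_apply A (c - f))"
      using B_add[OF EuY_BA(1)[OF f(1)] D'] by (simp add: blinfun.diff_right)
    moreover have "B (blinfun_apply A (c - f)) \<in> RBc" using f(2) D' unfolding RBc_def by blast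
    ultimately show ?thesis using 1 2[OF EuY_BA(2)[OF f(1)]] by (simp add: blinfun.add_right)
  qed
  note N = annihilates_range_BA[of "blinfun_apply L n", OF ann]
  define y where "y = Bd (blinfun_apply L n)"
  define R where "R = closure (range_BLBA L A D B)"
  have subR: "subspace R" unfolding R_def by (rule subspace_closure[OF subspace_range_BLBA])
  have clR: "closed R" by (simp add: R_def)
  have nD: "(n, 0) \<in> dG" and Gn: "G (n, 0) = (0, - y)"
    using N(1) subspace_0[OF subspace_D] by (simp_all add: dG_iff G_eq y_def blinfun.zero_right B_0)
  have TR: "snd (blinfun_apply (T h) (n, 0)) \<in> R" for h
  proof (rule closed_sequentially[OF clR])
    have "(\<lambda>j. snd (blinfun_apply (T h) (Px (v j), 0))) \<longlonglongrightarrow> snd (blinfun_apply (T h) (n, 0))"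
      by (intro tendsto_intros n)
    then show "(\<lambda>j. snd (blinfun_apply (T h) (Px (v j), 0))) \<longlonglongrightarrow> snd (blinfun_apply (T h) (n, 0))" .
    show "snd (blinfun_apply (T h) (Px (v j), 0)) \<in> R" for j
    proof -
      \<comment> \<open>Only \<open>Px (v j)\<close> converges, not \<open>v j\<close>. Their
        difference lies in \<open>ker L\<close>, is fixed by the group and contributes nothing to
        the Y component.\<close>
      have "blinfun_apply (T h) (Px (v j) - v j, 0) = (Px (v j) - v j, 0)"
        by (intro T_fixes_kernel kernel_L) (simp_all add: blinfun.diff_right blinfun.zero_right L_Px)
      moreover have "(Px (v j), 0) = (Px (v j) - v j, 0) + (v j, 0 :: 'y)" by simp
      ultimately have "snd (blinfun_apply (T h) (Px (v j), 0)) = snd (blinfun_apply (T h) (v j, 0))"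
        by (simp only: blinfun.add_right) simp
      also have "\<dots> \<in> R" unfolding R_def by (rule subsetD[OF closure_subset snd_T_RBc[OF v]])
      finally show ?thesis .
    qed
  qed
  \<comment> \<open>The Y component of the orbit from (n, 0) starts at 0 and stays in
    \<open>R\<close>, so its derivative at time 0, which is - y, belongs to the closed subspace
    \<open>R\<close>.\<close>
  have "(\<lambda>h. (1 / h) *\<^sub>R snd (blinfun_apply (T h) (n, 0))) \<midarrow>0\<rightarrow> - y"
    using tendsto_snd[OF generator_limit[OF nD]] by (simp add: Gn)
  then have "- y \<in> R"
    by (rule Lim_in_closed_set[OF clR _ trivial_limit_at, rotated])
      (intro always_eventually allI subspace_scale[OF subR] TR)
  then have "y \<in> R" using subspace_neg[OF subR, of "- y"] by simp
  moreover have "blinfun_apply A y = blinfun_apply A 0" using N(2) by (simp add: y_def blinfun.zero_right)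
  ultimately have "y = 0" using inj subspace_0[OF subR] unfolding R_def inj_on_def by blast
  then show ?thesis using N(3) by (intro blinfun_eqI) (simp add: Phi_apply y_def)
qed

lemma Phi_le_seminorm:
  assumes inj: "inj_on (blinfun_apply A) (closure (range_BLBA L A D B))"
  obtains C where "\<And>x. x \<in> RBc \<Longrightarrow> norm (Phi x) \<le> C * sqrt (lf x x)"
proof -
  interpret P: bounded_linear Px by (rule bounded_linear_Px)
  interpret F: bounded_linear Phi by (rule bounded_linear_Phi)
  interpret l: bounded_bilinear lf by (rule bounded_bilinear_lf)
  obtain I :: "'x set" and g and CP where g: "finite I" "0 \<le> CP" "\<And>e. e \<in> I \<Longrightarrow> g e \<in> Dd"
    "\<And>x. 0 \<le> lf x x \<Longrightarrow> norm (Px x) \<le> CP * (sqrt (lf x x) + (\<Sum>e\<in>I. \<bar>blinfun_apply (g e) x\<bar>))"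
    by (rule Px_le_seminorm) blast
  obtain K where K: "0 \<le> K" "\<And>x. norm (Phi x) \<le> norm x * K" using F.nonneg_bounded by blast
  define q where "q x = sqrt (lf x x)" for x
  have q_add: "q (x + y) \<le> q x + q y" if "x \<in> RBc" "y \<in> RBc" for x y
    unfolding q_def by (rule form_seminorm_triangle[OF bounded_bilinear_lf lf_commute subspace_RBc RBc_nonneg that])
  have q_scale: "q (c *\<^sub>R x) = \<bar>c\<bar> * q x" for c x
    by (simp add: q_def l.scaleR_left l.scaleR_right real_sqrt_mult mult.assoc[symmetric] flip: power2_eq_square)
  have "\<exists>C. \<forall>x\<in>RBc. norm (Phi x) \<le> C * q x"
  proof (rule drop_finitely_many_functionals[where I = I and g = "\<lambda>e. blinfun_apply (g e)" and C = "K * CP"])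
    show "norm (Phi x) \<le> K * CP * (q x + (\<Sum>e\<in>I. \<bar>blinfun_apply (g e) x\<bar>))" if "x \<in> RBc" for x
      using K(2)[of "Px x"] mult_right_mono[OF g(4)[OF RBc_nonneg[OF that]] K(1)]
      unfolding q_def Phi_Px by (simp add: mult_ac)
    show "(\<lambda>j. Phi (v j)) \<longlonglongrightarrow> 0" if v: "\<And>j. v j \<in> RBc" and q0: "(\<lambda>j. q (v j)) \<longlonglongrightarrow> 0"
      and c: "\<And>e. e \<in> I \<Longrightarrow> convergent (\<lambda>j. blinfun_apply (g e) (v j))" for v
    proof -
      define l where "l e = lim (\<lambda>j. blinfun_apply (g e) (v j))" for e
      have l: "(\<lambda>j. blinfun_apply (g e) (v j)) \<longlonglongrightarrow> l e" if "e \<in> I" for e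
        using c[OF that] unfolding l_def convergent_LIMSEQ_iff .
      define r where "r j = CP * (q (v j) + (\<Sum>e\<in>I. \<bar>blinfun_apply (g e) (v j) - l e\<bar>))" for j
      have "r \<longlonglongrightarrow> CP * (0 + (\<Sum>e\<in>I. \<bar>l e - l e\<bar>))" unfolding r_def
        by (intro tendsto_intros q0 l)
      then have r: "r \<longlonglongrightarrow> 0" by simp
      have dist: "norm (Px (v i) - Px (v j)) \<le> r i + r j" for i j
      proof -
        have d: "v i - v j \<in> RBc" using v by (intro subspace_diff[OF subspace_RBc])
        have qd: "q (v i - v j) \<le> q (v i) + q (v j)"
          using q_add[OF v[of i] subspace_scale[OF subspace_RBc v[of j], of "-1"]] q_scale[of "-1" "v j"] by simp
        have "(\<Sum>e\<in>I. \<bar>blinfun_apply (g e) (v i - v j)\<bar>)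
            \<le> (\<Sum>e\<in>I. \<bar>blinfun_apply (g e) (v i) - l e\<bar> + \<bar>blinfun_apply (g e) (v j) - l e\<bar>)"
          by (intro sum_mono) (simp add: blinfun.diff_right)
        then have "q (v i - v j) + (\<Sum>e\<in>I. \<bar>blinfun_apply (g e) (v i - v j)\<bar>)
            \<le> (q (v i) + (\<Sum>e\<in>I. \<bar>blinfun_apply (g e) (v i) - l e\<bar>)) + (q (v j) + (\<Sum>e\<in>I. \<bar>blinfun_apply (g e) (v j) - l e\<bar>))"
          using qd by (simp add: sum.distrib)
        then have "CP * (q (v i - v j) + (\<Sum>e\<in>I. \<bar>blinfun_apply (g e) (v i - v j)\<bar>)) \<le> r i + r j"
          unfolding r_def distrib_left[symmetric] by (rule mult_left_mono[OF _ g(2)])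
        then show ?thesis using g(4)[OF RBc_nonneg[OF d]] by (simp add: q_def P.diff)
      qed
      have "Cauchy (\<lambda>j. Px (v j))"
      proof (rule Cauchy_if_square_dist_le)
        show "(norm (Px (v i) - Px (v j)))\<^sup>2 \<le> 2 * (r i)\<^sup>2 + 2 * (r j)\<^sup>2" for i j
        proof -
          have "(norm (Px (v i) - Px (v j)))\<^sup>2 \<le> (r i + r j)\<^sup>2" using dist by (intro power_mono) auto
          also have "\<dots> \<le> 2 * (r i)\<^sup>2 + 2 * (r j)\<^sup>2"
            using zero_le_power2[of "r i - r j"] by (simp add: power2_eq_square algebra_simps)
          finally show ?thesis .
        qed
        have "(\<lambda>j. 2 * (r j)\<^sup>2) \<longlonglongrightarrow> 2 * 0\<^sup>2" by (intro tendsto_intros r)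
        then show "(\<lambda>j. 2 * (r j)\<^sup>2) \<longlonglongrightarrow> 0" by simp
      qed
      then obtain n where n: "(\<lambda>j. Px (v j)) \<longlonglongrightarrow> n" using Cauchy_convergent convergent_def by blast
      have "Phi n = 0" by (rule Phi_null_limit[OF inj v q0[unfolded q_def] n])
      then show ?thesis using F.tendsto[OF n] by (simp add: Phi_Px)
    qed
    show "linear (blinfun_apply (g i))" for i by (rule bounded_linear.linear[OF blinfun.bounded_linear_right])
    show "linear Phi" by (rule F.linear)
  qed (use g(1) subspace_RBc q_add q_scale in auto)
  then show ?thesis using that unfolding q_def by blast
qed

text \<open>Velocity is linear in t, so A of its integral, Px x(t) and the component in
  \<open>ker L\<close> are quadratic. Integrating the bound for Px x(t) would give a cubic one for
  the component in \<open>ker A\<close>; \<open>Phi_le_seminorm\<close> makes Phi x(t) linear and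
  saves that power.\<close>

lemma growth_injective:
  assumes inj: "inj_on (blinfun_apply A) (closure (range_BLBA L A D B))"
  shows "grows 2 (\<lambda>t. blinfun_apply (T t))"
proof -
  note gA = linear_growth_of_velocity(1) and gq = linear_growth_of_velocity(2)
  have gAp: "grows 2 (\<lambda>t z. blinfun_apply A (snd (prim z t)))"
    using grows_prim[OF bounded_linear_A_snd gA] by (simp add: numeral_2_eq_2)
  obtain C where C: "0 \<le> C" "\<And>y. y \<in> Yc \<Longrightarrow> blinfun_apply A y \<in> D \<Longrightarrow>
    norm (Px (B (blinfun_apply A y))) \<le> C * (sqrt (lf (B (blinfun_apply A y)) (B (blinfun_apply A y))) + norm (blinfun_apply A y))"
    by (rule Px_RBc_bound) blast
  have Yc: "snd (prim z t) \<in> Yc" if "z \<in> Ec" for t z using prim_Ec[OF that, of t] by (simp add: Ec_split)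
  have g\<xi>: "grows 2 (\<lambda>t z. Px (B (blinfun_apply A (snd (prim z t)))))"
  proof (rule grows_le)
    show "grows 2 (\<lambda>t z. C * (sqrt (lf (B (blinfun_apply A (snd (prim z t)))) (B (blinfun_apply A (snd (prim z t)))))
        + norm (blinfun_apply A (snd (prim z t)))))"
      by (intro grows_cmult grows_add grows_norm gAp grows_mono[OF gq]) simp
    show "norm (Px (B (blinfun_apply A (snd (prim z t))))) \<le> norm (C * (sqrt (lf (B (blinfun_apply A (snd (prim z t)))) (B (blinfun_apply A (snd (prim z t)))))
        + norm (blinfun_apply A (snd (prim z t)))))" if "z \<in> Ec" for t z
      using C(2)[OF Yc[OF that] prim_dom(2)] unfolding real_norm_def by (rule order_trans[OF _ abs_ge_self])
  qed
  have "grows 2 (\<lambda>t z. Px (fst z))"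
    by (intro grows_initial bounded_linear_compose[OF bounded_linear_Px] bounded_linear_fst)
  from grows_add[OF this g\<xi>] have gPx: "grows 2 (\<lambda>t z. Px (fst (blinfun_apply (T t) z)))"
    by (simp add: fst_T linear_add[OF bounded_linear.linear[OF bounded_linear_Px]])
  obtain CF where CF: "\<And>x. x \<in> RBc \<Longrightarrow> norm (Phi x) \<le> CF * sqrt (lf x x)"
    by (rule Phi_le_seminorm[OF inj]) blast
  have "grows 1 (\<lambda>t z. Phi (B (blinfun_apply A (snd (prim z t)))))"
  proof (rule grows_le[OF grows_cmult[OF gq, of CF]])
    show "norm (Phi (B (blinfun_apply A (snd (prim z t))))) \<le> norm (CF * sqrt (lf (B (blinfun_apply A (snd (prim z t)))) (B (blinfun_apply A (snd (prim z t))))))"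
      if "z \<in> Ec" for t z
      using CF[OF displacement_RBc[OF that]] unfolding real_norm_def by (rule order_trans[OF _ abs_ge_self])
  qed
  moreover have "grows 1 (\<lambda>t z. Phi (fst z))"
    by (intro grows_initial bounded_linear_compose[OF bounded_linear_Phi] bounded_linear_fst)
  ultimately have "grows 1 (\<lambda>t z. Phi (fst z) + Phi (B (blinfun_apply A (snd (prim z t)))))" by (rule grows_add[rotated])
  then have "grows 1 (\<lambda>t z. Phi (fst (blinfun_apply (T t) z)))"
    by (simp add: fst_T linear_add[OF bounded_linear.linear[OF bounded_linear_Phi]])
  from grows_prim[OF bounded_linear_compose[OF bounded_linear_Phi bounded_linear_fst] this]
  have gF: "grows 2 (\<lambda>t z. Phi (fst (prim z t)))" by (simp add: numeral_2_eq_2)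
  have "grows 2 (\<lambda>t z. Bd (blinfun_apply L (fst (prim z t))) - Py (Bd (blinfun_apply L (fst (prim z t)))))"
    by (rule grows_le[OF gF]) (rule ker_component_le_Phi[OF prim_dom(1)])
  from grows_ker_component_snd[OF this] show ?thesis
    by (intro grows_T gPx grows_ker_component_fst[OF gAp] grows_mono[OF grows_Py[OF gA]]) auto
qed

end

theorem theorem2p2:
  fixes L :: "'x::{real_inner,complete_space} \<Rightarrow>\<^sub>L ('x \<Rightarrow>\<^sub>L real)"
    and A :: "'y::{real_inner,complete_space} \<Rightarrow>\<^sub>L ('y \<Rightarrow>\<^sub>L real)"
    and D :: "('y \<Rightarrow>\<^sub>L real) set"
    and B :: "('y \<Rightarrow>\<^sub>L real) \<Rightarrow> 'x"
    and Xm Xp :: "'x set"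
    and Yp :: "'y set"
    and T :: "real \<Rightarrow> ('x \<times> 'y) \<Rightarrow>\<^sub>L ('x \<times> 'y)"
  assumes "G1 D B"
    and "G2 A Yp"
    and "G3 L Xm Xp"
    and "G4 D B Xm Xp Yp"
    and "generates_C0_group (JL_dom L A D B) (JL_op L A D B) T"
  shows
    "(inj_on (blinfun_apply A) (closure (range_BLBA L A D B)) \<longrightarrow>
        (\<exists>M>0. \<forall>t. \<forall>z\<in>E_c L A D B.
           norm (blinfun_apply (T t) z) \<le> M * (1 + t\<^sup>2) * norm z)) \<and>
     (closure (range_BA A D B) = UNIV \<longrightarrow>
        (\<exists>M>0. \<forall>t. \<forall>z\<in>E_c L A D B.
           norm (blinfun_apply (T t) z) \<le> M * (1 + \<bar>t\<bar>) * norm z)) \<and>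
     (nondegenerate_on (closure (B ` D)) (\<lambda>u v. blinfun_apply (blinfun_apply L u) v) \<and>
      nondegenerate_on (closure (dual_op D B ` dual_dom D B))
        (\<lambda>u v. blinfun_apply (blinfun_apply A u) v) \<longrightarrow>
        (\<exists>M>0. \<forall>t. \<forall>z\<in>E_c L A D B. norm (blinfun_apply (T t) z) \<le> M * norm z))"
proof (intro conjI impI)
  interpret separable_hamiltonian L A D B Xm Xp Yp T using assms by unfold_locales
  {
    assume "inj_on (blinfun_apply A) (closure (range_BLBA L A D B))"
    from grows_both_directions[OF growth_injective[OF this]]
    obtain M where M: "0 < M" "\<And>t z. z \<in> Ec \<Longrightarrow> norm (blinfun_apply (T t) z) \<le> M * (1 + \<bar>t\<bar>)\<^sup>2 * norm z"
      by blast
    have "norm (blinfun_apply (T t) z) \<le> (2 * M) * (1 + t\<^sup>2) * norm z" if "z \<in> Ec" for t z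
    proof -
      \<comment> \<open>From (1 - |t|)^2 >= 0; this doubles the constant.\<close>
      have "(1 + \<bar>t\<bar>)\<^sup>2 \<le> 2 * (1 + t\<^sup>2)"
        using zero_le_power2[of "1 - \<bar>t\<bar>"] by (simp add: power2_sum power2_diff)
      then have "M * (1 + \<bar>t\<bar>)\<^sup>2 * norm z \<le> M * (2 * (1 + t\<^sup>2)) * norm z"
        using M(1) by (intro mult_right_mono mult_left_mono) auto
      then show ?thesis using M(2)[OF that, of t] by (simp add: mult_ac)
    qed
    then show "\<exists>M>0. \<forall>t. \<forall>z\<in>Ec. norm (blinfun_apply (T t) z) \<le> M * (1 + t\<^sup>2) * norm z"
      using M(1) by (intro exI[of _ "2 * M"]) auto
  }
  {
    assume "closure (range_BA A D B) = UNIV"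
    from grows_both_directions[OF growth_dense_range[OF this]]
    show "\<exists>M>0. \<forall>t. \<forall>z\<in>Ec. norm (blinfun_apply (T t) z) \<le> M * (1 + \<bar>t\<bar>) * norm z"
      by (metis power_one_right)
  }
  {
    assume "nondegenerate_on (closure (B ` D)) (\<lambda>u v. lf u v) \<and>
      nondegenerate_on (closure (Bd ` Dd)) (\<lambda>u v. af u v)"
    then show "\<exists>M>0. \<forall>t. \<forall>z\<in>Ec. norm (blinfun_apply (T t) z) \<le> M * norm z"
      using bounded_nondegenerate by metis
  }
qed

end
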